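(* Let $X$ be an infinite-dimensional (real or complex) Banach space and let $T\in\mathcal{B}(X)$ be a bounded linear operator such that either $\sigma(T)\subseteq\mathbb{R}$, or $\sigma(T)\cap\mathbb{R}$ has infinite cardinality. Then $T^*$ admits an almost-invariant halfspace of defect $\leq 1$.
   Context: $\mathcal{B}(X)$ is the algebra of bounded linear operators on $X$, and $T^*\in\mathcal{B}(X^* )$ is the Banach-space adjoint. If $X$ is complex, $\sigma(T)$ is the usual spectrum. If $X$ is real, its complexification is $X_\mathbb{C}=X\oplus iX$ with the usual complex vector space structure and a standard complete norm equivalent to $\|x\|+\|y\|$; $T_\mathbb{C}\in\mathcal{B}(X_\mathbb{C})$ is $T_\mathbb{C}(x\oplus iy)=Tx\oplus iTy$, and $\sigma(T):=\sigma(T_\mathbb{C})$. In the real case $\sigma(T)\cap\mathbb{R}$ equals the real spectrum $\sigma_\mathbb{R}(T)=\{\lambda\in\mathbb{R}:\lambda-T\text{ is not invertible in }\mathcal{B}(X)\}$. A halfspace of a Banach space $Z$ is a norm-closed subspace $Y$ with $\dim(Y)=\dim(Z/Y)=\infty$. For $R\in\mathcal{B}(Z)$, an almost-invariant halfspace under $R$ of defect $\leq d$ is a halfspace $Y$ of $Z$ such that $RY\subseteq Y+E$ for some subspace $E$ of $Z$ with $\dim(E)\leq d$. *)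

theory Defs
  imports "HOL-Analysis.Analysis"
begin

section \<open>Complex Banach spaces\<close>

class complex_normed_vector = real_normed_vector +
  fixes scaleC :: "complex \<Rightarrow> 'a \<Rightarrow> 'a" (infixr \<open>*\<^sub>C\<close> 75)
  assumes scaleC_add_right: "c *\<^sub>C (x + y) = c *\<^sub>C x + c *\<^sub>C y"
    and scaleC_add_left: "(c + d) *\<^sub>C x = c *\<^sub>C x + d *\<^sub>C x"
    and scaleC_scaleC: "c *\<^sub>C d *\<^sub>C x = (c * d) *\<^sub>C x"
    and scaleR_scaleC: "r *\<^sub>R x = complex_of_real r *\<^sub>C x"
    and norm_scaleC: "norm (c *\<^sub>C x) = cmod c * norm x"

class cbanach = complex_normed_vector + banach

lemma vector_space_scaleC: "vector_space (scaleC :: complex \<Rightarrow> 'a::complex_normed_vector \<Rightarrow> 'a)"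
proof
  show "1 *\<^sub>C x = x" for x :: 'a
    using scaleR_scaleC[of 1 x] by simp
qed (simp_all add: scaleC_add_right scaleC_add_left scaleC_scaleC)

lemma module_scaleC: "module (scaleC :: complex \<Rightarrow> 'a::complex_normed_vector \<Rightarrow> 'a)"
  using vector_space_scaleC by (rule module_iff_vector_space[THEN iffD2])

lemma scaleC_one: "1 *\<^sub>C x = x" for x :: "'a::complex_normed_vector"
  using scaleR_scaleC[of 1 x] by simp

lemma bounded_linear_scaleC: "bounded_linear (\<lambda>x :: 'a::complex_normed_vector. c *\<^sub>C x)"
proof (rule bounded_linear_intro[where K = "cmod c"])
  show "c *\<^sub>C r *\<^sub>R x = r *\<^sub>R c *\<^sub>C x" for r and x :: 'a
    by (simp only: scaleR_scaleC scaleC_scaleC mult.commute)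
qed (simp_all add: scaleC_add_right norm_scaleC mult.commute)

instantiation complex :: cbanach
begin

definition scaleC_complex :: "complex \<Rightarrow> complex \<Rightarrow> complex"
  where "scaleC_complex c z = c * z"

instance
  by standard
    (simp_all add: scaleC_complex_def algebra_simps scaleR_conv_of_real norm_mult)

end


section \<open>Bounded complex-linear operators\<close>

typedef (overloaded) ('a, 'b) cblinfun (\<open>(_ \<Rightarrow>\<^sub>C\<^sub>L /_)\<close> [22, 21] 21) =
  "{f :: 'a::complex_normed_vector \<Rightarrow>\<^sub>L 'b::complex_normed_vector. \<forall>c x. f (c *\<^sub>C x) = c *\<^sub>C f x}"
  morphisms blinfun_of_cblinfun cblinfun_of_blinfun
proof
  show "0 \<in> {f :: 'a \<Rightarrow>\<^sub>L 'b. \<forall>c x. f (c *\<^sub>C x) = c *\<^sub>C f x}"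
    using module.scale_zero_right[OF module_scaleC] by auto
qed

setup_lifting type_definition_cblinfun

lemma blinfun_of_cblinfun_scaleC: "blinfun_of_cblinfun f (c *\<^sub>C x) = c *\<^sub>C blinfun_of_cblinfun f x"
  using blinfun_of_cblinfun[of f] by simp

lemma Blinfun_scaleC: "blinfun_apply (Blinfun (\<lambda>x. c *\<^sub>C f x)) = (\<lambda>x. c *\<^sub>C f x)"
  for f :: "'a::complex_normed_vector \<Rightarrow>\<^sub>L 'b::complex_normed_vector"
  by (intro bounded_linear_Blinfun_apply bounded_linear_compose[OF bounded_linear_scaleC]
      blinfun.bounded_linear_right)

instantiation cblinfun :: (complex_normed_vector, complex_normed_vector) complex_normed_vector
begin

lift_definition zero_cblinfun :: "'a \<Rightarrow>\<^sub>C\<^sub>L 'b" is 0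
  using module.scale_zero_right[OF module_scaleC] by auto

lift_definition plus_cblinfun :: "'a \<Rightarrow>\<^sub>C\<^sub>L 'b \<Rightarrow> 'a \<Rightarrow>\<^sub>C\<^sub>L 'b \<Rightarrow> 'a \<Rightarrow>\<^sub>C\<^sub>L 'b" is "(+)"
  by (simp add: plus_blinfun.rep_eq scaleC_add_right)

lift_definition minus_cblinfun :: "'a \<Rightarrow>\<^sub>C\<^sub>L 'b \<Rightarrow> 'a \<Rightarrow>\<^sub>C\<^sub>L 'b \<Rightarrow> 'a \<Rightarrow>\<^sub>C\<^sub>L 'b" is "(-)"
  by (simp add: minus_blinfun.rep_eq module.scale_right_diff_distrib[OF module_scaleC])

lift_definition uminus_cblinfun :: "'a \<Rightarrow>\<^sub>C\<^sub>L 'b \<Rightarrow> 'a \<Rightarrow>\<^sub>C\<^sub>L 'b" is uminus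
  by (simp add: uminus_blinfun.rep_eq module.scale_minus_right[OF module_scaleC])

lift_definition scaleC_cblinfun :: "complex \<Rightarrow> 'a \<Rightarrow>\<^sub>C\<^sub>L 'b \<Rightarrow> 'a \<Rightarrow>\<^sub>C\<^sub>L 'b"
  is "\<lambda>c f. Blinfun (\<lambda>x. c *\<^sub>C blinfun_apply f x)"
  by (simp add: Blinfun_scaleC scaleC_scaleC mult.commute)

definition scaleR_cblinfun :: "real \<Rightarrow> 'a \<Rightarrow>\<^sub>C\<^sub>L 'b \<Rightarrow> 'a \<Rightarrow>\<^sub>C\<^sub>L 'b"
  where "scaleR_cblinfun r f = complex_of_real r *\<^sub>C f"

lift_definition norm_cblinfun :: "'a \<Rightarrow>\<^sub>C\<^sub>L 'b \<Rightarrow> real" is norm .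

definition dist_cblinfun :: "'a \<Rightarrow>\<^sub>C\<^sub>L 'b \<Rightarrow> 'a \<Rightarrow>\<^sub>C\<^sub>L 'b \<Rightarrow> real"
  where "dist_cblinfun f g = norm (f - g)"

definition sgn_cblinfun :: "'a \<Rightarrow>\<^sub>C\<^sub>L 'b \<Rightarrow> 'a \<Rightarrow>\<^sub>C\<^sub>L 'b"
  where "sgn_cblinfun f = inverse (norm f) *\<^sub>R f"

definition uniformity_cblinfun :: "(('a \<Rightarrow>\<^sub>C\<^sub>L 'b) \<times> ('a \<Rightarrow>\<^sub>C\<^sub>L 'b)) filter"
  where "uniformity_cblinfun = (INF e\<in>{0 <..}. principal {(f, g). dist f g < e})"

definition open_cblinfun :: "('a \<Rightarrow>\<^sub>C\<^sub>L 'b) set \<Rightarrow> bool"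
  where "open_cblinfun U = (\<forall>f\<in>U. \<forall>\<^sub>F (f', g) in uniformity. f' = f \<longrightarrow> g \<in> U)"

lemma scaleC_cblinfun_apply:
  "blinfun_of_cblinfun (c *\<^sub>C f) x = c *\<^sub>C blinfun_of_cblinfun f x" for f :: "'a \<Rightarrow>\<^sub>C\<^sub>L 'b"
  by (simp add: scaleC_cblinfun.rep_eq Blinfun_scaleC)

lemma scaleR_cblinfun_rep:
  "blinfun_of_cblinfun (r *\<^sub>R f) = r *\<^sub>R blinfun_of_cblinfun f" for f :: "'a \<Rightarrow>\<^sub>C\<^sub>L 'b"
  by (rule blinfun_eqI)
    (simp add: scaleR_cblinfun_def scaleC_cblinfun_apply blinfun.scaleR_left scaleR_scaleC)

instance
proof
  fix f g h :: "'a \<Rightarrow>\<^sub>C\<^sub>L 'b" and a b :: real and c d :: complex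
  note ext = blinfun_of_cblinfun_inject[THEN iffD1] blinfun_eqI
  show "f + g + h = f + (g + h)" by transfer simp
  show "f + g = g + f" by transfer simp
  show "0 + f = f" by transfer simp
  show "- f + f = 0" by transfer simp
  show "f - g = f + - g" by transfer simp
  show "a *\<^sub>R (f + g) = a *\<^sub>R f + a *\<^sub>R g"
    by (rule ext(1)) (simp add: scaleR_cblinfun_rep plus_cblinfun.rep_eq scaleR_add_right)
  show "(a + b) *\<^sub>R f = a *\<^sub>R f + b *\<^sub>R f"
    by (rule ext(1)) (simp add: scaleR_cblinfun_rep plus_cblinfun.rep_eq scaleR_add_left)
  show "a *\<^sub>R b *\<^sub>R f = (a * b) *\<^sub>R f"
    by (rule ext(1)) (simp add: scaleR_cblinfun_rep)
  show "1 *\<^sub>R f = f"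
    by (rule ext(1)) (simp add: scaleR_cblinfun_rep)
  show "dist f g = norm (f - g)" by (fact dist_cblinfun_def)
  show "sgn f = inverse (norm f) *\<^sub>R f" by (fact sgn_cblinfun_def)
  show "(uniformity :: (('a \<Rightarrow>\<^sub>C\<^sub>L 'b) \<times> ('a \<Rightarrow>\<^sub>C\<^sub>L 'b)) filter)
      = (INF e\<in>{0 <..}. principal {(f, g). dist f g < e})"
    by (fact uniformity_cblinfun_def)
  show "open U = (\<forall>f\<in>U. \<forall>\<^sub>F (f', g) in uniformity. f' = f \<longrightarrow> g \<in> U)" for U :: "('a \<Rightarrow>\<^sub>C\<^sub>L 'b) set"
    by (fact open_cblinfun_def)
  show "norm f = 0 \<longleftrightarrow> f = 0" by transfer simp
  show "norm (f + g) \<le> norm f + norm g" by transfer (rule norm_triangle_ineq)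
  show "norm (a *\<^sub>R f) = \<bar>a\<bar> * norm f"
    by (simp add: norm_cblinfun.rep_eq scaleR_cblinfun_rep)
  show "c *\<^sub>C (f + g) = c *\<^sub>C f + c *\<^sub>C g"
    by (rule ext(1), rule ext(2))
      (simp add: scaleC_cblinfun_apply plus_cblinfun.rep_eq blinfun.add_left scaleC_add_right)
  show "(c + d) *\<^sub>C f = c *\<^sub>C f + d *\<^sub>C f"
    by (rule ext(1), rule ext(2))
      (simp add: scaleC_cblinfun_apply plus_cblinfun.rep_eq blinfun.add_left scaleC_add_left)
  show "c *\<^sub>C d *\<^sub>C f = (c * d) *\<^sub>C f"
    by (rule ext(1), rule ext(2)) (simp add: scaleC_cblinfun_apply scaleC_scaleC)
  show "a *\<^sub>R f = complex_of_real a *\<^sub>C f" by (fact scaleR_cblinfun_def)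
  show "norm (c *\<^sub>C f) = cmod c * norm f"
  proof (rule antisym)
    have le: "norm (c *\<^sub>C f) \<le> cmod c * norm f" for c and f :: "'a \<Rightarrow>\<^sub>C\<^sub>L 'b"
      unfolding norm_cblinfun.rep_eq
    proof (rule norm_blinfun_bound)
      show "norm (blinfun_of_cblinfun (c *\<^sub>C f) x) \<le> cmod c * norm (blinfun_of_cblinfun f) * norm x" for x
        using mult_left_mono[OF norm_blinfun[of "blinfun_of_cblinfun f" x], of "cmod c"]
        by (simp add: scaleC_cblinfun_apply norm_scaleC mult.assoc)
    qed simp
    show "norm (c *\<^sub>C f) \<le> cmod c * norm f" by (rule le)
    show "cmod c * norm f \<le> norm (c *\<^sub>C f)"
    proof (cases "c = 0")
      case False
      have "inverse c *\<^sub>C c *\<^sub>C f = f"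
        by (rule ext(1), rule ext(2))
          (use False in \<open>simp add: scaleC_cblinfun_apply scaleC_scaleC
            scaleC_one\<close>)
      then have "norm f \<le> inverse (cmod c) * norm (c *\<^sub>C f)"
        using le[of "inverse c" "c *\<^sub>C f"] by (simp add: norm_inverse)
      then show ?thesis
        using False by (simp add: field_simps)
    qed (simp add: norm_cblinfun.rep_eq)
  qed
qed

end

instance cblinfun :: (complex_normed_vector, cbanach) cbanach
proof
  fix F :: "nat \<Rightarrow> 'a \<Rightarrow>\<^sub>C\<^sub>L 'b"
  assume "Cauchy F"
  let ?G = "\<lambda>n. blinfun_of_cblinfun (F n)"
  have dist: "dist (F m) (F n) = dist (?G m) (?G n)" for m n
    by (simp add: dist_norm norm_cblinfun.rep_eq minus_cblinfun.rep_eq)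
  with \<open>Cauchy F\<close> have "Cauchy ?G"
    by (simp add: Cauchy_def)
  then obtain g where g: "?G \<longlonglongrightarrow> g"
    using Cauchy_convergent_iff convergent_def by blast
  have lim: "(\<lambda>n. ?G n x) \<longlonglongrightarrow> g x" for x
    by (intro tendsto_intros g)
  have "g (c *\<^sub>C x) = c *\<^sub>C g x" for c x
  proof (rule LIMSEQ_unique[OF lim])
    from bounded_linear.tendsto[OF bounded_linear_scaleC lim]
    show "(\<lambda>n. ?G n (c *\<^sub>C x)) \<longlonglongrightarrow> c *\<^sub>C g x"
      by (simp add: blinfun_of_cblinfun_scaleC)
  qed
  then have g': "blinfun_of_cblinfun (cblinfun_of_blinfun g) = g"
    by (simp add: cblinfun_of_blinfun_inverse)
  have "F \<longlonglongrightarrow> cblinfun_of_blinfun g"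
    using g by (simp add: tendsto_iff dist_norm norm_cblinfun.rep_eq minus_cblinfun.rep_eq g')
  then show "convergent F"
    by (auto simp: convergent_def)
qed

lift_definition id_cblinfun :: "'a::complex_normed_vector \<Rightarrow>\<^sub>C\<^sub>L 'a" is id_blinfun
  by simp

lift_definition cblinfun_compose ::
  "'b::complex_normed_vector \<Rightarrow>\<^sub>C\<^sub>L 'c::complex_normed_vector \<Rightarrow>
    'a::complex_normed_vector \<Rightarrow>\<^sub>C\<^sub>L 'b \<Rightarrow> 'a \<Rightarrow>\<^sub>C\<^sub>L 'c"  (infixl \<open>o\<^sub>C\<^sub>L\<close> 55) is "(o\<^sub>L)"
  by simp


section \<open>Complexification\<close>

datatype 'a complexification = Oplus (re_part: 'a) (im_part: 'a)

lemma complexification_eqI: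
  "re_part z = re_part w \<Longrightarrow> im_part z = im_part w \<Longrightarrow> z = w"
  by (rule complexification.expand) simp

text \<open>
  The norm is the Taylor norm, the supremum of
  \<open>\<parallel>cos t \<cdot> x - sin t \<cdot> y\<parallel>\<close> over real \<open>t\<close> for the vector \<open>x \<oplus> iy\<close>.
\<close>

instantiation complexification :: (real_normed_vector) complex_normed_vector
begin

definition zero_complexification :: "'a complexification"
  where "zero_complexification = Oplus 0 0"

definition plus_complexification :: "'a complexification \<Rightarrow> 'a complexification \<Rightarrow> 'a complexification"
  where "plus_complexification z w = Oplus (re_part z + re_part w) (im_part z + im_part w)"

definition minus_complexification :: "'a complexification \<Rightarrow> 'a complexification \<Rightarrow> 'a complexification"
  where "minus_complexification z w = Oplus (re_part z - re_part w) (im_part z - im_part w)"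

definition uminus_complexification :: "'a complexification \<Rightarrow> 'a complexification"
  where "uminus_complexification z = Oplus (- re_part z) (- im_part z)"

definition scaleR_complexification :: "real \<Rightarrow> 'a complexification \<Rightarrow> 'a complexification"
  where "scaleR_complexification r z = Oplus (r *\<^sub>R re_part z) (r *\<^sub>R im_part z)"

definition scaleC_complexification :: "complex \<Rightarrow> 'a complexification \<Rightarrow> 'a complexification"
  where "scaleC_complexification c z =
    Oplus (Re c *\<^sub>R re_part z - Im c *\<^sub>R im_part z) (Re c *\<^sub>R im_part z + Im c *\<^sub>R re_part z)"

definition norm_complexification :: "'a complexification \<Rightarrow> real"
  where "norm_complexification z = (SUP u\<in>sphere (0::complex) 1. norm (re_part (u *\<^sub>C z)))"

definition dist_complexification :: "'a complexification \<Rightarrow> 'a complexification \<Rightarrow> real"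
  where "dist_complexification z w = norm (z - w)"

definition sgn_complexification :: "'a complexification \<Rightarrow> 'a complexification"
  where "sgn_complexification z = inverse (norm z) *\<^sub>R z"

definition uniformity_complexification :: "('a complexification \<times> 'a complexification) filter"
  where "uniformity_complexification = (INF e\<in>{0 <..}. principal {(z, w). dist z w < e})"

definition open_complexification :: "'a complexification set \<Rightarrow> bool"
  where "open_complexification U = (\<forall>z\<in>U. \<forall>\<^sub>F (z', w) in uniformity. z' = z \<longrightarrow> w \<in> U)"

lemmas complexification_arith_defs = zero_complexification_def plus_complexification_def
  minus_complexification_def uminus_complexification_def scaleR_complexification_def
  scaleC_complexification_def

lemma norm_re_part_rotated_le:
  fixes z :: "'a complexification"
  assumes "cmod u = 1"
  shows "norm (re_part (u *\<^sub>C z)) \<le> norm (re_part z) + norm (im_part z)"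
proof -
  have "norm (re_part (u *\<^sub>C z)) \<le> \<bar>Re u\<bar> * norm (re_part z) + \<bar>Im u\<bar> * norm (im_part z)"
    unfolding scaleC_complexification_def by (auto intro: order_trans[OF norm_triangle_ineq4])
  also have "\<dots> \<le> 1 * norm (re_part z) + 1 * norm (im_part z)"
    using abs_Re_le_cmod[of u] abs_Im_le_cmod[of u] assms
    by (intro add_mono mult_right_mono) auto
  finally show ?thesis by simp
qed

lemma norm_complexification_upper:
  fixes z :: "'a complexification"
  assumes "cmod u = 1"
  shows "norm (re_part (u *\<^sub>C z)) \<le> norm z"
  unfolding norm_complexification_def
  by (rule cSUP_upper)
    (use assms norm_re_part_rotated_le[of _ z] in \<open>auto intro!: bdd_aboveI2\<close>)

lemma norm_complexification_least:
  fixes z :: "'a complexification"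
  assumes "\<And>u. cmod u = 1 \<Longrightarrow> norm (re_part (u *\<^sub>C z)) \<le> B"
  shows "norm z \<le> B"
  unfolding norm_complexification_def
proof (rule cSUP_least)
  have "(1::complex) \<in> sphere 0 1" by simp
  then show "sphere (0::complex) 1 \<noteq> {}" by blast
qed (use assms in auto)

lemma norm_complexification_le: "norm z \<le> norm (re_part z) + norm (im_part z)"
  for z :: "'a complexification"
  by (intro norm_complexification_least norm_re_part_rotated_le)

lemma norm_re_part_le: "norm (re_part z) \<le> norm z" for z :: "'a complexification"
  using norm_complexification_upper[of 1 z] by (simp add: scaleC_complexification_def)

lemma norm_im_part_le: "norm (im_part z) \<le> norm z" for z :: "'a complexification"
  using norm_complexification_upper[of \<i> z] by (simp add: scaleC_complexification_def)

lemma scaleC_scaleC_complexification: "c *\<^sub>C d *\<^sub>C z = (c * d) *\<^sub>C z" for z :: "'a complexification"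
  by (rule complexification_eqI) (simp_all add: scaleC_complexification_def algebra_simps)

lemma norm_scaleC_complexification_le: "norm (c *\<^sub>C z) \<le> cmod c * norm z"
  for z :: "'a complexification"
proof (rule norm_complexification_least)
  fix u :: complex assume u: "cmod u = 1"
  show "norm (re_part (u *\<^sub>C c *\<^sub>C z)) \<le> cmod c * norm z"
  proof (cases "c = 0")
    case True
    then show ?thesis by (simp add: scaleC_complexification_def)
  next
    case False
    have "u * c = complex_of_real (cmod c) * (u * sgn c)"
      using False by (simp add: sgn_eq)
    then have "u *\<^sub>C c *\<^sub>C z = complex_of_real (cmod c) *\<^sub>C (u * sgn c) *\<^sub>C z"
      by (simp only: scaleC_scaleC_complexification)
    then have "re_part (u *\<^sub>C c *\<^sub>C z) = cmod c *\<^sub>R re_part ((u * sgn c) *\<^sub>C z)"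
      by (simp add: scaleC_complexification_def[of "complex_of_real _"])
    then have "norm (re_part (u *\<^sub>C c *\<^sub>C z)) = cmod c * norm (re_part ((u * sgn c) *\<^sub>C z))"
      by simp
    also have "\<dots> \<le> cmod c * norm z"
      using u False
      by (intro mult_left_mono norm_complexification_upper) (auto simp: norm_mult norm_sgn)
    finally show ?thesis .
  qed
qed

instance
proof
  fix z w v :: "'a complexification" and a b :: real and c d :: complex
  show "z + w + v = z + (w + v)" by (simp add: complexification_arith_defs)
  show "z + w = w + z" by (simp add: complexification_arith_defs)
  show "0 + z = z" by (simp add: complexification_arith_defs)
  show "- z + z = 0" by (simp add: complexification_arith_defs)
  show "z - w = z + - w" by (simp add: complexification_arith_defs)
  show "a *\<^sub>R (z + w) = a *\<^sub>R z + a *\<^sub>R w" by (simp add: complexification_arith_defs scaleR_add_right)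
  show "(a + b) *\<^sub>R z = a *\<^sub>R z + b *\<^sub>R z" by (simp add: complexification_arith_defs scaleR_add_left)
  show "a *\<^sub>R b *\<^sub>R z = (a * b) *\<^sub>R z" by (simp add: complexification_arith_defs)
  show "1 *\<^sub>R z = z" by (simp add: complexification_arith_defs)
  show "dist z w = norm (z - w)" by (fact dist_complexification_def)
  show "sgn z = inverse (norm z) *\<^sub>R z" by (fact sgn_complexification_def)
  show "(uniformity :: ('a complexification \<times> 'a complexification) filter)
      = (INF e\<in>{0 <..}. principal {(z, w). dist z w < e})"
    by (fact uniformity_complexification_def)
  show "open U = (\<forall>z\<in>U. \<forall>\<^sub>F (z', w) in uniformity. z' = z \<longrightarrow> w \<in> U)" for U :: "'a complexification set"
    by (fact open_complexification_def)
  show "norm z = 0 \<longleftrightarrow> z = 0"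
  proof
    assume "norm z = 0"
    then show "z = 0"
      using norm_re_part_le[of z] norm_im_part_le[of z]
      by (intro complexification_eqI) (simp_all add: zero_complexification_def)
  next
    assume "z = 0"
    then show "norm z = 0"
      using norm_complexification_le[of z] norm_re_part_le[of z]
      by (simp add: zero_complexification_def)
  qed
  show "norm (z + w) \<le> norm z + norm w"
  proof (rule norm_complexification_least)
    fix u :: complex assume u: "cmod u = 1"
    have "re_part (u *\<^sub>C (z + w)) = re_part (u *\<^sub>C z) + re_part (u *\<^sub>C w)"
      by (simp add: complexification_arith_defs algebra_simps)
    then show "norm (re_part (u *\<^sub>C (z + w))) \<le> norm z + norm w"
      using norm_triangle_ineq[of "re_part (u *\<^sub>C z)" "re_part (u *\<^sub>C w)"]
        norm_complexification_upper[OF u, of z] norm_complexification_upper[OF u, of w]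
      by simp
  qed
  show scaleC: "norm (c *\<^sub>C z) = cmod c * norm z" for c
  proof (rule antisym)
    show "cmod c * norm z \<le> norm (c *\<^sub>C z)"
    proof (cases "c = 0")
      case True
      then show ?thesis
        using order_trans[OF norm_ge_zero norm_re_part_le[of "c *\<^sub>C z"]] by simp
    next
      case False
      then have "inverse c *\<^sub>C c *\<^sub>C z = z"
        unfolding scaleC_scaleC_complexification by (simp add: scaleC_complexification_def)
      then have "norm z \<le> inverse (cmod c) * norm (c *\<^sub>C z)"
        using norm_scaleC_complexification_le[of "inverse c" "c *\<^sub>C z"] by (simp add: norm_inverse)
      then show ?thesis
        using False by (simp add: field_simps)
    qed
  qed (rule norm_scaleC_complexification_le)
  show scaleR: "a *\<^sub>R z = complex_of_real a *\<^sub>C z" by (simp add: complexification_arith_defs)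
  show "norm (a *\<^sub>R z) = \<bar>a\<bar> * norm z"
    unfolding scaleR scaleC by simp
  show "c *\<^sub>C (z + w) = c *\<^sub>C z + c *\<^sub>C w" by (simp add: complexification_arith_defs algebra_simps)
  show "(c + d) *\<^sub>C z = c *\<^sub>C z + d *\<^sub>C z" by (simp add: complexification_arith_defs algebra_simps)
  show "c *\<^sub>C d *\<^sub>C z = (c * d) *\<^sub>C z" by (rule scaleC_scaleC_complexification)
qed

end

instance complexification :: (banach) cbanach
proof
  fix F :: "nat \<Rightarrow> 'a complexification"
  assume F: "Cauchy F"
  have "Cauchy (\<lambda>n. re_part (F n))" "Cauchy (\<lambda>n. im_part (F n))"
  proof -
    have re: "norm (re_part (F m) - re_part (F n)) \<le> norm (F m - F n)" for m n
      using norm_re_part_le[of "F m - F n"] by (simp add: minus_complexification_def)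
    have im: "norm (im_part (F m) - im_part (F n)) \<le> norm (F m - F n)" for m n
      using norm_im_part_le[of "F m - F n"] by (simp add: minus_complexification_def)
    show "Cauchy (\<lambda>n. re_part (F n))"
      using F re unfolding Cauchy_iff by (meson le_less_trans)
    show "Cauchy (\<lambda>n. im_part (F n))"
      using F im unfolding Cauchy_iff by (meson le_less_trans)
  qed
  then obtain x y where xy: "(\<lambda>n. re_part (F n)) \<longlonglongrightarrow> x" "(\<lambda>n. im_part (F n)) \<longlonglongrightarrow> y"
    by (auto dest!: Cauchy_convergent simp: convergent_def)
  have "(\<lambda>n. norm (re_part (F n) - x) + norm (im_part (F n) - y)) \<longlonglongrightarrow> 0"
    by (intro tendsto_add_zero tendsto_norm_zero LIM_zero xy)
  moreover have "\<forall>n. norm (F n - Oplus x y) \<le> norm (re_part (F n) - x) + norm (im_part (F n) - y)"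
  proof
    show "norm (F n - Oplus x y) \<le> norm (re_part (F n) - x) + norm (im_part (F n) - y)" for n
      using norm_complexification_le[of "F n - Oplus x y"] by (simp add: minus_complexification_def)
  qed
  ultimately have "(\<lambda>n. F n - Oplus x y) \<longlonglongrightarrow> 0"
    by (rule Lim_null_comparison[OF always_eventually, rotated])
  then have "F \<longlonglongrightarrow> Oplus x y"
    by (rule LIM_zero_cancel)
  then show "convergent F"
    by (rule convergentI)
qed

lift_definition complexify_blinfun ::
  "'a::real_normed_vector \<Rightarrow>\<^sub>L 'a \<Rightarrow> 'a complexification \<Rightarrow>\<^sub>L 'a complexification"
  is "\<lambda>T z. Oplus (T (re_part z)) (T (im_part z))"
proof -
  fix T :: "'a \<Rightarrow> 'a"
  assume "bounded_linear T"
  then interpret bounded_linear T .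
  obtain K where K: "\<And>x. norm (T x) \<le> norm x * K"
    using bounded by blast
  show "bounded_linear (\<lambda>z. Oplus (T (re_part z)) (T (im_part z)))"
  proof (rule bounded_linear_intro)
    fix z :: "'a complexification"
    have "norm (Oplus (T (re_part z)) (T (im_part z))) \<le> norm (T (re_part z)) + norm (T (im_part z))"
      using norm_complexification_le[of "Oplus (T (re_part z)) (T (im_part z))"] by simp
    also have "\<dots> \<le> norm (re_part z) * \<bar>K\<bar> + norm (im_part z) * \<bar>K\<bar>"
      by (intro add_mono order_trans[OF K] mult_left_mono) auto
    also have "\<dots> \<le> norm z * \<bar>K\<bar> + norm z * \<bar>K\<bar>"
      by (intro add_mono mult_right_mono norm_re_part_le norm_im_part_le) auto
    finally show "norm (Oplus (T (re_part z)) (T (im_part z))) \<le> norm z * (2 * \<bar>K\<bar>)"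
      by (simp add: mult_ac)
  qed (simp_all add: complexification_arith_defs add scaleR)
qed

lift_definition complexify_op ::
  "'a::real_normed_vector \<Rightarrow>\<^sub>L 'a \<Rightarrow> 'a complexification \<Rightarrow>\<^sub>C\<^sub>L 'a complexification"
  is complexify_blinfun
  by (simp add: complexify_blinfun.rep_eq scaleC_complexification_def blinfun.add_right
      blinfun.diff_right blinfun.scaleR_right)


section \<open>Spectrum and adjoint\<close>

definition spectrum :: "'a::cbanach \<Rightarrow>\<^sub>C\<^sub>L 'a \<Rightarrow> complex set"
  where "spectrum T = {l. \<not> (\<exists>S. S o\<^sub>C\<^sub>L (l *\<^sub>C id_cblinfun - T) = id_cblinfun
                             \<and> (l *\<^sub>C id_cblinfun - T) o\<^sub>C\<^sub>L S = id_cblinfun)}"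

definition spectrum_real :: "'a::banach \<Rightarrow>\<^sub>L 'a \<Rightarrow> complex set"
  where "spectrum_real T = spectrum (complexify_op T)"

definition adjoint_op :: "'a::banach \<Rightarrow>\<^sub>L 'a \<Rightarrow> ('a \<Rightarrow>\<^sub>L real) \<Rightarrow> ('a \<Rightarrow>\<^sub>L real)"
  where "adjoint_op T f = f o\<^sub>L T"

definition cadjoint_op :: "'a::cbanach \<Rightarrow>\<^sub>C\<^sub>L 'a \<Rightarrow> ('a \<Rightarrow>\<^sub>C\<^sub>L complex) \<Rightarrow> ('a \<Rightarrow>\<^sub>C\<^sub>L complex)"
  where "cadjoint_op T f = f o\<^sub>C\<^sub>L T"


section \<open>Almost-invariant halfspaces\<close>

text \<open>
  The definitions below take the scalar multiplication as a parameter: it is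
  \<^term>\<open>scaleR\<close> for real spaces and \<^term>\<open>scaleC\<close> for complex ones. They are meant for
  subspaces \<open>V\<close>, \<open>Y\<close>. Finite dimensionality is stated separately because
  \<^const>\<open>vector_space.dim\<close> is \<open>0\<close> on infinite-dimensional subspaces.
\<close>

definition finite_dim :: "('k::field \<Rightarrow> 'z::ab_group_add \<Rightarrow> 'z) \<Rightarrow> 'z set \<Rightarrow> bool"
  where "finite_dim sc V \<longleftrightarrow> (\<exists>B. finite B \<and> module.span sc B = V)"

text \<open>The cosets of the finitely many elements of \<open>B\<close> span the quotient by \<open>Y\<close>.\<close>

definition finite_codim :: "('k::field \<Rightarrow> 'z::ab_group_add \<Rightarrow> 'z) \<Rightarrow> 'z set \<Rightarrow> bool"
  where "finite_codim sc Y \<longleftrightarrow>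
    (\<exists>B. finite B \<and> (\<forall>z. \<exists>v\<in>module.span sc B. z - v \<in> Y))"

definition halfspace :: "('k::field \<Rightarrow> 'z::real_normed_vector \<Rightarrow> 'z) \<Rightarrow> 'z set \<Rightarrow> bool"
  where "halfspace sc Y \<longleftrightarrow>
    module.subspace sc Y \<and> closed Y \<and> \<not> finite_dim sc Y \<and> \<not> finite_codim sc Y"

definition almost_invariant_halfspace ::
    "('k::field \<Rightarrow> 'z::real_normed_vector \<Rightarrow> 'z) \<Rightarrow> ('z \<Rightarrow> 'z) \<Rightarrow> nat \<Rightarrow> 'z set \<Rightarrow> bool"
  where "almost_invariant_halfspace sc R d Y \<longleftrightarrow>
    halfspace sc Y \<and>
    (\<exists>E. module.subspace sc E \<and> finite_dim sc E \<and> vector_space.dim sc E \<le> d \<and>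
         R ` Y \<subseteq> {y + e |y e. y \<in> Y \<and> e \<in> E})"

end

theory Submission
  imports Defs "HOL-Complex_Analysis.Complex_Analysis" "HOL-Library.Diagonal_Subsequence"
begin

text \<open>
  Let \<open>a\<close> be real, \<open>N = T - a\<close>, and let \<open>\<mu>\<^sub>n\<close> be real points outside the spectrum that converge
  to \<open>a\<close>. For any vector \<open>e\<close> the resolvent orbit \<open>r\<^sub>n = (\<mu>\<^sub>n - T)\<^sup>-\<^sup>1 e\<close> satisfies
  \<open>T r\<^sub>n = \<mu>\<^sub>n r\<^sub>n - e\<close>. Hence the closed span of any subsequence, together with any closed invariant
  subspace \<open>F\<close>, is mapped into itself plus the line of \<open>e\<close>. Almost-invariance of defect one is thus
  for free, and the whole problem is to obtain infinite codimension. The tool is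
  \<open>separated_imp_biorthogonal_differences\<close>: a bounded sequence whose members keep a fixed distance
  modulo \<open>F\<close> has a subsequence for which the even-numbered members and \<open>F\<close> together span a subspace
  of infinite codimension. It follows (\<open>AIH_or_limit_of_orbit\<close>) that if the orbit is
  unbounded modulo \<open>F\<close>, then either there is an almost-invariant halfspace, or the normalised orbit
  has a subsequence that converges modulo \<open>F\<close>, and its limit \<open>y\<close> satisfies \<open>y \<notin> F\<close> and \<open>N y \<in> F\<close>.

  Suppose now that the adjoint has no almost-invariant halfspace of defect at most one. Then \<open>T\<close> has
  none either, because annihilators carry one to the other (\<open>AIH_annihilator\<close>); in particular the
  kernel of \<open>N\<close> has finite dimension. The subspace \<open>F\<close> is chosen such that the limit \<open>y\<close>
  cannot exist. Consider the kernels of the powers of \<open>N\<^sup>*\<close>.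

  \<^item> If they increase strictly, let \<open>Z\<^sub>m\<close> be the common kernel of the functionals in the \<open>m\<close>-th one.
    The intersection \<open>F\<close> of all \<open>Z\<^sub>m\<close> is invariant and of infinite codimension, so it has
    finite dimension, and so does the preimage of \<open>F\<close> under \<open>N\<close>. That preimage meets \<open>Z\<^sub>m\<close> inside
    \<open>F\<close> for large \<open>m\<close>, and an orbit inside \<open>Z\<^sub>m\<close> gives a contradiction (\<open>AIH_of_strict_chain\<close>).

  \<^item> If they are constant from the \<open>k\<close>-th one on, that kernel serves as \<open>F\<close> in the dual space: \<open>y \<notin> F\<close>
    and \<open>N\<^sup>* y \<in> F\<close> contradict each other. So all dual orbits are bounded modulo \<open>F\<close>, and by uniform
    boundedness the resolvents are bounded on \<open>Z\<^sub>k\<close>, which contains the range of \<open>N\<^sup>k\<close>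
    (\<open>resolvents_bounded_on_range_hull\<close>). Therefore \<open>N\<close> is invertible on \<open>Z\<^sub>k\<close>, the point \<open>a\<close> is not
    a limit of other points of the real spectrum, and every \<open>N\<^sup>k x\<close> can be traced back
    under \<open>N\<close> with at most geometric growth (\<open>no_AIH_imp_isolated\<close>).

  An infinite real spectrum has a limit point that is also a limit of real points outside of the
  spectrum, which contradicts the second case. Otherwise the spectrum is finite and real. Let
  \<open>Q\<close> be the product of the powers \<open>(T - a)\<^sup>k\<close> over its points. Every vector \<open>Q x\<close> can be traced back
  geometrically at each point of the spectrum, which makes the resolvent applied to it bounded near
  each of them, hence entire; it vanishes at infinity, so \<open>Q x = 0\<close> by Liouville's theorem
  (\<open>zero_if_backward_orbits\<close>). But the kernel of \<open>Q\<close> has finite dimension, and the space has not.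

  Real and complex spaces are treated together in the locale \<open>banach_over\<close>, whose only
  substantial assumption is the Hahn--Banach theorem. The complexification enters only through the spectrum
  and Liouville's theorem.
\<close>

section \<open>The Hahn--Banach theorem\<close>

definition sublinear :: "('v::real_vector \<Rightarrow> real) \<Rightarrow> bool" where
  "sublinear p \<longleftrightarrow> (\<forall>x y. p (x + y) \<le> p x + p y) \<and> (\<forall>t x. 0 \<le> t \<longrightarrow> p (t *\<^sub>R x) = t * p x)"

lemma sublinearI:
  assumes "\<And>x y. p (x + y) \<le> p x + p y" "\<And>t x. 0 \<le> t \<Longrightarrow> p (t *\<^sub>R x) = t * p x"
  shows "sublinear p"
  using assms by (simp add: sublinear_def)

lemma sublinear_add: "sublinear p \<Longrightarrow> p (x + y) \<le> p x + p y"
  by (simp add: sublinear_def)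

lemma sublinear_scale: "sublinear p \<Longrightarrow> 0 \<le> t \<Longrightarrow> p (t *\<^sub>R x) = t * p x"
  by (simp add: sublinear_def)

lemma sublinear_zero: "sublinear p \<Longrightarrow> p 0 = 0"
  using sublinear_scale[of p 0 0] by simp

lemma sublinear_lower: "sublinear p \<Longrightarrow> - p (- x) \<le> p x"
  using sublinear_add[of p x "- x"] sublinear_zero[of p] by simp

text \<open>
  A minimal sublinear functional coincides with its own shifts. The last bound then turns
  subadditivity into additivity. The shift along \<open>x0\<close> also serves to fix the value at \<open>x0\<close>.
\<close>
lemma sublinear_shift:
  fixes y :: "'v::real_vector"
  assumes p: "sublinear p"
  defines "q \<equiv> \<lambda>x. INF t\<in>{0..}. p (x + t *\<^sub>R y) - t * p y"
  shows "sublinear q" and "q x \<le> p x" and "q x \<le> p (x + y) - p y"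
proof -
  have q_eq: "q x = (INF t\<in>{0..}. p (x + t *\<^sub>R y) - t * p y)" for x
    by (simp add: q_def)
  have low: "- p (- x) \<le> p (x + t *\<^sub>R y) - t * p y" if "0 \<le> t" for x t
  proof -
    have "t * p y = p (x + t *\<^sub>R y + - x)"
      using sublinear_scale[OF p that, of y] by simp
    also have "\<dots> \<le> p (x + t *\<^sub>R y) + p (- x)" by (rule sublinear_add[OF p])
    finally show ?thesis by simp
  qed
  have bdd: "bdd_below ((\<lambda>t. p (x + t *\<^sub>R y) - t * p y) ` {0..})" for x
    by (rule bdd_belowI2[where m = "- p (- x)"]) (use low in auto)
  have le: "q x \<le> p (x + t *\<^sub>R y) - t * p y" if "0 \<le> t" for x t
    unfolding q_def by (rule cINF_lower[OF bdd]) (use that in auto)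
  show "q x \<le> p x" using le[of 0 x] by simp
  show "q x \<le> p (x + y) - p y" using le[of 1 x] by simp
  have add: "q (u + v) \<le> q u + q v" for u v
  proof -
    have 1: "q (u + v) - (p (u + s *\<^sub>R y) - s * p y) \<le> p (v + t *\<^sub>R y) - t * p y"
      if "0 \<le> s" "0 \<le> t" for s t
    proof -
      have "q (u + v) \<le> p ((u + s *\<^sub>R y) + (v + t *\<^sub>R y)) - (s + t) * p y"
        using le[of "s + t" "u + v"] that by (simp add: algebra_simps)
      then show ?thesis
        using sublinear_add[OF p, of "u + s *\<^sub>R y" "v + t *\<^sub>R y"] by (simp add: algebra_simps)
    qed
    have "q (u + v) - (p (u + s *\<^sub>R y) - s * p y) \<le> q v" if "0 \<le> s" for s
      unfolding q_eq[of v] by (rule cINF_greatest) (use 1 that in auto)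
    then have "q (u + v) - q v \<le> p (u + s *\<^sub>R y) - s * p y" if "0 \<le> s" for s
      using that by (fastforce simp: algebra_simps)
    then have "q (u + v) - q v \<le> q u"
      unfolding q_eq[of u] by (intro cINF_greatest) auto
    then show ?thesis by simp
  qed
  have scale_le: "q (t *\<^sub>R u) \<le> t * q u" if "0 < t" for t u
  proof -
    have "q (t *\<^sub>R u) / t \<le> p (u + s *\<^sub>R y) - s * p y" if s: "0 \<le> s" for s
    proof -
      have "q (t *\<^sub>R u) \<le> p (t *\<^sub>R u + (t * s) *\<^sub>R y) - (t * s) * p y"
        using s \<open>0 < t\<close> by (intro le) auto
      also have "t *\<^sub>R u + (t * s) *\<^sub>R y = t *\<^sub>R (u + s *\<^sub>R y)" by (simp add: scaleR_add_right)
      also have "p (t *\<^sub>R (u + s *\<^sub>R y)) - (t * s) * p y = t * (p (u + s *\<^sub>R y) - s * p y)"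
        using sublinear_scale[OF p, of t] \<open>0 < t\<close> by (simp add: right_diff_distrib)
      finally show ?thesis using \<open>0 < t\<close> by (simp add: field_simps)
    qed
    then have "q (t *\<^sub>R u) / t \<le> q u" unfolding q_eq[of u] by (intro cINF_greatest) auto
    then show ?thesis using \<open>0 < t\<close> by (simp add: field_simps)
  qed
  have zero: "q 0 = 0"
  proof (rule antisym)
    show "q 0 \<le> 0" using le[of 0 0] sublinear_zero[OF p] by simp
    show "0 \<le> q 0" unfolding q_def
      by (rule cINF_greatest) (use sublinear_scale[OF p] in auto)
  qed
  show "sublinear q"
  proof (rule sublinearI)
    fix t u assume "0 \<le> (t::real)"
    show "q (t *\<^sub>R u) = t * q u"
    proof (cases "t = 0")
      case False
      then have "0 < t" using \<open>0 \<le> t\<close> by simp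
      moreover have "q u \<le> inverse t * q (t *\<^sub>R u)"
        using scale_le[of "inverse t" "t *\<^sub>R u"] \<open>0 < t\<close> by simp
      ultimately show ?thesis using scale_le[of t u] by (simp add: field_simps)
    qed (simp add: zero)
  qed (rule add)
qed

text \<open>
  Zorn's lemma. The pointwise infimum of a chain below \<open>p\<close> is finite, since a sublinear functional
  \<open>q \<le> p\<close> satisfies \<open>q x \<ge> - p (- x)\<close>.
\<close>
lemma sublinear_minimal:
  assumes p: "sublinear p"
  obtains f where "sublinear f" "f \<le> p" "\<And>q. sublinear q \<Longrightarrow> q \<le> f \<Longrightarrow> q = f"
proof -
  define A where "A = {q. sublinear q \<and> q \<le> p}"
  define P where "P = (\<lambda>(q::'a \<Rightarrow> real) q'. q' \<le> q)"
  have "\<exists>m\<in>A. \<forall>a\<in>A. P m a \<longrightarrow> a = m"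
  proof (rule predicate_Zorn)
    show "partial_order_on A (relation_of P A)"
      by (rule partial_order_on_relation_ofI) (auto simp: P_def)
    fix C assume C: "C \<in> Chains (relation_of P A)"
    then have CA: "C \<subseteq> A" by (rule Chains_relation_of)
    have tot: "q \<le> q' \<or> q' \<le> q" if "q \<in> C" "q' \<in> C" for q q'
      using C that by (auto simp: Chains_def relation_of_def P_def)
    show "\<exists>u\<in>A. \<forall>a\<in>C. P a u"
    proof (cases "C = {}")
      case True
      then show ?thesis using p by (auto simp: A_def)
    next
      case False
      define u where "u x = (INF q\<in>C. q x)" for x
      have low: "- p (- x) \<le> q x" if "q \<in> C" for q x
      proof -
        have "q (- x) \<le> p (- x)" using that CA by (auto simp: A_def le_fun_def)
        moreover have "sublinear q" using that CA by (auto simp: A_def)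
          ultimately show ?thesis using sublinear_lower[of q x] by simp
      qed
      have bdd: "bdd_below ((\<lambda>q. q x) ` C)" for x
        by (rule bdd_belowI2[where m = "- p (- x)"]) (use low in auto)
      have le: "u x \<le> q x" if "q \<in> C" for q x
        unfolding u_def by (rule cINF_lower[OF bdd that])
      have "sublinear u"
      proof (rule sublinearI)
        fix x y
        have 1: "u (x + y) \<le> q x + q' y" if "q \<in> C" "q' \<in> C" for q q'
        proof -
          note qq' = that
          obtain r where r: "r \<in> C" "r \<le> q" "r \<le> q'"
            using tot[OF qq'] qq' by blast
          have "u (x + y) \<le> r (x + y)" by (rule le[OF r(1)])
          also have "\<dots> \<le> r x + r y" using r(1) CA by (auto simp: A_def intro: sublinear_add)
          also have "\<dots> \<le> q x + q' y" using r by (intro add_mono) (auto simp: le_fun_def)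
          finally show ?thesis .
        qed
        have "u (x + y) - q x \<le> u y" if "q \<in> C" for q
          unfolding u_def[of y] using 1[OF that] False by (intro cINF_greatest) (auto simp: algebra_simps)
        then have "u (x + y) - u y \<le> q x" if "q \<in> C" for q using that by (fastforce simp: algebra_simps)
        then have "u (x + y) - u y \<le> u x"
          unfolding u_def[of x] using False by (intro cINF_greatest) auto
        then show "u (x + y) \<le> u x + u y" by simp
      next
        fix t :: real and x assume t: "0 \<le> t"
        have "u (t *\<^sub>R x) = (INF q\<in>C. t * q x)"
          unfolding u_def using CA t by (intro INF_cong) (auto simp: A_def sublinear_scale)
        also have "\<dots> = t * u x"
        proof (cases "t = 0")
          case False
          show ?thesis
          proof (rule antisym)
            have "(INF q\<in>C. t * q x) / t \<le> q x" if "q \<in> C" for q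
            proof -
              have "bdd_below ((\<lambda>q. t * q x) ` C)"
                by (rule bdd_belowI2[where m = "t * - p (- x)"]) (use low t in \<open>blast intro: mult_left_mono\<close>)
              then have "(INF q\<in>C. t * q x) \<le> t * q x" using that by (rule cINF_lower)
              then show ?thesis using t False by (simp add: field_simps)
            qed
            then have "(INF q\<in>C. t * q x) / t \<le> u x" unfolding u_def using \<open>C \<noteq> {}\<close> by (intro cINF_greatest) auto
            then show "(INF q\<in>C. t * q x) \<le> t * u x" using t False by (simp add: field_simps)
            show "t * u x \<le> (INF q\<in>C. t * q x)"
              using \<open>C \<noteq> {}\<close> le t by (intro cINF_greatest mult_left_mono) auto
          qed
        qed (simp add: \<open>C \<noteq> {}\<close>)
        finally show "u (t *\<^sub>R x) = t * u x" .
      qed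
      moreover have "u \<le> p"
      proof (rule le_funI)
        fix x
        from False obtain q where "q \<in> C" by blast
        then have "q x \<le> p x" using CA by (auto simp: A_def le_fun_def)
        then show "u x \<le> p x" using le[OF \<open>q \<in> C\<close>, of x] by simp
      qed
      ultimately show ?thesis using le by (auto simp: A_def P_def le_fun_def intro!: bexI[of _ u])
    qed
  qed
  then obtain m where m: "m \<in> A" "\<And>a. a \<in> A \<Longrightarrow> a \<le> m \<Longrightarrow> a = m" by (auto simp: P_def)
  show thesis
  proof (rule that)
    show "sublinear m" "m \<le> p" using m(1) by (auto simp: A_def)
    show "q = m" if "sublinear q" "q \<le> m" for q
      using m(2)[of q] that \<open>m \<le> p\<close> by (auto simp: A_def)
  qed
qed

text \<open>
  No partially defined functionals are extended: \<open>f\<close> is a minimal sublinear functional below the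
  shift of \<open>p\<close> along \<open>x0\<close>, and minimality makes it linear.
\<close>
theorem Hahn_Banach_real:
  fixes p :: "'v::real_vector \<Rightarrow> real"
  assumes p: "sublinear p"
  obtains f where "linear f" "\<And>x. f x \<le> p x" "f x0 = p x0"
proof -
  define p0 where "p0 = (\<lambda>x. INF t\<in>{0..}. p (x + t *\<^sub>R x0) - t * p x0)"
  have p0: "sublinear p0" "\<And>x. p0 x \<le> p x" "\<And>x. p0 x \<le> p (x + x0) - p x0"
    unfolding p0_def by (rule sublinear_shift[OF p])+
  obtain f where f: "sublinear f" "f \<le> p0" "\<And>q. sublinear q \<Longrightarrow> q \<le> f \<Longrightarrow> q = f"
    using sublinear_minimal[OF p0(1)] by blast
  have add: "f (x + y) = f x + f y" for x y
  proof (rule antisym[OF sublinear_add[OF f(1)]])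
    define q where "q = (\<lambda>x. INF t\<in>{0..}. f (x + t *\<^sub>R y) - t * f y)"
    have q: "sublinear q" "\<And>x. q x \<le> f x" "\<And>x. q x \<le> f (x + y) - f y"
      unfolding q_def by (rule sublinear_shift[OF f(1)])+
    have "q = f" by (rule f(3)) (use q in \<open>auto simp: le_fun_def\<close>)
    then show "f x + f y \<le> f (x + y)" using q(3)[of x] by simp
  qed
  have minus: "f (- x) = - f x" for x using add[of x "- x"] sublinear_zero[OF f(1)] by simp
  have "linear f"
  proof (rule linearI)
    show "f (t *\<^sub>R x) = t *\<^sub>R f x" for t x
    proof (cases "0 \<le> t")
      case False
      then have "f (- (t *\<^sub>R x)) = - t * f x" using sublinear_scale[OF f(1), of "- t" x] by simp
      then show ?thesis by (simp add: minus)
    qed (simp add: sublinear_scale[OF f(1)])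
  qed (rule add)
  moreover have fp: "f x \<le> p x" for x using f(2) p0(2)[of x] by (force simp: le_fun_def intro: order_trans)
  moreover have "f x0 = p x0"
  proof (rule antisym[OF fp])
    have "f (- x0) \<le> p0 (- x0)" using f(2) by (simp add: le_fun_def)
    also have "\<dots> \<le> - p x0" using p0(3)[of "- x0"] sublinear_zero[OF p] by simp
    finally show "p x0 \<le> f x0" by (simp add: minus)
  qed
  ultimately show thesis by (rule that)
qed

section \<open>Banach spaces over a field of scalars\<close>

lemma infdist_lessE:
  assumes "M \<noteq> {}" "infdist x M < d" obtains m where "m \<in> M" "dist x m < d"
proof -
  have "(INF a\<in>M. dist x a) < d" using assms by (simp add: infdist_notempty)
  then show thesis
    using cINF_less_iff[OF assms(1) bdd_belowI2[where m = 0]] that by (metis zero_le_dist)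
qed

lemma module_mult: "module ((*) :: 'k::comm_ring_1 \<Rightarrow> 'k \<Rightarrow> 'k)"
  by standard (simp_all add: algebra_simps)

text \<open>
  The scalars are meant to be the real or the complex numbers. The last assumption is the
  Hahn--Banach theorem; formulated with the distance from \<open>M\<close> it yields both functionals that
  vanish on \<open>M\<close> and, for \<open>M = {0}\<close>, functionals that attain the norm.
\<close>
locale banach_over = vector_space sc
  for sc :: "'k::{real_normed_field, heine_borel} \<Rightarrow> 'v::banach \<Rightarrow> 'v" (infixr \<open>*\<^sub>K\<close> 75) +
  assumes norm_sc: "norm (c *\<^sub>K x) = norm c * norm x"
    and scaleR_sc: "r *\<^sub>R x = of_real r *\<^sub>K x"
    and separating_functional:
      "subspace M \<Longrightarrow>
        \<exists>\<gamma>. module_hom (*\<^sub>K) (*) \<gamma> \<and> (\<forall>v. norm (\<gamma> v) \<le> norm v) \<and> (\<forall>m\<in>M. \<gamma> m = 0) \<and>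
            \<gamma> x = of_real (infdist x M)"
begin

definition contraction :: "('v \<Rightarrow> 'k) \<Rightarrow> bool" where
  "contraction \<gamma> \<longleftrightarrow> module_hom (*\<^sub>K) (*) \<gamma> \<and> (\<forall>v. norm (\<gamma> v) \<le> norm v)"

definition bounded_op :: "('v \<Rightarrow> 'v) \<Rightarrow> bool" where
  "bounded_op T \<longleftrightarrow> bounded_linear T \<and> (\<forall>c v. T (c *\<^sub>K v) = c *\<^sub>K T v)"

text \<open>
  Existence of an almost-invariant halfspace. The single vector \<open>e\<close> spans the error space, which is
  what a defect of at most one amounts to.
\<close>
definition has_AIH :: "('v \<Rightarrow> 'v) \<Rightarrow> bool" where
  "has_AIH T \<longleftrightarrow> (\<exists>Y e. halfspace (*\<^sub>K) Y \<and> (\<forall>y\<in>Y. \<exists>t. T y - t *\<^sub>K e \<in> Y))"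

lemma contraction_add: "contraction \<gamma> \<Longrightarrow> \<gamma> (u + v) = \<gamma> u + \<gamma> v"
  and contraction_diff: "contraction \<gamma> \<Longrightarrow> \<gamma> (u - v) = \<gamma> u - \<gamma> v"
  and contraction_scale: "contraction \<gamma> \<Longrightarrow> \<gamma> (c *\<^sub>K v) = c * \<gamma> v"
  and contraction_zero: "contraction \<gamma> \<Longrightarrow> \<gamma> 0 = 0"
  and contraction_sum: "contraction \<gamma> \<Longrightarrow> \<gamma> (sum g A) = (\<Sum>a\<in>A. \<gamma> (g a))"
  and contraction_norm: "contraction \<gamma> \<Longrightarrow> norm (\<gamma> v) \<le> norm v"
  by (auto simp: contraction_def dest: module_hom.add module_hom.diff module_hom.scale module_hom.zero
      module_hom.sum)

lemma contraction_tendsto: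
  assumes "contraction \<gamma>" "(f \<longlongrightarrow> l) F"
  shows "((\<lambda>x. \<gamma> (f x)) \<longlongrightarrow> \<gamma> l) F"
proof -
  have "((\<lambda>x. norm (f x - l)) \<longlongrightarrow> 0) F" using assms(2) by (simp add: LIM_zero tendsto_norm_zero)
  then have "((\<lambda>x. \<gamma> (f x - l)) \<longlongrightarrow> 0) F"
    by (rule Lim_null_comparison[rotated]) (use contraction_norm[OF assms(1)] in auto)
  then show ?thesis
    by (simp add: contraction_diff[OF assms(1)] LIM_zero_cancel)
qed

lemma contraction_zero_on_closure:
  assumes "contraction \<gamma>" "\<And>v. v \<in> M \<Longrightarrow> \<gamma> v = 0" "v \<in> closure M"
  shows "\<gamma> v = 0"
proof -
  obtain s where s: "\<And>n. s n \<in> M" "s \<longlonglongrightarrow> v" using assms(3) by (auto simp: closure_sequential)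
  have "(\<lambda>n. \<gamma> (s n)) \<longlonglongrightarrow> \<gamma> v" by (rule contraction_tendsto[OF assms(1) s(2)])
  then show ?thesis using s(1) assms(2) by (simp add: LIMSEQ_const_iff)
qed

lemma separate:
  assumes "subspace M"
  obtains \<gamma> where "contraction \<gamma>" "\<And>m. m \<in> M \<Longrightarrow> \<gamma> m = 0" "\<gamma> x = of_real (infdist x M)"
  using separating_functional[OF assms, of x] by (auto simp: contraction_def)

lemma op_linear: "bounded_op T \<Longrightarrow> bounded_linear T"
  and op_scale: "bounded_op T \<Longrightarrow> T (c *\<^sub>K v) = c *\<^sub>K T v"
  by (auto simp: bounded_op_def)

lemma op_add: "bounded_op T \<Longrightarrow> T (u + v) = T u + T v"
  and op_diff: "bounded_op T \<Longrightarrow> T (u - v) = T u - T v"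
  and op_zero: "bounded_op T \<Longrightarrow> T 0 = 0"
  and op_sum: "bounded_op T \<Longrightarrow> T (sum g A) = (\<Sum>a\<in>A. T (g a))"
  and op_scaleR: "bounded_op T \<Longrightarrow> T (r *\<^sub>R v) = r *\<^sub>R T v"
  using op_linear[of T] bounded_linear.linear[of T]
  by (simp_all add: linear_add linear_diff linear_0 linear_sum linear_scale)

lemma op_tendsto: "bounded_op T \<Longrightarrow> (f \<longlongrightarrow> l) F \<Longrightarrow> ((\<lambda>x. T (f x)) \<longlongrightarrow> T l) F"
  by (rule bounded_linear.tendsto[OF op_linear])

lemma op_bound:
  assumes "bounded_op T" obtains K where "K > 0" "\<And>v. norm (T v) \<le> K * norm v"
  using bounded_linear.pos_bounded[OF op_linear[OF assms]] by (auto simp: mult.commute)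

lemma op_shift: "bounded_op T \<Longrightarrow> bounded_op (\<lambda>x. T x - a *\<^sub>R x)"
  unfolding bounded_op_def
  by (auto intro!: bounded_linear_sub bounded_linear_scaleR_right simp: scale_right_diff_distrib)
    (simp add: scaleR_sc mult.commute)

lemma tendsto_sc: "(f \<longlongrightarrow> c) F \<Longrightarrow> (g \<longlongrightarrow> x) F \<Longrightarrow> ((\<lambda>t. f t *\<^sub>K g t) \<longlongrightarrow> c *\<^sub>K x) F"
proof -
  assume f: "(f \<longlongrightarrow> c) F" and g: "(g \<longlongrightarrow> x) F"
  have b: "bounded_bilinear (\<lambda>c x. c *\<^sub>K x)"
    by (rule bounded_bilinear.intro)
      (auto simp: scale_left_distrib scale_right_distrib scaleR_sc norm_sc scaleR_conv_of_real mult.commute intro!: exI[of _ 1])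
  show ?thesis by (rule bounded_bilinear.tendsto[OF b f g])
qed

lemma subspace_scaleR: "subspace M \<Longrightarrow> x \<in> M \<Longrightarrow> r *\<^sub>R x \<in> M"
  by (simp add: scaleR_sc subspace_scale)

lemma subspace_closure:
  assumes "subspace M" shows "subspace (closure M)"
proof (rule subspaceI)
  show "0 \<in> closure M" using subspace_0[OF assms] closure_subset by blast
  fix x y c assume x: "x \<in> closure M"
  then obtain s where s: "\<And>n. s n \<in> M" "s \<longlonglongrightarrow> x" by (auto simp: closure_sequential)
  have "(\<lambda>n. c *\<^sub>K s n) \<longlonglongrightarrow> c *\<^sub>K x" by (rule tendsto_sc[OF tendsto_const s(2)])
  then show "c *\<^sub>K x \<in> closure M"
    using s(1) subspace_scale[OF assms] unfolding closure_sequential by (intro exI[of _ "\<lambda>n. c *\<^sub>K s n"]) auto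
  assume "y \<in> closure M"
  then obtain t where t: "\<And>n. t n \<in> M" "t \<longlonglongrightarrow> y" by (auto simp: closure_sequential)
  show "x + y \<in> closure M"
    unfolding closure_sequential
    by (intro exI[of _ "\<lambda>n. s n + t n"] conjI allI tendsto_add s t subspace_add[OF assms])
qed

lemma infdist_subspace_bound:
  assumes "subspace M" "infdist x M < d"
  obtains m where "m \<in> M" "norm (x - m) < d"
  using infdist_lessE[OF _ assms(2)] subspace_0[OF assms(1)] unfolding dist_norm by blast

lemma infdist_geI:
  assumes "subspace M" "\<And>m. m \<in> M \<Longrightarrow> d \<le> norm (x - m)"
  shows "d \<le> infdist x M"
proof (rule ccontr)
  assume "\<not> d \<le> infdist x M"
  then have "infdist x M < d" by simp
  from infdist_subspace_bound[OF assms(1) this] obtain m where "m \<in> M" "norm (x - m) < d" .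
  then show False using assms(2)[of m] by simp
qed

lemma infdist_le_norm: "m \<in> M \<Longrightarrow> infdist x M \<le> norm (x - m)"
  by (metis dist_norm infdist_le)

text \<open>
  A functional that vanishes on \<open>M\<close> but not at \<open>z\<close> recovers the coefficient of \<open>z\<close>
  continuously, so limits can be taken in both summands separately.
\<close>
lemma closed_add_line:
  assumes M: "subspace M" "closed M"
  shows "closed {m + t *\<^sub>K z |m t. m \<in> M}"
proof (cases "z \<in> M")
  case True
  have "{m + t *\<^sub>K z |m t. m \<in> M} = M" (is "?L = M")
  proof
    show "?L \<subseteq> M" using True M by (auto intro: subspace_add subspace_scale)
    show "M \<subseteq> ?L" by (force intro: exI[of _ 0])
  qed
  then show ?thesis using M by simp
next
  case False
  have d: "infdist z M > 0"
    using infdist_pos_not_in_closed[OF M(2) _ False] subspace_0[OF M(1)] by blast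
  obtain \<gamma> where g: "contraction \<gamma>" "\<And>m. m \<in> M \<Longrightarrow> \<gamma> m = 0" "\<gamma> z = of_real (infdist z M)"
    using separate[OF M(1)] by blast
  have gz: "\<gamma> z \<noteq> 0" using d g(3) by simp
  show ?thesis unfolding closed_sequential_limits
  proof (intro allI impI, elim conjE)
    fix s l assume s: "\<forall>n. s n \<in> {m + t *\<^sub>K z |m t. m \<in> M}" "s \<longlonglongrightarrow> l"
    have "\<exists>t. s n - t *\<^sub>K z \<in> M" for n
    proof -
      obtain m t where "s n = m + t *\<^sub>K z" "m \<in> M" using s(1) by blast
      then have "s n - t *\<^sub>K z \<in> M" by simp
      then show ?thesis ..
    qed
    then obtain t where t: "\<And>n. s n - t n *\<^sub>K z \<in> M" by metis
    have "\<gamma> (s n) = t n * \<gamma> z" for n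
      using g(2)[OF t[of n]] by (simp add: contraction_diff[OF g(1)] contraction_scale[OF g(1)])
    then have "t = (\<lambda>n. \<gamma> (s n) / \<gamma> z)" using gz by (simp add: fun_eq_iff)
    then have "t \<longlonglongrightarrow> \<gamma> l / \<gamma> z"
      using contraction_tendsto[OF g(1) s(2)] gz by (auto intro!: tendsto_divide)
    then have "(\<lambda>n. s n - t n *\<^sub>K z) \<longlonglongrightarrow> l - (\<gamma> l / \<gamma> z) *\<^sub>K z"
      by (intro tendsto_diff s(2) tendsto_sc tendsto_const)
    then have "l - (\<gamma> l / \<gamma> z) *\<^sub>K z \<in> M"
      using M(2) t unfolding closed_sequential_limits by (metis (no_types, lifting))
    then show "l \<in> {m + t *\<^sub>K z |m t. m \<in> M}"
      by (intro CollectI exI[of _ "l - (\<gamma> l / \<gamma> z) *\<^sub>K z"] exI[of _ "\<gamma> l / \<gamma> z"]) simp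
  qed
qed

lemma subspace_add_line:
  assumes M: "subspace M"
  shows "subspace {m + t *\<^sub>K z |m t. m \<in> M}"
proof -
  have "{m + t *\<^sub>K z |m t. m \<in> M} = {x + y |x y. x \<in> M \<and> y \<in> span {z}}"
    by (auto simp: span_singleton)
  then show ?thesis using subspace_sums[OF M subspace_span] by simp
qed

lemma closed_span_finite: "finite B \<Longrightarrow> closed (span B)"
proof (induction B rule: finite_induct)
  case (insert b B)
  have "span (insert b B) = {m + t *\<^sub>K b |m t. m \<in> span B}"
  proof (rule set_eqI, rule iffI)
    fix x assume "x \<in> span (insert b B)"
    then obtain k where "x - k *\<^sub>K b \<in> span B" by (auto simp: span_insert)
    then show "x \<in> {m + t *\<^sub>K b |m t. m \<in> span B}"
      by (intro CollectI exI[of _ "x - k *\<^sub>K b"] exI[of _ k]) simp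
  next
    fix x assume "x \<in> {m + t *\<^sub>K b |m t. m \<in> span B}"
    then obtain m t where "x = m + t *\<^sub>K b" "m \<in> span B" by blast
    then have "x - t *\<^sub>K b \<in> span B" by simp
    then show "x \<in> span (insert b B)" unfolding span_insert by blast
  qed
  then show ?case using closed_add_line[OF subspace_span insert.IH] by simp
qed simp

subsection \<open>Finite dimension and codimension\<close>

text \<open>
  Sequences take the place of sets here, so that a repeated member counts as a relation.
\<close>
lemma linear_relation:
  assumes "finite B" "\<And>j::nat. u j \<in> span B"
  obtains n c where "\<exists>j<n. c j \<noteq> 0" "(\<Sum>j<n. c j *\<^sub>K u j) = 0"
proof -
  have "\<exists>n c. (\<exists>j<n. c j \<noteq> 0) \<and> (\<Sum>j<n. c j *\<^sub>K u j) = 0"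
  proof (cases "inj u")
    case False
    then obtain i j where ij: "i < j" "u i = u j" by (metis injI linorder_neqE_nat)
    define c where "c = (\<lambda>k. if k = i then 1 else if k = j then - 1 else (0::'k))"
    have "(\<Sum>k<Suc j. c k *\<^sub>K u k) = (\<Sum>k\<in>{i,j}. c k *\<^sub>K u k)"
      using ij by (intro sum.mono_neutral_right) (auto simp: c_def)
    also have "\<dots> = 0" using ij by (simp add: c_def)
    finally show ?thesis using ij by (intro exI[of _ "Suc j"] exI[of _ c]) (auto simp: c_def intro!: exI[of _ i])
  next
    case True
    define S where "S = u ` {..<Suc (card B)}"
    have card: "card S = Suc (card B)" unfolding S_def using True by (subst card_image) (auto intro: inj_on_subset)
    have "S \<subseteq> span B" using assms(2) by (auto simp: S_def)
    then have "dependent S" using independent_span_bound[OF assms(1), of S] card by auto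
    then obtain c where c: "\<exists>v\<in>S. c v \<noteq> 0" "(\<Sum>v\<in>S. c v *\<^sub>K v) = 0"
      using dependent_finite[of S] by (auto simp: S_def)
    have "(\<Sum>k<Suc (card B). c (u k) *\<^sub>K u k) = (\<Sum>v\<in>S. c v *\<^sub>K v)"
      unfolding S_def using True by (subst sum.reindex) (auto intro: inj_on_subset)
    then show ?thesis using c by (intro exI[of _ "Suc (card B)"] exI[of _ "\<lambda>k. c (u k)"]) (auto simp: S_def)
  qed
  then show thesis using that by blast
qed

lemma not_finite_dimI:
  assumes "\<And>j::nat. u j \<in> V" "\<And>n c. (\<Sum>j<n. c j *\<^sub>K u j) = 0 \<Longrightarrow> \<forall>j<n. c j = 0"
  shows "\<not> finite_dim (*\<^sub>K) V"
proof
  assume "finite_dim (*\<^sub>K) V"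
  then obtain B where "finite B" "span B = V" by (auto simp: finite_dim_def)
  then obtain n c where "\<exists>j<n. c j \<noteq> 0" "(\<Sum>j<n. c j *\<^sub>K u j) = 0"
    using linear_relation[of B u] assms(1) by metis
  then show False using assms(2) by blast
qed

lemma not_finite_codimI:
  assumes Y: "subspace Y" and u: "\<And>n c. (\<Sum>j<n. c j *\<^sub>K u j) \<in> Y \<Longrightarrow> \<forall>j<n::nat. c j = 0"
  shows "\<not> finite_codim (*\<^sub>K) Y"
proof
  assume "finite_codim (*\<^sub>K) Y"
  then obtain B where B: "finite B" "\<And>z. \<exists>v\<in>span B. z - v \<in> Y" by (auto simp: finite_codim_def)
  then have "\<forall>j. \<exists>v. v \<in> span B \<and> u j - v \<in> Y" by blast
  then obtain v where v: "\<And>j. v j \<in> span B" "\<And>j. u j - v j \<in> Y" by metis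
  obtain n c where c: "\<exists>j<n. c j \<noteq> 0" "(\<Sum>j<n. c j *\<^sub>K v j) = 0"
    using linear_relation[of B v] B(1) v(1) by metis
  have "(\<Sum>j<n. c j *\<^sub>K u j) = (\<Sum>j<n. c j *\<^sub>K (u j - v j))"
    using c(2) by (simp add: scale_right_diff_distrib sum_subtractf)
  also have "\<dots> \<in> Y" using v(2) by (intro subspace_sum[OF Y] subspace_scale[OF Y])
  finally show False using u c(1) by blast
qed

lemma finite_dim_subset:
  assumes "finite_dim (*\<^sub>K) V" "subspace W" "W \<subseteq> V"
  shows "finite_dim (*\<^sub>K) W"
proof -
  obtain B where B: "finite B" "span B = V" using assms(1) by (auto simp: finite_dim_def)
  obtain C where C: "C \<subseteq> W" "independent C" "W \<subseteq> span C" using basis_exists[of W] by metis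
  have "finite C" using independent_span_bound[OF B(1) C(2)] C(1) assms(3) B(2) by auto
  moreover have "span C = W" using C assms(2) by (meson span_minimal subset_antisym)
  ultimately show ?thesis by (auto simp: finite_dim_def)
qed

lemma finite_dim_zero: "finite_dim (*\<^sub>K) {0}"
  unfolding finite_dim_def by (rule exI[of _ "{}"]) simp

text \<open>
  Preimages of a basis of \<open>W \<inter> range T\<close>, together with the kernel, span the preimage of \<open>W\<close>.
\<close>
lemma finite_dim_vimage:
  assumes T: "bounded_op T" and ker: "finite_dim (*\<^sub>K) {x. T x = 0}" and W: "finite_dim (*\<^sub>K) W"
  shows "finite_dim (*\<^sub>K) {x. T x \<in> W}"
proof -
  have sW: "subspace W" using W by (auto simp: finite_dim_def)
  have "subspace (W \<inter> range T)"
    using sW subspace_0[OF sW] op_zero[OF T]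
    by (intro subspace_inter[OF sW]) (auto intro!: subspaceI
       simp: image_iff op_add[OF T, symmetric] op_scale[OF T, symmetric])
  then have "finite_dim (*\<^sub>K) (W \<inter> range T)" by (rule finite_dim_subset[OF W]) blast
  then obtain B where B: "finite B" "span B = W \<inter> range T" by (auto simp: finite_dim_def)
  obtain C where C: "finite C" "span C = {x. T x = 0}" using ker by (auto simp: finite_dim_def)
  have "\<exists>s. \<forall>b\<in>B. T (s b) = b"
  proof (intro exI[of _ "inv T"] ballI)
    fix b assume "b \<in> B"
    then have "b \<in> range T" using span_superset[of B] B(2) by blast
    then show "T (inv T b) = b" by (rule f_inv_into_f)
  qed
  then obtain s where s: "\<And>b. b \<in> B \<Longrightarrow> T (s b) = b" by blast
  have "{x. T x \<in> W} \<subseteq> span (s ` B \<union> C)"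
  proof
    fix x assume "x \<in> {x. T x \<in> W}"
    then have "T x \<in> span B" using B(2) by auto
    then obtain a where a: "T x = (\<Sum>b\<in>B. a b *\<^sub>K b)" using span_finite[OF B(1)] by auto
    define y where "y = (\<Sum>b\<in>B. a b *\<^sub>K s b)"
    have "T y = T x" unfolding y_def a
      by (simp add: op_sum[OF T] op_scale[OF T] s cong: sum.cong)
    then have "x - y \<in> span C" using C(2) by (simp add: op_diff[OF T])
    moreover have "y \<in> span (s ` B)" unfolding y_def
      by (intro span_sum span_scale span_base) auto
    ultimately have "(x - y) + y \<in> span (s ` B \<union> C)"
      by (intro span_add) (auto intro: span_mono[THEN subsetD, rotated])
    then show "x \<in> span (s ` B \<union> C)" by simp
  qed
  moreover have "subspace {x. T x \<in> W}"
    using sW subspace_0[OF sW] by (intro subspaceI)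
      (auto simp: op_zero[OF T] op_add[OF T] op_scale[OF T] subspace_add subspace_scale)
  moreover have "finite_dim (*\<^sub>K) (span (s ` B \<union> C))"
    using B(1) C(1) unfolding finite_dim_def by (intro exI[of _ "s ` B \<union> C"]) simp
  ultimately show ?thesis using finite_dim_subset by blast
qed

end

section \<open>Selecting subsequences\<close>

lemma convergent_diagonal_subsequence:
  fixes f :: "nat \<Rightarrow> nat \<Rightarrow> 'k::heine_borel"
  assumes "\<And>i. bounded (range (\<lambda>n. f n i))"
  obtains r where "strict_mono r" "\<And>i. convergent (\<lambda>n. f (r n) i)"
proof -
  interpret subseqs "\<lambda>i s. convergent (\<lambda>n. f (s n) i)"
  proof
    fix i and s :: "nat \<Rightarrow> nat" assume "strict_mono s"
    have "bounded (range (\<lambda>n. f (s n) i))"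
      by (rule bounded_subset[OF assms[of i]]) auto
    then obtain l r where "strict_mono r" "((\<lambda>n. f (s n) i) \<circ> r) \<longlonglongrightarrow> l"
      using bounded_imp_convergent_subsequence by blast
    then show "\<exists>r'. strict_mono r' \<and> convergent (\<lambda>n. f ((s \<circ> r') n) i)"
      by (auto simp: convergent_def o_def)
  qed
  have "convergent (\<lambda>n. f (diagseq n) i)" for i
  proof -
    have "convergent (\<lambda>n. f ((diagseq \<circ> (+) (Suc i)) n) i)"
    proof (rule diagseq_holds)
      fix r s n assume "strict_mono (r::nat\<Rightarrow>nat)" and c: "convergent (\<lambda>m. f (s m) n)"
      then show "convergent (\<lambda>m. f ((s \<circ> r) m) n)"
        using convergent_subseq_convergent[OF c, of r] by (simp add: o_def)
    qed
    then obtain l where "(\<lambda>n. f (diagseq (n + Suc i)) i) \<longlonglongrightarrow> l" by (auto simp: convergent_def add.commute)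
    from LIMSEQ_offset[OF this] show ?thesis by (rule convergentI)
  qed
  then show thesis using that subseq_diagseq by blast
qed

text \<open>
  Each term is chosen after all earlier ones, hence as far out as they require.
\<close>
lemma fast_subsequence:
  fixes Q :: "nat \<Rightarrow> nat \<Rightarrow> nat \<Rightarrow> bool"
  assumes "\<And>l i. eventually (Q l i) sequentially"
  obtains t where "strict_mono t" "\<And>i l. i < l \<Longrightarrow> Q l (t i) (t l)"
proof -
  have "\<exists>t. \<forall>l. \<forall>i<l. t i < t l \<and> Q l (t i) (t l)"
  proof (rule dependent_wellorder_choice)
    fix l :: nat and t :: "nat \<Rightarrow> nat"
    have "eventually (\<lambda>m. \<forall>i\<in>{..<l}. t i < m \<and> Q l (t i) m) sequentially"
      by (intro eventually_ball_finite ballI eventually_conj assms eventually_gt_at_top) simp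
    then show "\<exists>r. \<forall>i<l. t i < r \<and> Q l (t i) r"
      by (auto dest!: eventually_happens'[rotated])
  qed auto
  then obtain t where "\<And>i l. i < l \<Longrightarrow> t i < t l \<and> Q l (t i) (t l)" by blast
  then show thesis using that[of t] by (simp add: strict_mono_def)
qed

text \<open>
  Let \<open>M k j\<close> be the value of the \<open>k\<close>-th functional at the \<open>j\<close>-th vector. Rows tend to zero, so the
  entries above the diagonal become small along a fast subsequence \<open>t\<close>. In a column the entries only
  converge, but the difference of the rows \<open>t (2 * k + 1)\<close> and \<open>t (2 * k)\<close> cancels the limit.
  Pairing it with the vector number \<open>t (2 * k + 1)\<close> keeps the diagonal entry of the first row,
  whereas the second row is already small there.
\<close>
lemma almost_diagonal_differences:
  fixes M :: "nat \<Rightarrow> nat \<Rightarrow> 'k::real_normed_vector"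
  assumes c: "c > 0" "\<And>k. c \<le> norm (M k k)"
    and row: "\<And>k. M k \<longlonglongrightarrow> 0" and col: "\<And>j. (\<lambda>k. M k j) \<longlonglongrightarrow> \<mu> j"
  obtains p q where "strict_mono q"
    and "\<And>k. 7 / 8 * c \<le> norm (M (q k) (q k) - M (p k) (q k))"
    and "\<And>k j. j \<noteq> k \<Longrightarrow> norm (M (q k) (q j) - M (p k) (q j)) \<le> c / 8 * (1/2)^j"
proof -
  define Q where "Q l i m \<longleftrightarrow> norm (M i m) < c / 16 * (1/2)^l \<and> norm (M m i - \<mu> i) < c / 16 * (1/2)^l"
    for l i m :: nat
  have "eventually (Q l i) sequentially" for l i
  proof -
    have pos: "c / 16 * (1/2)^l > 0" using c by simp
    show ?thesis unfolding Q_def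
      using tendstoD[OF row[of i] pos] tendstoD[OF col[of i] pos]
      by (intro eventually_conj) (simp_all add: dist_norm)
  qed
  then obtain t where t: "strict_mono t" "\<And>i l. i < l \<Longrightarrow> Q l (t i) (t l)"
    using fast_subsequence[of Q] by blast
  define p q where "p k = t (2 * k)" and "q k = t (2 * k + 1)" for k
  have up: "norm (M (t i) (t l)) \<le> c / 16 * (1/2)^l" and
    low: "norm (M (t l) (t i) - \<mu> (t i)) \<le> c / 16 * (1/2)^l" if "i < l" for i l
    using t(2)[OF that] by (auto simp: Q_def)
  have pow: "(1/2)^m \<le> ((1/2)^j :: real)" if "j \<le> m" for j m
    using that by (simp add: power_decreasing)
  show thesis
  proof (rule that)
    show "strict_mono q" using t(1) by (auto simp: q_def strict_mono_def)
    fix k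
    have "norm (M (p k) (q k)) \<le> c / 16 * (1/2)^(2 * k + 1)" unfolding p_def q_def by (rule up) simp
    also have "\<dots> \<le> c / 16 * (1/2)^0" using c by (intro mult_left_mono pow) auto
    finally show "7 / 8 * c \<le> norm (M (q k) (q k) - M (p k) (q k))"
      using norm_triangle_ineq2[of "M (q k) (q k)" "M (p k) (q k)"] c(1) c(2)[of "q k"] by simp
    fix j assume "j \<noteq> k"
    then consider "j < k" | "k < j" by linarith
    then show "norm (M (q k) (q j) - M (p k) (q j)) \<le> c / 8 * (1/2)^j"
    proof cases
      case 1
      have "norm (M (q k) (q j) - \<mu> (q j)) \<le> c / 16 * (1/2)^(2 * k + 1)"
        unfolding q_def by (rule low) (use 1 in simp)
      also have "\<dots> \<le> c / 16 * (1/2)^j" using c 1 by (intro mult_left_mono pow) auto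
      finally have 2: "norm (M (q k) (q j) - \<mu> (q j)) \<le> c / 16 * (1/2)^j" .
      have "norm (M (p k) (q j) - \<mu> (q j)) \<le> c / 16 * (1/2)^(2 * k)"
        unfolding q_def p_def by (rule low) (use 1 in simp)
      also have "\<dots> \<le> c / 16 * (1/2)^j" using c 1 by (intro mult_left_mono pow) auto
      finally show ?thesis
        using 2 norm_triangle_ineq4[of "M (q k) (q j) - \<mu> (q j)" "M (p k) (q j) - \<mu> (q j)"] by simp
    next
      case 2
      have "norm (M (q k) (q j)) \<le> c / 16 * (1/2)^(2 * j + 1)"
        unfolding q_def by (rule up) (use 2 in simp)
      also have "\<dots> \<le> c / 16 * (1/2)^j" using c 2 by (intro mult_left_mono pow) auto
      finally have 3: "norm (M (q k) (q j)) \<le> c / 16 * (1/2)^j" .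
      have "norm (M (p k) (q j)) \<le> c / 16 * (1/2)^(2 * j + 1)"
        unfolding q_def p_def by (rule up) (use 2 in simp)
      also have "\<dots> \<le> c / 16 * (1/2)^j" using c 2 by (intro mult_left_mono pow) auto
      finally show ?thesis
        using 3 norm_triangle_ineq4[of "M (q k) (q j)" "M (p k) (q j)"] by simp
    qed
  qed
qed

text \<open>
  If every infinite set of indices contains, at every scale, an index to which infinitely many members
  of the set are close, then nested choices produce the Cauchy alternative. A set of indices that
  violates this contains a separated sequence.
\<close>
lemma separated_or_Cauchy_subsequence:
  fixes \<rho> :: "nat \<Rightarrow> nat \<Rightarrow> real"
  assumes sym: "\<And>m n. \<rho> m n = \<rho> n m"
  obtains (separated) r \<delta> where "strict_mono (r :: nat \<Rightarrow> nat)" "\<delta> > 0" "\<And>m n. m \<noteq> n \<Longrightarrow> \<delta> \<le> \<rho> (r m) (r n)"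
    | (Cauchy) r where "strict_mono (r :: nat \<Rightarrow> nat)" "\<And>k. \<rho> (r k) (r (Suc k)) < (1/2)^k"
proof (cases "\<exists>r \<delta>. strict_mono (r :: nat \<Rightarrow> nat) \<and> \<delta> > 0 \<and> (\<forall>m n. m \<noteq> n \<longrightarrow> \<delta> \<le> \<rho> (r m) (r n))")
  case True
  then obtain r \<delta> where "strict_mono (r :: nat \<Rightarrow> nat)" "\<delta> > 0" "\<forall>m n. m \<noteq> n \<longrightarrow> \<delta> \<le> \<rho> (r m) (r n)"
    by blast
  then show thesis by (intro separated[of r \<delta>]) auto
next
  case False
  have crowd: "\<exists>i\<in>I. infinite {j\<in>I. \<rho> i j < \<delta>}" if I: "infinite I" and "\<delta> > 0" for I \<delta>
  proof (rule ccontr)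
    assume "\<not> ?thesis"
    then have fin: "finite {j\<in>I. \<rho> i j < \<delta>}" if "i \<in> I" for i using that by blast
    have "\<exists>r. \<forall>n::nat. r n \<in> I \<and> (\<forall>i<n. r i < r n \<and> \<delta> \<le> \<rho> (r i) (r n))"
    proof (rule dependent_wellorder_choice)
      fix n :: nat and r assume r: "\<And>y. y < n \<Longrightarrow> r y \<in> I \<and> (\<forall>i<y. r i < r y \<and> \<delta> \<le> \<rho> (r i) (r y))"
      have "finite ((\<Union>i<n. {j\<in>I. \<rho> (r i) j < \<delta>}) \<union> (\<Union>i<n. {..r i}))" using fin r by auto
      then have "infinite (I - ((\<Union>i<n. {j\<in>I. \<rho> (r i) j < \<delta>}) \<union> (\<Union>i<n. {..r i})))"
        using I by (simp add: Diff_infinite_finite)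
      then obtain m where "m \<in> I - ((\<Union>i<n. {j\<in>I. \<rho> (r i) j < \<delta>}) \<union> (\<Union>i<n. {..r i}))"
        using infinite_imp_nonempty by blast
      then have "m \<in> I \<and> (\<forall>i<n. r i < m \<and> \<delta> \<le> \<rho> (r i) m)" by (auto simp: not_le not_less)
      then show "\<exists>m. m \<in> I \<and> (\<forall>i<n. r i < m \<and> \<delta> \<le> \<rho> (r i) m)" ..
    qed simp
    then obtain r where "\<forall>n::nat. r n \<in> I \<and> (\<forall>i<n. r i < r n \<and> \<delta> \<le> \<rho> (r i) (r n))" ..
    then have r: "r i < r n \<and> \<delta> \<le> \<rho> (r i) (r n)" if "i < n" for n i :: nat using that by blast
    have "\<delta> \<le> \<rho> (r m) (r n)" if "m \<noteq> n" for m n :: nat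
      using that r[of m n] r[of n m] sym[of "r m" "r n"] by (cases "m < n") auto
    moreover have "strict_mono r" using r by (simp add: strict_mono_def)
    ultimately show False using False \<open>\<delta> > 0\<close> by blast
  qed
  define P where "P n x \<longleftrightarrow> infinite (snd x) \<and> (\<forall>j\<in>snd x. fst x < j \<and> \<rho> (fst x) j < (1/2)^n)"
    for n :: nat and x :: "nat \<times> nat set"
  have step: "\<exists>y. P n y \<and> fst y \<in> I" if inf: "infinite I" for n I
  proof -
    obtain i where i: "i \<in> I" "infinite {j\<in>I. \<rho> i j < (1/2)^n}" using crowd[OF inf, of "(1/2)^n"] by auto
    have "infinite ({j\<in>I. \<rho> i j < (1/2)^n} - {..i})" using i(2) by (simp add: Diff_infinite_finite)
    then have "P n (i, {j\<in>I. \<rho> i j < (1/2)^n} - {..i})" by (auto simp: P_def)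
    then show ?thesis using i(1) by (intro exI[of _ "(i, {j\<in>I. \<rho> i j < (1/2)^n} - {..i})"]) simp
  qed
  have "\<exists>f. \<forall>n. P n (f n) \<and> fst (f (Suc n)) \<in> snd (f n)"
  proof (rule dependent_nat_choice)
    show "\<exists>x. P 0 x" using step[of UNIV 0] by auto
    show "\<exists>y. P (Suc n) y \<and> fst y \<in> snd x" if "P n x" for x n
      using step[of "snd x" "Suc n"] that by (simp add: P_def)
  qed
  then obtain f where "\<forall>n. P n (f n) \<and> fst (f (Suc n)) \<in> snd (f n)" ..
  then have f: "P n (f n)" "fst (f (Suc n)) \<in> snd (f n)" for n by simp_all
  show thesis
  proof (rule Cauchy)
    show "strict_mono (\<lambda>n. fst (f n))"
      unfolding strict_mono_Suc_iff using f by (auto simp: P_def)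
    show "\<rho> (fst (f k)) (fst (f (Suc k))) < (1/2)^k" for k
      using f(1)[of k] f(2)[of k] by (auto simp: P_def)
  qed
qed

section \<open>Separated sequences span halfspaces\<close>

context banach_over
begin

text \<open>
  The functional \<open>\<eta> k\<close> is nearly constant, with value \<open>\<theta> k\<close>, on all \<open>z j\<close> except \<open>z k\<close>; the constant
  disappears when the coefficients add up to zero. Evaluating the functional that belongs to the largest
  coefficient then bounds all of them.
\<close>
lemma zero_sum_coefficient_bound:
  assumes c: "c > 0" and F: "\<And>k v. v \<in> F \<Longrightarrow> \<eta> k v = 0"
    and lin: "\<And>k. module_hom (*\<^sub>K) (*) (\<eta> k)" and bd: "\<And>k v. norm (\<eta> k v) \<le> 2 * norm v"
    and diag: "\<And>k. 7 / 8 * c \<le> norm (\<eta> k (z k) - \<theta> k)"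
    and off: "\<And>k j. j \<noteq> k \<Longrightarrow> norm (\<eta> k (z j) - \<theta> k) \<le> c / 8 * (1/2)^j"
    and b: "(\<Sum>j<N. b j) = 0" and "\<psi> \<in> F" and k: "k < (N::nat)"
  shows "5 / 16 * c * norm (b k) \<le> norm ((\<Sum>j<N. b j *\<^sub>K z j) + \<psi>)"
proof -
  define m where "m = Max ((\<lambda>j. norm (b j)) ` {..<N})"
  have le: "norm (b j) \<le> m" if "j < N" for j unfolding m_def using that by (intro Max_ge) auto
  have "m \<in> (\<lambda>j. norm (b j)) ` {..<N}" unfolding m_def using k by (intro Max_in) auto
  then obtain i where i: "i < N" "norm (b i) = m" by auto
  define x where "x = (\<Sum>j<N. b j *\<^sub>K z j) + \<psi>"
  have "\<eta> i x = (\<Sum>j<N. b j * \<eta> i (z j))"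
    unfolding x_def using F[OF \<open>\<psi> \<in> F\<close>, of i]
    by (simp add: module_hom.add[OF lin] module_hom.sum[OF lin] module_hom.scale[OF lin])
  also have "\<dots> = (\<Sum>j<N. b j * (\<eta> i (z j) - \<theta> i))"
    using b by (simp add: right_diff_distrib sum_subtractf flip: sum_distrib_right)
  also have "\<dots> = b i * (\<eta> i (z i) - \<theta> i) + (\<Sum>j\<in>{..<N}-{i}. b j * (\<eta> i (z j) - \<theta> i))"
    using i(1) by (subst sum.remove[of _ i]) auto
  finally have eq: "\<eta> i x = \<dots>" .
  have "norm (\<Sum>j\<in>{..<N}-{i}. b j * (\<eta> i (z j) - \<theta> i)) \<le> (\<Sum>j\<in>{..<N}-{i}. m * (c / 8 * (1/2)^j))"
  proof (rule sum_norm_le)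
    fix j assume "j \<in> {..<N} - {i}"
    then show "norm (b j * (\<eta> i (z j) - \<theta> i)) \<le> m * (c / 8 * (1/2)^j)"
      unfolding norm_mult using order_trans[OF norm_ge_zero le[OF k]]
      by (intro mult_mono le off) auto
  qed
  also have "\<dots> \<le> (\<Sum>j<N. m * (c / 8 * (1/2)^j))"
    using c order_trans[OF norm_ge_zero le[OF k]] by (intro sum_mono2) auto
  also have "\<dots> = m * (c / 8) * (\<Sum>j<N. (1/2)^j)" by (simp add: sum_distrib_left mult.assoc)
  also have "\<dots> \<le> m * (c / 8) * 2"
    using c order_trans[OF norm_ge_zero le[OF k]]
    by (intro mult_left_mono) (auto simp: sum_gp_strict)
  finally have off': "norm (\<Sum>j\<in>{..<N}-{i}. b j * (\<eta> i (z j) - \<theta> i)) \<le> m * c / 4" by (simp add: mult.commute)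
  have "m * (7 / 8 * c) \<le> norm (b i * (\<eta> i (z i) - \<theta> i))"
    unfolding norm_mult i(2) using diag[of i] order_trans[OF norm_ge_zero le[OF k]] by (intro mult_left_mono) auto
  then have "m * (7 / 8 * c) - m * c / 4 \<le> norm (\<eta> i x)"
    unfolding eq using off' norm_diff_ineq[of "b i * (\<eta> i (z i) - \<theta> i)" "\<Sum>j\<in>{..<N}-{i}. b j * (\<eta> i (z j) - \<theta> i)"]
    by linarith
  also have "\<dots> \<le> 2 * norm x" by (rule bd)
  finally have "5 / 16 * c * m \<le> norm x" by (simp add: field_simps)
  moreover have "5 / 16 * c * norm (b k) \<le> 5 / 16 * c * m" using c le[OF k] by simp
  ultimately show ?thesis by (simp add: x_def)
qed

end

lemma sum_lessThan_extend:
  fixes h :: "nat \<Rightarrow> 'a::comm_monoid_add"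
  assumes "\<And>j. N \<le> j \<Longrightarrow> h j = 0" "N \<le> K"
  shows "sum h {..<K} = sum h {..<N}"
  using assms by (intro sum.mono_neutral_right) auto

context banach_over
begin

text \<open>
  Countably many functionals separate the pairs \<open>v m\<close>, \<open>v n\<close> modulo \<open>F\<close>, so along some subsequence all
  of them converge. A functional that separates two members cannot be close to its limit at both, so
  all indices but at most one have a functional that is far from its limit there.
\<close>
lemma separated_norming_functionals:
  assumes F: "subspace F" and B: "\<And>n. norm (v n) \<le> B"
    and sep: "\<And>m n. m \<noteq> n \<Longrightarrow> \<delta> \<le> infdist (v m - v n) F"
  obtains r g \<phi> where "strict_mono (r :: nat \<Rightarrow> nat)" "\<And>k. contraction (g k)" "\<And>k x. x \<in> F \<Longrightarrow> g k x = 0"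
    "\<And>k. (\<lambda>j. g k (v (r j))) \<longlonglongrightarrow> \<phi> k" "\<And>k. \<delta> / 2 \<le> norm (g k (v (r k)) - \<phi> k)"
proof -
  have "\<exists>\<gamma>. contraction \<gamma> \<and> (\<forall>x\<in>F. \<gamma> x = 0) \<and> \<gamma> (v m - v n) = of_real (infdist (v m - v n) F)" for m n
    by (rule separate[OF F, of "v m - v n"]) blast
  then obtain \<gamma> where g: "\<And>m n. contraction (\<gamma> m n)" "\<And>m n x. x \<in> F \<Longrightarrow> \<gamma> m n x = 0"
    "\<And>m n. \<gamma> m n (v m - v n) = of_real (infdist (v m - v n) F)" by metis
  define f where "f n i = \<gamma> (fst (prod_decode i)) (snd (prod_decode i)) (v n)" for n i
  have "bounded (range (\<lambda>n. f n i))" for i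
    by (rule boundedI[where B = B])
      (auto simp: f_def intro: order_trans[OF contraction_norm[OF g(1)] B])
  then obtain r where r: "strict_mono r" "\<And>i. convergent (\<lambda>n. f (r n) i)"
    using convergent_diagonal_subsequence by blast
  define L where "L m n = lim (\<lambda>k. \<gamma> m n (v (r k)))" for m n
  have L: "(\<lambda>k. \<gamma> m n (v (r k))) \<longlonglongrightarrow> L m n" for m n
    using r(2)[of "prod_encode (m, n)"] by (simp add: f_def L_def convergent_LIMSEQ_iff)
  define good where "good k \<longleftrightarrow> (\<exists>m n. \<delta> / 2 \<le> norm (\<gamma> m n (v (r k)) - L m n))" for k
  have two: "good i \<or> good j" if "i \<noteq> j" for i j
  proof -
    have ne: "r i \<noteq> r j" using that strict_mono_eq[OF r(1)] by simp
    let ?g = "\<gamma> (r i) (r j)" and ?L = "L (r i) (r j)"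
    have "\<delta> \<le> norm (?g (v (r i) - v (r j)))" using sep[OF ne] by (simp add: g(3) infdist_nonneg)
    also have "?g (v (r i) - v (r j)) = (?g (v (r i)) - ?L) - (?g (v (r j)) - ?L)"
      by (simp add: contraction_diff[OF g(1)])
    also have "norm \<dots> \<le> norm (?g (v (r i)) - ?L) + norm (?g (v (r j)) - ?L)" by (rule norm_triangle_ineq4)
    finally have "\<delta> / 2 \<le> norm (?g (v (r i)) - ?L) \<or> \<delta> / 2 \<le> norm (?g (v (r j)) - ?L)" by linarith
    then show ?thesis unfolding good_def by blast
  qed
  \<comment> \<open>At most one index is not good; it is skipped.\<close>
  obtain k0 where k0: "\<And>k. good (k0 + k)"
  proof (cases "\<forall>k. good k")
    case True
    then show thesis using that[of 0] by simp
  next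
    case False
    then obtain i where "\<not> good i" by blast
    then have "good (Suc i + k)" for k using two[of i "Suc i + k"] by auto
    then show thesis by (rule that)
  qed
  then obtain a b where ab: "\<And>k. \<delta> / 2 \<le> norm (\<gamma> (a k) (b k) (v (r (k0 + k))) - L (a k) (b k))"
    unfolding good_def by metis
  show thesis
  proof (rule that[of "\<lambda>k. r (k0 + k)" "\<lambda>k. \<gamma> (a k) (b k)" "\<lambda>k. L (a k) (b k)"])
    show "strict_mono (\<lambda>k. r (k0 + k))" using r(1) by (auto simp: strict_mono_def)
    show "(\<lambda>j. \<gamma> (a k) (b k) (v (r (k0 + j)))) \<longlonglongrightarrow> L (a k) (b k)" for k
      using LIMSEQ_ignore_initial_segment[OF L[of "a k" "b k"], of k0] by (simp add: add.commute)
  qed (use g ab in auto)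
qed

text \<open>
  This is the substitute for extracting a basic sequence. The sequence may cluster weakly at a vector
  of the bidual, and only the differences of its members are under control; the functionals are
  biorthogonal to them up to that ambiguity.
\<close>
proposition separated_imp_biorthogonal_differences:
  assumes F: "subspace F" and B: "\<And>n. norm (v n) \<le> B" and "\<delta> > 0"
    and sep: "\<And>m n. m \<noteq> n \<Longrightarrow> \<delta> \<le> infdist (v m - v n) F"
  obtains q \<kappa> where "strict_mono (q :: nat \<Rightarrow> nat)" "\<And>k. contraction (\<kappa> k)" "\<And>k x. x \<in> F \<Longrightarrow> \<kappa> k x = 0"
    "\<And>k i j. i \<noteq> k \<Longrightarrow> j \<noteq> k \<Longrightarrow> \<kappa> k (v (q i) - v (q j)) = 0"
    "\<And>k j. j \<noteq> k \<Longrightarrow> \<kappa> k (v (q k) - v (q j)) \<noteq> 0"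
proof -
  obtain r g \<phi> where r: "strict_mono (r :: nat \<Rightarrow> nat)" and g: "\<And>k. contraction (g k)" "\<And>k x. x \<in> F \<Longrightarrow> g k x = 0"
    and lim: "\<And>k. (\<lambda>j. g k (v (r j))) \<longlonglongrightarrow> \<phi> k" and big: "\<And>k. \<delta> / 2 \<le> norm (g k (v (r k)) - \<phi> k)"
    using separated_norming_functionals[where v = v, OF F B sep] by metis
  have phi: "norm (\<phi> k) \<le> B" for k
    by (rule LIMSEQ_le_const2[OF tendsto_norm[OF lim]])
      (auto intro!: exI[of _ 0] order_trans[OF contraction_norm[OF g(1)] B])
  have "bounded (range (\<lambda>k. g k (v (r j)) - \<phi> k))" for j
  proof (rule boundedI[where B = "B + B"], clarify)
    fix k
    have "norm (g k (v (r j))) \<le> B" by (rule order_trans[OF contraction_norm[OF g(1)] B])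
    then show "norm (g k (v (r j)) - \<phi> k) \<le> B + B"
      using norm_triangle_ineq4[of "g k (v (r j))" "\<phi> k"] phi[of k] by linarith
  qed
  then obtain s where s: "strict_mono s" "\<And>j. convergent (\<lambda>k. g (s k) (v (r j)) - \<phi> (s k))"
    using convergent_diagonal_subsequence[of "\<lambda>k j. g k (v (r j)) - \<phi> k"] by blast
  \<comment> \<open>The second subsequence makes the columns converge; the rows tend to zero by the choice of the first.\<close>
  define M where "M k j = g (s k) (v (r (s j))) - \<phi> (s k)" for k j
  have row: "M k \<longlonglongrightarrow> 0" for k
    unfolding M_def using LIMSEQ_subseq_LIMSEQ[OF LIM_zero[OF lim] s(1)] by (simp add: o_def)
  have col: "(\<lambda>k. M k j) \<longlonglongrightarrow> lim (\<lambda>k. M k j)" for j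
    using s(2)[of "s j"] by (simp add: M_def convergent_LIMSEQ_iff)
  have diag: "\<delta> / 2 \<le> norm (M k k)" for k using big by (simp add: M_def)
  have half: "0 < \<delta> / 2" using \<open>\<delta> > 0\<close> by simp
  obtain p q where pq: "strict_mono q"
    "\<And>k. 7 / 8 * (\<delta> / 2) \<le> norm (M (q k) (q k) - M (p k) (q k))"
    "\<And>k j. j \<noteq> k \<Longrightarrow> norm (M (q k) (q j) - M (p k) (q j)) \<le> \<delta> / 2 / 8 * (1/2)^j"
    using almost_diagonal_differences[where M = M, OF half diag row col] by metis
  define z where "z j = v (r (s (q j)))" for j
  define \<eta> where "\<eta> k x = g (s (q k)) x - g (s (p k)) x" for k x
  define \<theta> where "\<theta> k = \<phi> (s (q k)) - \<phi> (s (p k))" for k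
  have eta_lin: "module_hom (*\<^sub>K) (*) (\<eta> k)" for k
  by (intro module_hom.intro module_axioms module_mult module_hom_axioms.intro)
    (simp_all add: \<eta>_def contraction_add[OF g(1)] contraction_scale[OF g(1)] algebra_simps)
  have eta_norm: "norm (\<eta> k x) \<le> 2 * norm x" for k x
    unfolding \<eta>_def using norm_triangle_ineq4[of "g (s (q k)) x" "g (s (p k)) x"]
      contraction_norm[OF g(1), of "s (q k)" x] contraction_norm[OF g(1), of "s (p k)" x] by simp
  have eta_M: "\<eta> k (z j) - \<theta> k = M (q k) (q j) - M (p k) (q j)" for k j
    by (simp add: \<eta>_def \<theta>_def M_def z_def)
  have coeff: "5 / 16 * (\<delta> / 2) * norm (b k) \<le> norm ((\<Sum>j<N. b j *\<^sub>K z j) + \<psi>)"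
    if "(\<Sum>j<N. b j) = 0" "\<psi> \<in> F" "k < N" for b N \<psi> k
  proof (rule zero_sum_coefficient_bound[where \<eta> = \<eta> and \<theta> = \<theta> and F = F])
    show "\<eta> i x = 0" if "x \<in> F" for i x using g(2)[OF that] by (simp add: \<eta>_def)
    show "7 / 8 * (\<delta> / 2) \<le> norm (\<eta> i (z i) - \<theta> i)" for i unfolding eta_M by (rule pq(2))
    show "norm (\<eta> i (z j) - \<theta> i) \<le> \<delta> / 2 / 8 * (1/2)^j" if "j \<noteq> i" for i j
      unfolding eta_M by (rule pq(3)[OF that])
  qed (use that eta_lin eta_norm half in auto)
  \<comment> \<open>The functional \<open>\<kappa> k\<close> vanishes on \<open>G k\<close>; it exists because \<open>z k - z (Suc k)\<close> has positive distance from \<open>G k\<close>.\<close>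
  define G where "G k = span (F \<union> {z i - z j |i j. i \<noteq> k \<and> j \<noteq> k})" for k
  have far: "infdist (z k - z (Suc k)) (G k) > 0" for k
  proof -
    define R where "R x \<longleftrightarrow> (\<exists>a N. (\<forall>j\<ge>N. a j = 0) \<and> a k = 0 \<and> (\<Sum>j<N. a j) = 0 \<and> x - (\<Sum>j<N. a j *\<^sub>K z j) \<in> F)" for x
    have R: "R x" if "x \<in> G k" for x
    proof -
      have "subspace {x. R x}"
      proof (rule subspaceI; clarsimp)
        show "R 0" unfolding R_def using subspace_0[OF F] by (intro exI[of _ "\<lambda>_. 0"]) auto
      next
        fix x y assume "R x" "R y"
        then obtain a N b N' where a: "\<forall>j\<ge>N. a j = 0" "a k = 0" "(\<Sum>j<N. a j) = 0" "x - (\<Sum>j<N. a j *\<^sub>K z j) \<in> F"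
          and b: "\<forall>j\<ge>N'. b j = 0" "b k = 0" "(\<Sum>j<N'. b j) = 0" "y - (\<Sum>j<N'. b j *\<^sub>K z j) \<in> F"
          unfolding R_def by blast
        define K where "K = max N N'"
        have ext: "(\<Sum>j<K. a j) = (\<Sum>j<N. a j)" "(\<Sum>j<K. a j *\<^sub>K z j) = (\<Sum>j<N. a j *\<^sub>K z j)"
          "(\<Sum>j<K. b j) = (\<Sum>j<N'. b j)" "(\<Sum>j<K. b j *\<^sub>K z j) = (\<Sum>j<N'. b j *\<^sub>K z j)"
          by (rule sum_lessThan_extend; use a(1) b(1) in \<open>simp add: K_def\<close>)+
        have "x + y - (\<Sum>j<K. (a j + b j) *\<^sub>K z j) = (x - (\<Sum>j<N. a j *\<^sub>K z j)) + (y - (\<Sum>j<N'. b j *\<^sub>K z j))"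
          by (simp add: scale_left_distrib sum.distrib ext)
        also have "\<dots> \<in> F" by (rule subspace_add[OF F a(4) b(4)])
        finally show "R (x + y)" unfolding R_def using a b ext
          by (intro exI[of _ "\<lambda>j. a j + b j"] exI[of _ K]) (auto simp: sum.distrib K_def)
      next
        fix c x assume "R x"
        then obtain a N where a: "\<forall>j\<ge>N. a j = 0" "a k = 0" "(\<Sum>j<N. a j) = 0" "x - (\<Sum>j<N. a j *\<^sub>K z j) \<in> F"
          unfolding R_def by blast
        have "c *\<^sub>K x - (\<Sum>j<N. (c * a j) *\<^sub>K z j) = c *\<^sub>K (x - (\<Sum>j<N. a j *\<^sub>K z j))"
          by (simp add: scale_right_diff_distrib scale_sum_right)
        also have "\<dots> \<in> F" by (rule subspace_scale[OF F a(4)])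
        finally show "R (c *\<^sub>K x)" unfolding R_def using a
          by (intro exI[of _ "\<lambda>j. c * a j"] exI[of _ N]) (auto simp flip: sum_distrib_left)
      qed
      moreover have "R x" if "x \<in> F" for x
        unfolding R_def using that by (intro exI[of _ "\<lambda>_. 0"]) auto
      moreover have "R (z i - z j)" if "i \<noteq> k" "j \<noteq> k" for i j
      proof -
        define a :: "nat \<Rightarrow> 'k" where "a = (\<lambda>l. (if l = i then 1 else 0) - (if l = j then 1 else 0))"
        have "(\<Sum>l<Suc (max i j). a l *\<^sub>K z l) = z i - z j"
          by (simp add: a_def scale_left_diff_distrib sum_subtractf if_distrib[of "\<lambda>c. c *\<^sub>K _"] sum.delta less_Suc_eq_le cong: if_cong)
        moreover have "(\<Sum>l<Suc (max i j). a l) = 0"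
          by (simp add: a_def sum_subtractf sum.delta less_Suc_eq_le)
        ultimately show ?thesis unfolding R_def using that subspace_0[OF F]
          by (intro exI[of _ a] exI[of _ "Suc (max i j)"]) (auto simp: a_def)
      qed
      ultimately have "G k \<subseteq> {x. R x}" unfolding G_def by (intro span_minimal) auto
      then show ?thesis using that by blast
    qed
    have "5 / 16 * (\<delta> / 2) \<le> infdist (z k - z (Suc k)) (G k)"
    proof (rule infdist_geI)
      show "subspace (G k)" by (simp add: G_def)
      fix m assume "m \<in> G k"
      from R[OF this] obtain a N where a: "\<forall>j\<ge>N. a j = 0" "a k = 0" "(\<Sum>j<N. a j) = 0" "m - (\<Sum>j<N. a j *\<^sub>K z j) \<in> F"
        unfolding R_def by blast
      define K where "K = max N (Suc (Suc k))"
      have ext: "(\<Sum>j<K. a j) = (\<Sum>j<N. a j)" "(\<Sum>j<K. a j *\<^sub>K z j) = (\<Sum>j<N. a j *\<^sub>K z j)"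
        by (rule sum_lessThan_extend; use a(1) in \<open>simp add: K_def\<close>)+
      define b where "b = (\<lambda>l. (if l = k then 1 else 0) - (if l = Suc k then 1 else 0) - a l)"
      have kK: "k < K" "Suc k < K" by (auto simp: K_def)
      have bz: "(\<Sum>l<K. b l *\<^sub>K z l) = z k - z (Suc k) - (\<Sum>j<N. a j *\<^sub>K z j)"
        using kK by (simp add: b_def scale_left_diff_distrib sum_subtractf if_distrib[of "\<lambda>c. c *\<^sub>K _"] sum.delta ext cong: if_cong)
      have b0: "(\<Sum>l<K. b l) = 0" using kK a(3) by (simp add: b_def sum_subtractf sum.delta ext)
      have "- (m - (\<Sum>j<N. a j *\<^sub>K z j)) \<in> F" by (rule subspace_neg[OF F a(4)])
      moreover have "norm (b k) = 1" using a(2) by (simp add: b_def)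
      ultimately show "5 / 16 * (\<delta> / 2) \<le> norm (z k - z (Suc k) - m)"
        using coeff[OF b0 _ kK(1)] by (force simp: bz)
    qed
    then show ?thesis using \<open>\<delta> > 0\<close> by linarith
  qed
  have "\<exists>\<kappa>. contraction \<kappa> \<and> (\<forall>x\<in>G k. \<kappa> x = 0) \<and> \<kappa> (z k - z (Suc k)) \<noteq> 0" for k
  proof -
    have "subspace (G k)" by (simp add: G_def)
    from separate[OF this, of "z k - z (Suc k)"] obtain \<gamma>
      where "contraction \<gamma>" "\<And>x. x \<in> G k \<Longrightarrow> \<gamma> x = 0" "\<gamma> (z k - z (Suc k)) = of_real (infdist (z k - z (Suc k)) (G k))"
      by blast
    then show ?thesis using far[of k] by (intro exI[of _ \<gamma>]) auto
  qed
  then obtain \<kappa> where kappa: "\<And>k. contraction (\<kappa> k)" "\<And>k x. x \<in> G k \<Longrightarrow> \<kappa> k x = 0" "\<And>k. \<kappa> k (z k - z (Suc k)) \<noteq> 0"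
    by metis
  have kz: "\<kappa> k (z i - z j) = 0" if "i \<noteq> k" "j \<noteq> k" for i j k
    by (rule kappa(2)) (use that in \<open>auto simp: G_def intro!: span_base\<close>)
  show thesis
  proof (rule that[of "\<lambda>j. r (s (q j))" \<kappa>])
    show "strict_mono (\<lambda>j. r (s (q j)))" using r s(1) pq(1) by (simp add: strict_mono_def)
    show "\<kappa> k x = 0" if "x \<in> F" for k x
      by (rule kappa(2)) (use that in \<open>auto simp: G_def intro: span_base\<close>)
    show "\<kappa> k (v (r (s (q i))) - v (r (s (q j)))) = 0" if "i \<noteq> k" "j \<noteq> k" for i j k
      using kz[OF that] by (simp add: z_def)
    show "\<kappa> k (v (r (s (q k))) - v (r (s (q j)))) \<noteq> 0" if "j \<noteq> k" for k j
    proof -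
      have "\<kappa> k (z k - z j) = \<kappa> k (z k - z (Suc k)) + \<kappa> k (z (Suc k) - z j)"
        by (simp flip: contraction_add[OF kappa(1)])
      then show ?thesis using kz[of "Suc k" k j] that kappa(3) by (simp add: z_def)
    qed
  qed (rule kappa(1))
qed

lemma biorthogonal_coefficients_vanish:
  assumes "\<And>k. contraction (\<kappa> k)" "\<And>k j. j \<noteq> k \<Longrightarrow> \<kappa> k (u j) = 0" "\<And>k. \<kappa> k (u k) \<noteq> 0"
    and "\<And>k. \<kappa> k (\<Sum>j<n. c j *\<^sub>K u j) = 0"
  shows "\<forall>j<n::nat. c j = 0"
proof (intro allI impI)
  fix k assume k: "k < n"
  have "0 = (\<Sum>j<n. c j * \<kappa> k (u j))"
    using assms(4)[of k] by (simp add: contraction_sum[OF assms(1)] contraction_scale[OF assms(1)])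
  also have "\<dots> = (\<Sum>j\<in>{k}. c j * \<kappa> k (u j))"
    using k assms(2) by (intro sum.mono_neutral_right) auto
  finally show "c k = 0" using assms(3)[of k] by simp
qed

text \<open>
  The halfspace is the closed span of \<open>F\<close> and the even-numbered members of the selected subsequence.
  It exceeds the closed span of \<open>F\<close> and the differences \<open>z (2 * j) - z 0\<close> by at most one dimension,
  and differences of odd-numbered members are independent modulo the latter.
\<close>
theorem AIH_of_separated_sequence:
  assumes T: "bounded_op T" and F: "subspace F" and TF: "\<And>x. x \<in> F \<Longrightarrow> T x \<in> F"
    and B: "\<And>n::nat. norm (v n) \<le> B" and d: "\<delta> > 0"
    and sep: "\<And>m n. m \<noteq> n \<Longrightarrow> \<delta> \<le> infdist (v m - v n) F"
    and Tv: "\<And>n. \<exists>l s. T (v n) - l *\<^sub>K v n - s *\<^sub>K e \<in> F"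
  shows "has_AIH T"
proof -
  obtain q \<kappa> where q: "strict_mono (q :: nat \<Rightarrow> nat)" and k: "\<And>k. contraction (\<kappa> k)" "\<And>k x. x \<in> F \<Longrightarrow> \<kappa> k x = 0"
    and k0: "\<And>k i j. i \<noteq> k \<Longrightarrow> j \<noteq> k \<Longrightarrow> \<kappa> k (v (q i) - v (q j)) = 0"
    and k1: "\<And>k j. j \<noteq> k \<Longrightarrow> \<kappa> k (v (q k) - v (q j)) \<noteq> 0"
    using separated_imp_biorthogonal_differences[where v = v, OF F B d sep] by metis
  define z where "z j = v (q j)" for j
  define S where "S = span (F \<union> range (\<lambda>j. z (2 * j)))"
  define S0 where "S0 = span (F \<union> range (\<lambda>j. z (2 * j) - z 0))"
  have sub: "subspace (closure S)" "subspace (closure S0)"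
    by (auto simp: S_def S0_def intro: subspace_closure)
  have line: "closure S \<subseteq> {m + t *\<^sub>K z 0 |m t. m \<in> closure S0}" (is "_ \<subseteq> ?L")
  proof (rule closure_minimal)
    show "closed ?L" by (rule closed_add_line[OF sub(2)]) simp
    have "F \<union> range (\<lambda>j. z (2 * j)) \<subseteq> ?L"
    proof (intro Un_least subsetI)
      fix x assume "x \<in> F"
      then have "x \<in> closure S0" unfolding S0_def by (intro closure_subset[THEN subsetD] span_base) auto
      then show "x \<in> ?L" by (intro CollectI exI[of _ x] exI[of _ 0]) simp
    next
      fix x assume "x \<in> range (\<lambda>j. z (2 * j))"
      then obtain j where j: "x = z (2 * j)" by blast
      have "z (2 * j) - z 0 \<in> closure S0" unfolding S0_def by (intro closure_subset[THEN subsetD] span_base) auto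
      then show "x \<in> ?L" unfolding j by (intro CollectI exI[of _ "z (2 * j) - z 0"] exI[of _ 1]) simp
    qed
    then show "S \<subseteq> ?L" unfolding S_def by (rule span_minimal[OF _ subspace_add_line[OF sub(2)]])
  qed
  have codim0: "\<not> finite_codim (*\<^sub>K) (closure S0)"
  proof (rule not_finite_codimI[OF sub(2), where u = "\<lambda>j. z (2 * j + 3) - z 1"])
    fix n and c :: "nat \<Rightarrow> 'k" assume x: "(\<Sum>j<n. c j *\<^sub>K (z (2 * j + 3) - z 1)) \<in> closure S0"
    show "\<forall>j<n. c j = 0"
    proof (rule biorthogonal_coefficients_vanish[where u = "\<lambda>j. z (2 * j + 3) - z 1" and \<kappa> = "\<lambda>j. \<kappa> (2 * j + 3)"])
      fix i
      have "\<kappa> (2 * i + 3) x = 0" if "x \<in> S0" for x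
      proof -
        have "S0 \<subseteq> {x. \<kappa> (2 * i + 3) x = 0}" unfolding S0_def
        proof (rule span_minimal)
          show "F \<union> range (\<lambda>j. z (2 * j) - z 0) \<subseteq> {x. \<kappa> (2 * i + 3) x = 0}"
          proof (intro Un_least subsetI CollectI)
            fix x assume "x \<in> range (\<lambda>j. z (2 * j) - z 0)"
            then obtain j where "x = z (2 * j) - z 0" by blast
            moreover have "2 * j \<noteq> 2 * i + 3" by presburger
            ultimately show "\<kappa> (2 * i + 3) x = 0" using k0[of "2 * j" "2 * i + 3" 0] by (simp add: z_def)
          qed (rule k(2))
        qed (auto intro!: subspaceI simp: contraction_zero[OF k(1)] contraction_add[OF k(1)] contraction_scale[OF k(1)])
        then show ?thesis using that by blast
      qed
      then show "\<kappa> (2 * i + 3) (\<Sum>j<n. c j *\<^sub>K (z (2 * j + 3) - z 1)) = 0"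
        by (rule contraction_zero_on_closure[OF k(1) _ x])
      show "\<kappa> (2 * i + 3) (z (2 * i + 3) - z 1) \<noteq> 0" using k1[of 1 "2 * i + 3"] by (simp add: z_def)
      show "\<kappa> (2 * i + 3) (z (2 * j + 3) - z 1) = 0" if "j \<noteq> i" for j
        using that k0[of "2 * j + 3" "2 * i + 3" 1] by (simp add: z_def)
    qed (rule k(1))
  qed
  have codim: "\<not> finite_codim (*\<^sub>K) (closure S)"
  proof
    assume "finite_codim (*\<^sub>K) (closure S)"
    then obtain A where A: "finite A" "\<forall>x. \<exists>v\<in>span A. x - v \<in> closure S" by (auto simp: finite_codim_def)
    have "\<exists>v\<in>span (insert (z 0) A). x - v \<in> closure S0" for x
    proof -
      obtain w where w: "w \<in> span A" "x - w \<in> closure S" using A(2) by blast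
      then obtain m t where mt: "x - w = m + t *\<^sub>K z 0" "m \<in> closure S0" using line by blast
      have "w + t *\<^sub>K z 0 \<in> span (insert (z 0) A)"
        using w(1) span_mono[of A "insert (z 0) A"] by (intro span_add span_scale) (auto intro: span_base)
      moreover have "x - (w + t *\<^sub>K z 0) = m" using mt(1) by (simp add: algebra_simps)
      ultimately show ?thesis using mt(2) by (intro bexI[of _ "w + t *\<^sub>K z 0"]) simp_all
    qed
    then show False using codim0 A(1) by (auto simp: finite_codim_def dest!: spec[of _ "insert (z 0) A"])
  qed
  have zS: "z (2 * j) \<in> closure S" for j
    unfolding S_def by (intro closure_subset[THEN subsetD] span_base) auto
  have dim: "\<not> finite_dim (*\<^sub>K) (closure S)"
  proof (rule not_finite_dimI[where u = "\<lambda>j. z (2 * j + 2) - z 0"])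
    fix j show "z (2 * j + 2) - z 0 \<in> closure S"
      using zS[of "Suc j"] zS[of 0] by (auto intro: subspace_diff[OF sub(1)])
  next
    fix n and c :: "nat \<Rightarrow> 'k" assume x: "(\<Sum>j<n. c j *\<^sub>K (z (2 * j + 2) - z 0)) = 0"
    show "\<forall>j<n. c j = 0"
    proof (rule biorthogonal_coefficients_vanish[where u = "\<lambda>j. z (2 * j + 2) - z 0" and \<kappa> = "\<lambda>j. \<kappa> (2 * j + 2)"])
      fix i
      show "\<kappa> (2 * i + 2) (\<Sum>j<n. c j *\<^sub>K (z (2 * j + 2) - z 0)) = 0"
        unfolding x by (rule contraction_zero[OF k(1)])
      show "\<kappa> (2 * i + 2) (z (2 * i + 2) - z 0) \<noteq> 0" using k1[of 0 "2 * i + 2"] by (simp add: z_def)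
      show "\<kappa> (2 * i + 2) (z (2 * j + 2) - z 0) = 0" if "j \<noteq> i" for j
        using that k0[of "2 * j + 2" "2 * i + 2" 0] by (simp add: z_def)
    qed (rule k(1))
  qed
  have inv: "\<exists>t. T y - t *\<^sub>K e \<in> closure S" if "y \<in> closure S" for y
  proof -
    let ?E = "{m + t *\<^sub>K e |m t. m \<in> closure S}"
    have E: "subspace ?E" "closed ?E" by (rule subspace_add_line[OF sub(1)], rule closed_add_line[OF sub(1) closed_closure])
    have "closed {x. T x \<in> ?E}"
      using continuous_closed_vimage[OF E(2), of T] linear_continuous_at[OF op_linear[OF T]]
      by (simp add: vimage_def)
    moreover have "span (F \<union> range (\<lambda>j. z (2 * j))) \<subseteq> {x. T x \<in> ?E}"
    proof (rule span_minimal)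
      show "subspace {x. T x \<in> ?E}"
      proof (rule subspaceI, goal_cases)
        case 1 show ?case using subspace_0[OF E(1)] by (simp only: mem_Collect_eq op_zero[OF T])
      next
        case (2 x y) then show ?case using subspace_add[OF E(1), of "T x" "T y"] by (simp only: mem_Collect_eq op_add[OF T])
      next
        case (3 c x) then show ?case using subspace_scale[OF E(1), of "T x" c] by (simp only: mem_Collect_eq op_scale[OF T])
      qed
      show "F \<union> range (\<lambda>j. z (2 * j)) \<subseteq> {x. T x \<in> ?E}"
      proof (intro Un_least subsetI CollectI)
        fix x assume "x \<in> F"
        then have "T x \<in> closure S" unfolding S_def using TF by (intro closure_subset[THEN subsetD] span_base) auto
        then show "\<exists>m t. T x = m + t *\<^sub>K e \<and> m \<in> closure S" by (intro exI[of _ "T x"] exI[of _ 0]) simp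
      next
        fix x assume "x \<in> range (\<lambda>j. z (2 * j))"
        then obtain j where j: "x = z (2 * j)" by blast
        obtain l s where "T x - l *\<^sub>K x - s *\<^sub>K e \<in> F" using Tv[of "q (2 * j)"] by (auto simp: j z_def)
        then have "T x - l *\<^sub>K x - s *\<^sub>K e \<in> closure S" unfolding S_def by (intro closure_subset[THEN subsetD] span_base) auto
        then have "(T x - l *\<^sub>K x - s *\<^sub>K e) + l *\<^sub>K x \<in> closure S"
          unfolding j by (intro subspace_add[OF sub(1)] subspace_scale[OF sub(1)] zS)
        then have "T x - s *\<^sub>K e \<in> closure S" by (simp add: algebra_simps)
        then show "\<exists>m t. T x = m + t *\<^sub>K e \<and> m \<in> closure S"
          by (intro exI[of _ "T x - s *\<^sub>K e"] exI[of _ s]) simp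
      qed
    qed
    ultimately have "closure S \<subseteq> {x. T x \<in> ?E}" unfolding S_def[symmetric] by (rule closure_minimal[rotated])
    then obtain m t where "T y = m + t *\<^sub>K e" "m \<in> closure S" using \<open>y \<in> closure S\<close> by blast
    then show ?thesis by (intro exI[of _ t]) simp
  qed
  show ?thesis unfolding has_AIH_def halfspace_def using sub(1) dim codim inv by blast
qed

text \<open>
  Riesz's lemma, iterated along the finite-dimensional spans of the vectors already chosen.
\<close>
lemma infinite_dim_separated_sequence:
  assumes W: "subspace W" and inf: "\<not> finite_dim (*\<^sub>K) W"
  obtains v where "\<And>n. v n \<in> W" "\<And>n. norm (v n) \<le> 2" "\<And>m n. m \<noteq> n \<Longrightarrow> 1 \<le> norm (v m - v (n::nat))"
proof -
  have "\<exists>v. \<forall>n::nat. v n \<in> W \<and> norm (v n) \<le> 2 \<and> (\<forall>i<n. 1 \<le> norm (v n - v i))"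
  proof (rule dependent_wellorder_choice)
    fix n :: nat and v :: "nat \<Rightarrow> 'v"
    assume v: "\<And>y. y < n \<Longrightarrow> v y \<in> W \<and> norm (v y) \<le> 2 \<and> (\<forall>i<y. 1 \<le> norm (v y - v i))"
    define M where "M = span (v ` {..<n})"
    have M: "subspace M" "closed M" by (auto simp: M_def intro: closed_span_finite)
    have "M \<subseteq> W" unfolding M_def using v W by (intro span_minimal) auto
    moreover have "M \<noteq> W" using inf by (auto simp: finite_dim_def M_def)
    ultimately obtain x where x: "x \<in> W" "x \<notin> M" by blast
    have d: "infdist x M > 0" using infdist_pos_not_in_closed[OF M(2) _ x(2)] subspace_0[OF M(1)] by blast
    then have "infdist x M < 2 * infdist x M" by simp
    from infdist_subspace_bound[OF M(1) this] obtain m where m: "m \<in> M" "norm (x - m) < 2 * infdist x M" .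
    define r where "r = inverse (infdist x M) *\<^sub>R (x - m)"
    have "r \<in> W" unfolding r_def using x(1) m(1) \<open>M \<subseteq> W\<close> by (intro subspace_scaleR[OF W] subspace_diff[OF W]) auto
    moreover have "norm r \<le> 2"
    proof -
      have "norm r = norm (x - m) / infdist x M" using d by (simp add: r_def divide_inverse mult.commute)
      then show ?thesis using m(2) d by (simp add: divide_le_eq)
    qed
    moreover have "1 \<le> norm (r - y)" if "y \<in> M" for y
    proof -
      have "r - y = inverse (infdist x M) *\<^sub>R (x - (m + infdist x M *\<^sub>R y))"
        using d by (simp add: r_def algebra_simps)
      moreover have "infdist x M \<le> norm (x - (m + infdist x M *\<^sub>R y))"
        by (intro infdist_le_norm subspace_add[OF M(1)] m(1) subspace_scaleR[OF M(1)] that)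
      ultimately show ?thesis using d by (simp only: norm_scaleR) (simp add: field_simps)
    qed
    ultimately show "\<exists>r. r \<in> W \<and> norm r \<le> 2 \<and> (\<forall>i<n. 1 \<le> norm (r - v i))"
      by (intro exI[of _ r]) (auto simp: M_def intro: span_base)
  qed auto
  then obtain v where v: "\<forall>n::nat. v n \<in> W \<and> norm (v n) \<le> 2 \<and> (\<forall>i<n. 1 \<le> norm (v n - v i))" ..
  show thesis
  proof (rule that[of v])
    fix m n :: nat assume "m \<noteq> n"
    then show "1 \<le> norm (v m - v n)"
    proof (cases "n < m")
      case True
      then show ?thesis using v by blast
    next
      case False
      then have "1 \<le> norm (v n - v m)" using v \<open>m \<noteq> n\<close> by simp
      then show ?thesis by (simp add: norm_minus_commute)
    qed
  qed (use v in auto)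
qed

text \<open>
  Every subspace of an eigenspace is invariant, so a separated sequence in it suffices.
\<close>
lemma AIH_of_infinite_dim_eigenspace:
  assumes T: "bounded_op T" and inf: "\<not> finite_dim (*\<^sub>K) {x. T x - a *\<^sub>R x = 0}"
  shows "has_AIH T"
proof -
  have W: "subspace {x. T x - a *\<^sub>R x = 0}"
    by (rule subspaceI) (auto simp: op_zero[OF T] op_add[OF T] op_scale[OF T] algebra_simps scaleR_sc mult.commute)
  obtain v where v: "\<And>n. v n \<in> {x. T x - a *\<^sub>R x = 0}" "\<And>n. norm (v n) \<le> 2" "\<And>m n. m \<noteq> n \<Longrightarrow> 1 \<le> norm (v m - v (n::nat))"
    using infinite_dim_separated_sequence[OF W inf] by metis
  show ?thesis
  proof (rule AIH_of_separated_sequence[OF T, where F = "{0}" and v = v and B = 2 and \<delta> = 1 and e = 0])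
    fix n show "\<exists>l s. T (v n) - l *\<^sub>K v n - s *\<^sub>K 0 \<in> {0}"
      using v(1)[of n] by (intro exI[of _ "of_real a"] exI[of _ 0]) (simp add: scaleR_sc)
  qed (use v in \<open>auto simp: op_zero[OF T] dist_norm subspace_single_0\<close>)
qed

text \<open>
  Completeness of the quotient by \<open>F\<close>, in terms of representatives: they are corrected by elements of
  \<open>F\<close> until they form a Cauchy sequence.
\<close>
lemma Cauchy_modulo_subspace:
  assumes F: "subspace F" and v: "\<And>k. infdist (v (Suc k) - v k) F < (1/2)^k"
  obtains w y where "w \<longlonglongrightarrow> y" "\<And>k. v k - w k \<in> F"
proof -
  have "\<exists>x\<in>F. norm (v (Suc k) - v k - x) < (1/2)^k" for k
    using infdist_subspace_bound[OF F v[of k]] by metis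
  then obtain x where x: "\<And>k. x k \<in> F" "\<And>k. norm (v (Suc k) - v k - x k) < (1/2)^k" by metis
  define w where "w k = v k - (\<Sum>i<k. x i)" for k
  have "norm (w (Suc k) - w k) \<le> (1/2)^k" for k
    using x(2)[of k] by (simp add: w_def algebra_simps)
  then have "summable (\<lambda>k. w (Suc k) - w k)"
    by (intro summable_comparison_test'[OF summable_geometric[of "1/2::real"], of 0]) auto
  then have "(\<lambda>n. \<Sum>k<n. w (Suc k) - w k) \<longlonglongrightarrow> (\<Sum>k. w (Suc k) - w k)" by (rule summable_LIMSEQ)
  then have "(\<lambda>n. w n - w 0) \<longlonglongrightarrow> (\<Sum>k. w (Suc k) - w k)" by (simp add: sum_lessThan_telescope)
  from tendsto_add[OF this tendsto_const[of "w 0"]]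
  have "w \<longlonglongrightarrow> (\<Sum>k. w (Suc k) - w k) + w 0" by simp
  moreover have "v k - w k \<in> F" for k using x(1) by (auto simp: w_def intro: subspace_sum[OF F])
  ultimately show thesis by (rule that)
qed

text \<open>
  The orbit is normalised modulo \<open>F\<close>. A separated subsequence produces a halfspace. A Cauchy
  subsequence has a limit \<open>y\<close> of distance at least one from \<open>F\<close>, and as the term with \<open>e\<close> is
  divided by the growing distance, \<open>T y - a y\<close> ends up in \<open>F\<close>. The last clause locates \<open>y\<close> in any
  closed subspace that contains the orbit and \<open>F\<close>.
\<close>
theorem AIH_or_limit_of_orbit:
  assumes T: "bounded_op T" and F: "subspace F" "closed F" and TF: "\<And>x. x \<in> F \<Longrightarrow> T x \<in> F"
    and lam: "l \<longlonglongrightarrow> a" and r: "\<And>n. T (r n) = l n *\<^sub>R r n - e"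
    and unb: "\<And>C. \<exists>n. C < infdist (r n) F"
  obtains "has_AIH T"
    | y where "y \<notin> F" "T y - a *\<^sub>R y \<in> F"
      "\<And>M. subspace M \<Longrightarrow> closed M \<Longrightarrow> F \<subseteq> M \<Longrightarrow> (\<And>n. r n \<in> M) \<Longrightarrow> y \<in> M"
proof -
  obtain s where s: "strict_mono s" "\<And>k. real k + 1 < infdist (r (s k)) F"
  proof -
    have "infinite {n. C < infdist (r n) F}" for C
    proof
      assume fin: "finite {n. C < infdist (r n) F}"
      define C' where "C' = Max (insert C ((\<lambda>n. infdist (r n) F) ` {n. C < infdist (r n) F}))"
      obtain n where n: "C' < infdist (r n) F" using unb by blast
      have "C \<le> C'" unfolding C'_def using fin by (intro Max_ge) auto
      then have "C < infdist (r n) F" using n by simp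
      then have "infdist (r n) F \<le> C'" unfolding C'_def using fin by (intro Max_ge) auto
      then show False using n by simp
    qed
    then have ex: "\<exists>n>m. C < infdist (r n) F" for m C
      unfolding infinite_nat_iff_unbounded by blast
    have "\<exists>s. \<forall>k. real k + 1 < infdist (r (s k)) F \<and> s k < s (Suc k)"
      by (rule dependent_nat_choice) (use ex in blast)+
    then show thesis using that by (auto simp: strict_mono_Suc_iff)
  qed
  define d where "d k = infdist (r (s k)) F" for k
  have d: "real k + 1 < d k" "d k > 0" for k using s(2)[of k] by (auto simp: d_def)
  have "\<exists>x\<in>F. norm (r (s k) - x) < 2 * d k" for k
    using infdist_subspace_bound[OF F(1), of "r (s k)" "2 * d k"] d(2)[of k] by (metis d_def less_add_same_cancel1 mult_2)
  then obtain x where x: "\<And>k. x k \<in> F" "\<And>k. norm (r (s k) - x k) < 2 * d k" by metis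
  define v where "v k = inverse (d k) *\<^sub>R (r (s k) - x k)" for k
  have vB: "norm (v k) \<le> 2" for k
  proof -
    have "norm (v k) = norm (r (s k) - x k) / d k" using d(2)[of k] by (simp add: v_def divide_inverse mult.commute)
    then show ?thesis using x(2)[of k] d(2)[of k] by (simp add: divide_le_eq)
  qed
  have vF: "1 \<le> norm (v k - y)" if "y \<in> F" for k y
  proof -
    have "v k - y = inverse (d k) *\<^sub>R (r (s k) - (x k + d k *\<^sub>R y))"
      using d(2)[of k] by (simp add: v_def algebra_simps)
    moreover have "d k \<le> norm (r (s k) - (x k + d k *\<^sub>R y))"
      unfolding d_def by (intro infdist_le_norm subspace_add[OF F(1)] x(1) subspace_scaleR[OF F(1)] that)
    ultimately show ?thesis using d(2)[of k] by (simp only: norm_scaleR) (simp add: field_simps)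
  qed
  have Tv: "T (v k) - l (s k) *\<^sub>R v k + inverse (d k) *\<^sub>R e \<in> F" for k
  proof -
    have "T (v k) - l (s k) *\<^sub>R v k + inverse (d k) *\<^sub>R e = inverse (d k) *\<^sub>R (l (s k) *\<^sub>R x k - T (x k))"
      by (simp add: v_def op_scaleR[OF T] op_diff[OF T] r algebra_simps)
    also have "\<dots> \<in> F" by (intro subspace_scaleR[OF F(1)] subspace_diff[OF F(1)] x(1) TF)
    finally show ?thesis .
  qed
  show thesis
  proof (rule separated_or_Cauchy_subsequence[of "\<lambda>i j. infdist (v j - v i) F"])
    fix m n
    have "infdist (v n - v m) F \<le> infdist (v m - v n) F" for m n
    proof (rule infdist_geI[OF F(1)])
      fix y assume "y \<in> F"
      then have "infdist (v n - v m) F \<le> norm ((v n - v m) - (- y))"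
        by (intro infdist_le_norm subspace_neg[OF F(1)])
      also have "(v n - v m) - (- y) = - (v m - v n - y)" by simp
      also have "norm \<dots> = norm (v m - v n - y)" by (rule norm_minus_cancel)
      finally show "infdist (v n - v m) F \<le> norm (v m - v n - y)" .
    qed
    then show "infdist (v n - v m) F = infdist (v m - v n) F" by (intro antisym)
  next
    fix q \<delta> assume q: "strict_mono (q :: nat \<Rightarrow> nat)" "\<delta> > 0" "\<And>m n. m \<noteq> n \<Longrightarrow> \<delta> \<le> infdist (v (q n) - v (q m)) F"
    have "has_AIH T"
    proof (rule AIH_of_separated_sequence[OF T F(1) TF, where v = "\<lambda>n. v (q n)" and e = e])
      fix n
      show "\<exists>c t. T (v (q n)) - c *\<^sub>K v (q n) - t *\<^sub>K e \<in> F"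
        using Tv[of "q n"] by (intro exI[of _ "of_real (l (s (q n)))"] exI[of _ "- of_real (inverse (d (q n)))"])
          (simp add: scaleR_sc)
    qed (use vB q in auto)
    then show thesis by (rule that(1))
  next
    fix q assume q: "strict_mono (q :: nat \<Rightarrow> nat)" "\<And>k. infdist (v (q (Suc k)) - v (q k)) F < (1/2)^k"
    obtain w y where w: "w \<longlonglongrightarrow> y" "\<And>k. v (q k) - w k \<in> F"
      using Cauchy_modulo_subspace[OF F(1), of "\<lambda>k. v (q k)"] q(2) by metis
    show thesis
    proof (rule that(2))
      show "y \<notin> F"
      proof
        assume "y \<in> F"
        have "1 \<le> norm (w k - y)" for k
          using vF[OF subspace_add[OF F(1) w(2)[of k] \<open>y \<in> F\<close>], of "q k"] by (simp add: algebra_simps)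
        moreover have "(\<lambda>k. norm (w k - y)) \<longlonglongrightarrow> 0" using w(1) by (simp add: LIM_zero tendsto_norm_zero)
        ultimately show False using LIMSEQ_le_const[of "\<lambda>k. norm (w k - y)" 0 1] by force
      qed
      have sq: "filterlim (\<lambda>k. s (q k)) sequentially sequentially"
        using filterlim_compose[OF filterlim_subseq[OF s(1)] filterlim_subseq[OF q(1)]] by (simp add: o_def)
      have dinv: "(\<lambda>k. inverse (d (q k))) \<longlonglongrightarrow> 0"
      proof (rule Lim_null_comparison)
        have "norm (inverse (d (q k))) \<le> inverse (real (Suc k))" for k
        proof -
          have "real (Suc k) \<le> d (q k)" using d(1)[of "q k"] strict_mono_imp_increasing[OF q(1), of k] by simp
          then show ?thesis using d(2)[of "q k"] by (simp add: le_imp_inverse_le)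
        qed
        then show "\<forall>\<^sub>F k in sequentially. norm (inverse (d (q k))) \<le> inverse (real (Suc k))" by simp
      qed (rule LIMSEQ_inverse_real_of_nat)
      have "T (w k) - l (s (q k)) *\<^sub>R w k + inverse (d (q k)) *\<^sub>R e \<in> F" for k
      proof -
        define f where "f = v (q k) - w k"
        have wk: "w k = v (q k) - f" by (simp add: f_def)
        have "T (w k) - l (s (q k)) *\<^sub>R w k + inverse (d (q k)) *\<^sub>R e
          = (T (v (q k)) - l (s (q k)) *\<^sub>R v (q k) + inverse (d (q k)) *\<^sub>R e) - (T f - l (s (q k)) *\<^sub>R f)"
          unfolding wk by (simp add: op_diff[OF T] algebra_simps)
        also have "\<dots> \<in> F" using w(2)[of k] unfolding f_def[symmetric]
          by (intro subspace_diff[OF F(1)] Tv TF subspace_scaleR[OF F(1)])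
        finally show ?thesis .
      qed
      moreover have "(\<lambda>k. T (w k) - l (s (q k)) *\<^sub>R w k + inverse (d (q k)) *\<^sub>R e) \<longlonglongrightarrow> T y - a *\<^sub>R y + 0 *\<^sub>R e"
        by (intro tendsto_add tendsto_diff tendsto_scaleR op_tendsto[OF T] w(1) dinv tendsto_const
            filterlim_compose[OF lam sq])
      ultimately show "T y - a *\<^sub>R y \<in> F"
        using F(2) unfolding closed_sequential_limits by (metis (no_types, lifting) add.right_neutral scaleR_zero_left)
      fix M assume M: "subspace M" "closed M" "F \<subseteq> M" "\<And>n. r n \<in> M"
      have "v k \<in> M" for k unfolding v_def using M(3) x(1)
        by (intro subspace_scaleR[OF M(1)] subspace_diff[OF M(1)] M(4)) auto
      then have "w k \<in> M" for k
        using subspace_diff[OF M(1), of "v (q k)" "v (q k) - w k"] w(2)[of k] M(3) by auto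
      then show "y \<in> M" using M(2) w(1) unfolding closed_sequential_limits by blast
    qed
  qed
qed

end

section \<open>An operator and its adjoint\<close>

context banach_over
begin

definition is_resolvent :: "('v \<Rightarrow> 'v) \<Rightarrow> real \<Rightarrow> ('v \<Rightarrow> 'v) \<Rightarrow> bool" where
  "is_resolvent T l R \<longleftrightarrow> bounded_op R \<and> (\<forall>x. l *\<^sub>R R x - T (R x) = x) \<and> (\<forall>x. R (l *\<^sub>R x - T x) = x)"

text \<open>
  The term with the first nonzero coefficient would lie one step further down the chain.
\<close>
lemma strict_chain_independent:
  assumes Z: "\<And>j::nat. subspace (Z j)" "\<And>j. Z (Suc j) \<subseteq> Z j"
    and u: "\<And>j. u j \<in> Z j" "\<And>j. u j \<notin> Z (Suc j)" and sum: "(\<Sum>j<n. c j *\<^sub>K u j) \<in> Z n"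
  shows "\<forall>j<n. c j = 0"
proof -
  have anti: "Z j \<subseteq> Z i" if "i \<le> j" for i j by (rule lift_Suc_antimono_le[of Z, OF Z(2) that])
  have "j < n \<longrightarrow> c j = 0" for j
  proof (induction j rule: less_induct)
    case (less j)
    show ?case
    proof
      assume j: "j < n"
      have "(\<Sum>i<n. c i *\<^sub>K u i) = (\<Sum>i\<in>{..<n}-{j}. c i *\<^sub>K u i) + c j *\<^sub>K u j"
        using j by (subst sum.remove[of _ j]) auto
      moreover have "(\<Sum>i\<in>{..<n}-{j}. c i *\<^sub>K u i) \<in> Z (Suc j)"
      proof (rule subspace_sum[OF Z(1)])
        fix i assume i: "i \<in> {..<n} - {j}"
        show "c i *\<^sub>K u i \<in> Z (Suc j)"
        proof (cases "i < j")
          case True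
          then show ?thesis using less i subspace_0[OF Z(1)] by auto
        next
          case False
          then have "u i \<in> Z (Suc j)" using i u(1)[of i] anti[of "Suc j" i] by auto
          then show ?thesis by (rule subspace_scale[OF Z(1)])
        qed
      qed
      moreover have "(\<Sum>i<n. c i *\<^sub>K u i) \<in> Z (Suc j)" using sum anti[of "Suc j" n] j by auto
      ultimately have "c j *\<^sub>K u j \<in> Z (Suc j)" using subspace_diff[OF Z(1)] by (metis add_diff_cancel_left')
      then have "c j \<noteq> 0 \<Longrightarrow> inverse (c j) *\<^sub>K c j *\<^sub>K u j \<in> Z (Suc j)" using subspace_scale[OF Z(1)] by blast
      then show "c j = 0" using u(2)[of j] by auto
    qed
  qed
  then show ?thesis by blast
qed

end

text \<open>
  The pairing \<open>ev\<close> identifies \<open>'d\<close> with the full dual space of \<open>'x\<close>, and \<open>A\<close> with the adjoint of \<open>T\<close>.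
\<close>
locale dual_operator = X: banach_over scX + D: banach_over scD
  for scX :: "'k::{real_normed_field, heine_borel} \<Rightarrow> 'x::banach \<Rightarrow> 'x"
    and scD :: "'k \<Rightarrow> 'd::banach \<Rightarrow> 'd" +
  fixes ev :: "'d \<Rightarrow> 'x \<Rightarrow> 'k" and T :: "'x \<Rightarrow> 'x" and A :: "'d \<Rightarrow> 'd"
  assumes ev_add: "ev (f + g) x = ev f x + ev g x" and ev_scale: "ev (scD c f) x = c * ev f x"
    and ev_add_right: "ev f (x + y) = ev f x + ev f y" and ev_scale_right: "ev f (scX c x) = c * ev f x"
    and ev_norm: "norm (ev f x) \<le> norm f * norm x"
    and ev_eqI: "(\<And>x. ev f x = ev g x) \<Longrightarrow> f = g"
    and ev_full: "module_hom scX (*) \<gamma> \<Longrightarrow> 0 \<le> B \<Longrightarrow> (\<And>x. norm (\<gamma> x) \<le> B * norm x) \<Longrightarrow>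
      \<exists>f. norm f \<le> B \<and> ev f = \<gamma>"
    and T: "X.bounded_op T" and A: "D.bounded_op A" and ev_A: "ev (A f) x = ev f (T x)"
begin

lemma ev_hom: "module_hom scX (*) (ev f)"
by (intro module_hom.intro X.module_axioms module_mult module_hom_axioms.intro)
    (simp_all add: ev_add_right ev_scale_right)

lemma ev_hom_left: "module_hom scD (*) (\<lambda>f. ev f x)"
by (intro module_hom.intro D.module_axioms module_mult module_hom_axioms.intro)
    (simp_all add: ev_add ev_scale)

lemmas ev_right_simps = module_hom.zero[OF ev_hom] module_hom.diff[OF ev_hom] module_hom.neg[OF ev_hom] module_hom.sum[OF ev_hom]
lemmas ev_left_simps = module_hom.zero[OF ev_hom_left] module_hom.diff[OF ev_hom_left] module_hom.neg[OF ev_hom_left]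

lemma ev_scaleR: "ev (r *\<^sub>R f) x = of_real r * ev f x" "ev f (r *\<^sub>R x) = of_real r * ev f x"
  by (simp_all add: X.scaleR_sc D.scaleR_sc ev_scale ev_scale_right)

lemma tendsto_ev:
  assumes "(f \<longlongrightarrow> f0) F" "(x \<longlongrightarrow> x0) F"
  shows "((\<lambda>t. ev (f t) (x t)) \<longlongrightarrow> ev f0 x0) F"
proof -
  have "bounded_bilinear ev"
    by (rule bounded_bilinear.intro)
      (auto simp: ev_add ev_add_right ev_scaleR scaleR_conv_of_real ev_norm intro!: exI[of _ 1])
  then show ?thesis using assms by (rule bounded_bilinear.tendsto)
qed

lemma functional_separating:
  assumes "X.subspace M" "closed M" "x \<notin> M"
  obtains f where "\<And>m. m \<in> M \<Longrightarrow> ev f m = 0" "ev f x \<noteq> 0"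
proof -
  obtain \<gamma> where g: "X.contraction \<gamma>" "\<And>m. m \<in> M \<Longrightarrow> \<gamma> m = 0" "\<gamma> x = of_real (infdist x M)"
    using X.separate[OF assms(1)] by blast
  then obtain f where f: "ev f = \<gamma>" using ev_full[of \<gamma> 1] by (auto simp: X.contraction_def)
  have "infdist x M > 0" using infdist_pos_not_in_closed[OF assms(2) _ assms(3)] X.subspace_0[OF assms(1)] by blast
  then have "ev f x \<noteq> 0" using g(3) f by simp
  then show thesis using that g(2) f by blast
qed

lemma functional_norming:
  obtains f where "norm f \<le> 1" "ev f x = of_real (norm x)"
proof -
  obtain \<gamma> where g: "X.contraction \<gamma>" "\<gamma> x = of_real (infdist x {0})"
    using X.separate[OF X.subspace_single_0] by blast
  then obtain f where "norm f \<le> 1" "ev f = \<gamma>" using ev_full[of \<gamma> 1] by (auto simp: X.contraction_def)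
  then show thesis using that[of f] g(2) by simp
qed

lemma ev_zero_imp_zero: "(\<And>f. ev f x = 0) \<Longrightarrow> x = 0"
  using functional_norming[of x] by (metis norm_eq_zero of_real_eq_0_iff)

subsection \<open>Annihilators of halfspaces\<close>

text \<open>
  Common kernels of finitely many functionals have finite codimension, also relative to a
  subspace \<open>V\<close>. For an annihilator of finite dimension this is applied with \<open>V\<close> the whole space, and
  for one of finite codimension with \<open>V\<close> the halfspace itself.
\<close>
lemma finitely_many_kernels:
  assumes V: "X.subspace V" and "finite B"
  obtains C where "finite C" "C \<subseteq> V" "\<And>v. v \<in> V \<Longrightarrow> \<exists>w\<in>X.span C. \<forall>b\<in>B. ev b (v - w) = 0"
proof -
  have "\<exists>C. finite C \<and> C \<subseteq> V \<and> (\<forall>v\<in>V. \<exists>w\<in>X.span C. \<forall>b\<in>B. ev b (v - w) = 0)"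
    using \<open>finite B\<close>
  proof induction
    case empty
    then show ?case by (intro exI[of _ "{}"]) auto
  next
    case (insert b B)
    then obtain C where C: "finite C" "C \<subseteq> V" "\<And>v. v \<in> V \<Longrightarrow> \<exists>w\<in>X.span C. \<forall>b\<in>B. ev b (v - w) = 0" by blast
    have spV: "w \<in> V" if "w \<in> X.span C" for w using that X.span_minimal[OF C(2) V] by blast
    show ?case
    proof (cases "\<forall>v\<in>V. (\<forall>b'\<in>B. ev b' v = 0) \<longrightarrow> ev b v = 0")
      case True
      have "\<exists>w\<in>X.span C. \<forall>b'\<in>insert b B. ev b' (v - w) = 0" if v: "v \<in> V" for v
      proof -
        obtain w where w: "w \<in> X.span C" "\<forall>b\<in>B. ev b (v - w) = 0" using C(3)[OF v] by blast
        moreover have "v - w \<in> V" using v spV[OF w(1)] by (rule X.subspace_diff[OF V])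
        ultimately show ?thesis using True by (intro bexI[of _ w]) auto
      qed
      then show ?thesis using C by blast
    next
      case False
      then obtain u where u: "u \<in> V" "\<forall>b'\<in>B. ev b' u = 0" "ev b u \<noteq> 0" by blast
      have "\<exists>w\<in>X.span (insert u C). \<forall>b'\<in>insert b B. ev b' (v - w) = 0" if v: "v \<in> V" for v
      proof -
        obtain w where w: "w \<in> X.span C" "\<forall>b\<in>B. ev b (v - w) = 0" using C(3)[OF v] by blast
        define w' where "w' = w + scX (ev b (v - w) / ev b u) u"
        have "w' \<in> X.span (insert u C)" unfolding w'_def
          using w(1) X.span_mono[of C "insert u C"]
          by (intro X.span_add X.span_scale) (auto intro: X.span_base)
        moreover have "ev b' (v - w') = ev b' (v - w) - (ev b (v - w) / ev b u) * ev b' u" for b'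
          by (simp add: w'_def ev_right_simps ev_add_right ev_scale_right)
        ultimately show ?thesis using w u by (intro bexI[of _ w']) auto
      qed
      then show ?thesis using C u(1) by (intro exI[of _ "insert u C"]) auto
    qed
  qed
  then show thesis using that by blast
qed

text \<open>
  Passing to annihilators exchanges dimension and codimension. A functional that annihilates \<open>Y\<close> and
  also \<open>e\<close> is mapped into the annihilator of \<open>Y\<close>. These functionals have codimension at most one
  in the annihilator, so the image of a single further functional spans the error.
\<close>
lemma AIH_annihilator:
  assumes "X.has_AIH T" shows "D.has_AIH A"
proof -
  obtain Y e where Y: "X.subspace Y" "closed Y" "\<not> finite_dim scX Y" "\<not> finite_codim scX Y"
    and TY: "\<And>y. y \<in> Y \<Longrightarrow> \<exists>t. T y - scX t e \<in> Y"
    using assms by (auto simp: X.has_AIH_def halfspace_def)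
  define P where "P = {f. \<forall>y\<in>Y. ev f y = 0}"
  have sP: "D.subspace P"
    by (rule D.subspaceI) (auto simp: P_def ev_left_simps ev_add ev_scale)
  have cP: "closed P" unfolding closed_sequential_limits
  proof (intro allI impI, elim conjE)
    fix s f assume s: "\<forall>n. s n \<in> P" "s \<longlonglongrightarrow> f"
    have "ev f y = 0" if "y \<in> Y" for y
      using tendsto_ev[OF s(2) tendsto_const[of y]] s(1) that by (simp add: P_def LIMSEQ_const_iff)
    then show "f \<in> P" by (simp add: P_def)
  qed
  have dP: "\<not> finite_dim scD P"
  proof
    assume "finite_dim scD P"
    then obtain B where B: "finite B" "D.span B = P" by (auto simp: finite_dim_def)
    obtain C where C: "finite C" "\<And>v. \<exists>w\<in>X.span C. \<forall>b\<in>B. ev b (v - w) = 0"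
      using finitely_many_kernels[OF X.subspace_UNIV B(1)] by (metis UNIV_I)
    have "v - w \<in> Y" if w: "\<forall>b\<in>B. ev b (v - w) = 0" for v w
    proof (rule ccontr)
      assume "v - w \<notin> Y"
      then obtain f where f: "\<And>m. m \<in> Y \<Longrightarrow> ev f m = 0" "ev f (v - w) \<noteq> 0"
        using functional_separating[OF Y(1,2)] by blast
      have "D.span B \<subseteq> {f. ev f (v - w) = 0}"
        using w by (intro D.span_minimal D.subspaceI) (auto simp: ev_left_simps ev_add ev_scale)
      then show False using f B(2) by (auto simp: P_def)
    qed
    then have "finite_codim scX Y" using C unfolding finite_codim_def by meson
    then show False using Y(4) by blast
  qed
  have codP: "\<not> finite_codim scD P"
  proof
    assume "finite_codim scD P"
    then obtain B where B: "finite B" "\<And>f. \<exists>g\<in>D.span B. f - g \<in> P" by (auto simp: finite_codim_def)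
    obtain C where C: "finite C" "C \<subseteq> Y" "\<And>v. v \<in> Y \<Longrightarrow> \<exists>w\<in>X.span C. \<forall>b\<in>B. ev b (v - w) = 0"
      using finitely_many_kernels[OF Y(1) B(1)] by metis
    have CY: "X.span C \<subseteq> Y" by (rule X.span_minimal[OF C(2) Y(1)])
    have "v \<in> X.span C" if v: "v \<in> Y" for v
    proof -
      obtain w where w: "w \<in> X.span C" "\<forall>b\<in>B. ev b (v - w) = 0" using C(3)[OF v] by blast
      have vw: "v - w \<in> Y" using v w(1) CY by (intro X.subspace_diff[OF Y(1)]) auto
      have "v - w = 0"
      proof (rule ev_zero_imp_zero)
        fix f
        obtain g where g: "g \<in> D.span B" "f - g \<in> P" using B(2) by blast
        have "D.span B \<subseteq> {f. ev f (v - w) = 0}"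
          using w by (intro D.span_minimal D.subspaceI) (auto simp: ev_left_simps ev_add ev_scale)
        then have "ev g (v - w) = 0" using g(1) by blast
        moreover have "ev (f - g) (v - w) = 0" using g(2) vw by (simp add: P_def)
        ultimately show "ev f (v - w) = 0" by (simp add: ev_left_simps)
      qed
      then show ?thesis using w(1) by simp
    qed
    then have "finite_dim scX Y" using C(1) CY unfolding finite_dim_def by blast
    then show False using Y(3) by blast
  qed
  have AP: "A f \<in> P" if "f \<in> P" "ev f e = 0" for f
  proof -
    have "ev (A f) y = 0" if y: "y \<in> Y" for y
    proof -
      obtain t where "T y - scX t e \<in> Y" using TY[OF y] by blast
      then have "ev f (T y - scX t e) = 0" using \<open>f \<in> P\<close> by (simp add: P_def)
      then show ?thesis using \<open>ev f e = 0\<close> by (simp add: ev_A ev_right_simps ev_scale_right)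
    qed
    then show ?thesis by (simp add: P_def)
  qed
  have "\<exists>h. \<forall>f\<in>P. \<exists>t. A f - scD t h \<in> P"
  proof (cases "\<forall>f\<in>P. ev f e = 0")
    case True
    then show ?thesis using AP by (intro exI[of _ 0]) auto
  next
    case False
    then obtain f0 where f0: "f0 \<in> P" "ev f0 e \<noteq> 0" by blast
    show ?thesis
    proof (intro exI[of _ "A f0"] ballI)
      fix f assume f: "f \<in> P"
      let ?t = "ev f e / ev f0 e"
      have "A (f - scD ?t f0) \<in> P"
        using f f0 by (intro AP D.subspace_diff[OF sP] D.subspace_scale[OF sP]) (auto simp: ev_left_simps ev_scale)
      then show "\<exists>t. A f - scD t (A f0) \<in> P"
        by (intro exI[of _ ?t]) (simp add: D.op_diff[OF A] D.op_scale[OF A])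
    qed
  qed
  then show ?thesis unfolding D.has_AIH_def halfspace_def using sP cP dP codP by blast
qed

subsection \<open>Uniform boundedness\<close>

text \<open>
  By Baire's theorem one of the sets \<open>E n\<close> contains a ball; then all of \<open>W\<close> is bounded on a ball of
  functionals, and functionals that attain the norm turn this into a bound for \<open>W\<close>.
\<close>
lemma uniform_boundedness:
  assumes "\<And>f. \<exists>C. \<forall>w\<in>W. norm (ev f w) \<le> C"
  obtains C where "\<And>w. w \<in> W \<Longrightarrow> norm w \<le> C"
proof -
  define E where "E n = {f. \<forall>w\<in>W. norm (ev f w) \<le> real n}" for n
  have clE: "closed (E n)" for n unfolding closed_sequential_limits
  proof (intro allI impI, elim conjE)
    fix s f assume s: "\<forall>i. s i \<in> E n" "s \<longlonglongrightarrow> f"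
    have "norm (ev f w) \<le> real n" if "w \<in> W" for w
      using tendsto_norm[OF tendsto_ev[OF s(2) tendsto_const[of w]]] s(1) that
      by (intro LIMSEQ_le_const2[of "\<lambda>i. norm (ev (s i) w)"]) (auto simp: E_def)
    then show "f \<in> E n" by (simp add: E_def)
  qed
  have "f \<in> \<Union>(range E)" for f
  proof -
    obtain C where "\<forall>w\<in>W. norm (ev f w) \<le> C" using assms by blast
    moreover obtain n where "C \<le> real n" using real_arch_simple by blast
    ultimately have "f \<in> E n" by (force simp: E_def)
    then show ?thesis by blast
  qed
  then have un: "\<Union>(range E) = UNIV" by blast
  have "\<exists>n. interior (E n) \<noteq> {}"
  proof (rule ccontr)
    assume "\<not> ?thesis"
    then have "Met_TC.mtopology interior_of \<Union>(range E) = ({} :: 'd set)"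
      by (intro Met_TC.metric_Baire_category_alt) (use clE in \<open>auto simp: complete_UNIV mcomplete_iff_complete\<close>)
    then show False by (simp add: un)
  qed
  then obtain n f0 r where r: "r > 0" "cball f0 r \<subseteq> E n"
    by (metis all_not_in_conv mem_interior_cball)
  show thesis
  proof (rule that)
    fix w assume w: "w \<in> W"
    obtain h where h: "norm h \<le> 1" "ev h w = of_real (norm w)" using functional_norming by blast
    have "f0 \<in> E n" "f0 + r *\<^sub>R h \<in> E n"
      using r h(1) by (auto intro!: subsetD[OF r(2)] simp: dist_norm mult_left_le)
    then have "norm (ev f0 w) \<le> real n" "norm (ev (f0 + r *\<^sub>R h) w) \<le> real n" using w by (auto simp: E_def)
    moreover have "of_real (r * norm w) = ev (f0 + r *\<^sub>R h) w - ev f0 w"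
      by (simp add: ev_add ev_scaleR h(2))
    ultimately have "norm (of_real (r * norm w) :: 'k) \<le> real n + real n"
      using norm_triangle_ineq4[of "ev (f0 + r *\<^sub>R h) w" "ev f0 w"] by simp
    then have "r * norm w \<le> 2 * real n" using r(1) by (simp add: norm_mult)
    then show "norm w \<le> 2 * real n / r" using r(1) by (simp add: field_simps)
  qed
qed

section \<open>Boundary points of the real spectrum\<close>

definition shift :: "real \<Rightarrow> 'x \<Rightarrow> 'x" where "shift a x = T x - a *\<^sub>R x"

text \<open>
  The kernel of the \<open>m\<close>-th power of \<open>A - a\<close>, described by the action of functionals on \<open>'x\<close>.
\<close>
definition gen_kernel :: "real \<Rightarrow> nat \<Rightarrow> 'd set" where
  "gen_kernel a m = {f. \<forall>x. ev f ((shift a ^^ m) x) = 0}"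

text \<open>
  By Hahn--Banach this is the closure of the range of the \<open>m\<close>-th power of \<open>T - a\<close>. In the form of an
  annihilator it is evidently closed, and the kernels control when it decreases.
\<close>
definition range_hull :: "real \<Rightarrow> nat \<Rightarrow> 'x set" where
  "range_hull a m = {x. \<forall>f\<in>gen_kernel a m. ev f x = 0}"

lemma op_shift: "X.bounded_op (shift a)"
  using X.op_shift[OF T, of a] by (simp add: shift_def[abs_def])

lemma op_shift_pow: "X.bounded_op (shift a ^^ m)"
proof (induction m)
  case 0
  then show ?case by (simp add: X.bounded_op_def)
next
  case (Suc m)
  then show ?case using op_shift[of a] unfolding X.bounded_op_def
    by (auto simp: o_def intro: bounded_linear_compose[of "shift a" "shift a ^^ m", unfolded o_def])
qed

lemma shift_T: "shift a (T x) = T (shift a x)"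
  by (simp add: shift_def X.op_diff[OF T] X.op_scaleR[OF T])

lemma shift_pow_T: "(shift a ^^ m) (T x) = T ((shift a ^^ m) x)"
  by (induction m) (simp_all add: shift_T)

lemma subspace_gen_kernel: "D.subspace (gen_kernel a m)"
  by (rule D.subspaceI) (auto simp: gen_kernel_def ev_left_simps ev_add ev_scale)

lemma closed_gen_kernel: "closed (gen_kernel a m)"
  unfolding closed_sequential_limits
proof (intro allI impI, elim conjE)
  fix s f assume s: "\<forall>i. s i \<in> gen_kernel a m" "s \<longlonglongrightarrow> f"
  have "ev f y = 0" if "y \<in> range (shift a ^^ m)" for y
    using tendsto_ev[OF s(2) tendsto_const[of y]] s(1) that by (auto simp: gen_kernel_def LIMSEQ_const_iff)
  then show "f \<in> gen_kernel a m" by (simp add: gen_kernel_def)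
qed

lemma A_gen_kernel: "f \<in> gen_kernel a m \<Longrightarrow> A f \<in> gen_kernel a m"
  by (simp add: gen_kernel_def ev_A flip: shift_pow_T)

lemma ev_shift: "ev (A f - a *\<^sub>R f) x = ev f (shift a x)"
  by (simp add: shift_def ev_left_simps ev_right_simps ev_A ev_scaleR)

lemma gen_kernel_Suc_iff: "f \<in> gen_kernel a (Suc m) \<longleftrightarrow> A f - a *\<^sub>R f \<in> gen_kernel a m"
  by (simp add: gen_kernel_def ev_shift)

lemma gen_kernel_mono: "gen_kernel a m \<subseteq> gen_kernel a (Suc m)"
  by (auto simp: gen_kernel_def funpow_swap1 simp del: funpow.simps(2) simp add: funpow_Suc_right)

lemma subspace_range_hull: "X.subspace (range_hull a m)"
  by (rule X.subspaceI) (auto simp: range_hull_def ev_right_simps ev_add_right ev_scale_right)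

lemma closed_range_hull: "closed (range_hull a m)"
  unfolding closed_sequential_limits
proof (intro allI impI, elim conjE)
  fix s x assume s: "\<forall>i. s i \<in> range_hull a m" "s \<longlonglongrightarrow> x"
  have "ev f x = 0" if "f \<in> gen_kernel a m" for f
    using tendsto_ev[OF tendsto_const[of f] s(2)] s(1) that by (simp add: range_hull_def LIMSEQ_const_iff)
  then show "x \<in> range_hull a m" by (simp add: range_hull_def)
qed

lemma range_hull_antimono: "range_hull a (Suc m) \<subseteq> range_hull a m"
  using gen_kernel_mono by (auto simp: range_hull_def)

lemma shift_range_hull: "x \<in> range_hull a m \<Longrightarrow> shift a x \<in> range_hull a (Suc m)"
  by (simp add: range_hull_def gen_kernel_Suc_iff flip: ev_shift)

lemma T_range_hull: assumes "x \<in> range_hull a m" shows "T x \<in> range_hull a m"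
proof -
  have "shift a x + a *\<^sub>R x \<in> range_hull a m"
    using shift_range_hull[OF assms] range_hull_antimono assms
    by (intro X.subspace_add[OF subspace_range_hull] X.subspace_scaleR[OF subspace_range_hull]) auto
  then show ?thesis by (simp add: shift_def)
qed

lemma range_in_range_hull: "(shift a ^^ m) x \<in> range_hull a m"
  by (simp add: range_hull_def gen_kernel_def)

lemma adjoint_exists:
  assumes "X.bounded_op R" obtains g where "\<And>x. ev g x = ev f (R x)"
proof -
  obtain K where K: "K > 0" "\<And>v. norm (R v) \<le> K * norm v" using X.op_bound[OF assms] by blast
  have "\<exists>g. norm g \<le> norm f * K \<and> ev g = (\<lambda>x. ev f (R x))"
  proof (rule ev_full)
    show "module_hom scX (*) (\<lambda>x. ev f (R x))"
      by (intro module_hom.intro X.module_axioms module_mult module_hom_axioms.intro)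
        (simp_all add: X.op_add[OF assms] X.op_scale[OF assms] ev_add_right ev_scale_right)
    show "norm (ev f (R x)) \<le> norm f * K * norm x" for x
      using ev_norm[of f "R x"] mult_left_mono[OF K(2)[of x], of "norm f"] by (simp add: mult.assoc)
  qed (use K in simp)
  then show thesis using that by metis
qed

lemma is_resolvent_commute:
  assumes "X.is_resolvent T l R" shows "R (shift a x) = shift a (R x)"
proof -
  have R: "X.bounded_op R" "\<And>x. l *\<^sub>R R x - T (R x) = x" "\<And>x. R (l *\<^sub>R x - T x) = x" using assms by (auto simp: X.is_resolvent_def)
  have "R (T x) = l *\<^sub>R R x - x"
    using R(3)[of x] by (simp add: X.op_diff[OF R(1)] X.op_scaleR[OF R(1)] algebra_simps)
  also have "\<dots> = T (R x)" using R(2)[of x] by (simp add: algebra_simps)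
  finally show ?thesis by (simp add: shift_def X.op_diff[OF R(1)] X.op_scaleR[OF R(1)])
qed

lemma is_resolvent_commute_pow: "X.is_resolvent T l R \<Longrightarrow> R ((shift a ^^ m) x) = (shift a ^^ m) (R x)"
  by (induction m) (simp_all add: is_resolvent_commute)

text \<open>
  A resolvent commutes with \<open>T\<close>, so composition with it preserves the generalised kernels.
\<close>
lemma is_resolvent_range_hull:
  assumes R: "X.is_resolvent T l R" and x: "x \<in> range_hull a m"
  shows "R x \<in> range_hull a m"
proof -
  have "ev f (R x) = 0" if f: "f \<in> gen_kernel a m" for f
  proof -
    have "X.bounded_op R" using R by (simp add: X.is_resolvent_def)
    then obtain g where g: "\<And>x. ev g x = ev f (R x)" using adjoint_exists by blast
    have "g \<in> gen_kernel a m" using f by (simp add: gen_kernel_def g is_resolvent_commute_pow[OF R])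
    then show ?thesis using x by (simp add: range_hull_def g[symmetric])
  qed
  then show ?thesis by (simp add: range_hull_def)
qed

text \<open>
  The intersection \<open>W\<close> of all range hulls has infinite codimension, so it is either a halfspace or
  finite-dimensional. In the second case the limit from \<open>AIH_or_limit_of_orbit\<close> would lie
  in the preimage of \<open>W\<close>. This has finite dimension, so a range hull far enough down the chain
  meets it only inside \<open>W\<close>, and the orbit is started there.
\<close>
lemma AIH_of_strict_chain:
  assumes strict: "\<And>m. gen_kernel a m \<noteq> gen_kernel a (Suc m)"
    and lim: "l \<longlonglongrightarrow> a" and R: "\<And>n. X.is_resolvent T (l n) (R n)"
  shows "X.has_AIH T"
proof (rule ccontr)
  assume no: "\<not> X.has_AIH T"
  let ?Z = "range_hull a"
  have "\<exists>x. (shift a ^^ m) x \<notin> ?Z (Suc m)" for m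
  proof -
    obtain f where f: "f \<in> gen_kernel a (Suc m)" "f \<notin> gen_kernel a m" using strict[of m] gen_kernel_mono by blast
    then obtain x where "ev f ((shift a ^^ m) x) \<noteq> 0" by (auto simp: gen_kernel_def)
    then show ?thesis using f(1) by (auto simp: range_hull_def intro!: exI[of _ x])
  qed
  then obtain x where x: "\<And>m. (shift a ^^ m) (x m) \<notin> ?Z (Suc m)" by metis
  define W where "W = (\<Inter>m. ?Z m)"
  have W: "X.subspace W" "closed W"
    unfolding W_def using subspace_range_hull closed_range_hull by (auto intro!: X.subspace_Inter)
  have TW: "T y \<in> W" if "y \<in> W" for y using that T_range_hull by (auto simp: W_def)
  have anti: "?Z j \<subseteq> ?Z i" if "i \<le> j" for i j
    by (rule lift_Suc_antimono_le[of ?Z, OF range_hull_antimono that])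
  have "\<not> finite_codim scX W"
  proof (rule X.not_finite_codimI[OF W(1), where u = "\<lambda>m. (shift a ^^ m) (x m)"])
    fix n c assume "(\<Sum>j<n. scX (c j) ((shift a ^^ j) (x j))) \<in> W"
    then show "\<forall>j<n. c j = 0"
      by (intro X.strict_chain_independent[where Z = ?Z and u = "\<lambda>m. (shift a ^^ m) (x m)"])
        (auto simp: W_def x intro: subspace_range_hull range_in_range_hull dest: subsetD[OF range_hull_antimono])
  qed
  moreover have "\<forall>y\<in>W. \<exists>t. T y - scX t 0 \<in> W" using TW by simp
  ultimately have finW: "finite_dim scX W"
    using no W unfolding X.has_AIH_def halfspace_def by blast
  have "finite_dim scX {x. shift a x = 0}"
    using X.AIH_of_infinite_dim_eigenspace[OF T, of a] no by (auto simp: shift_def)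
  then have finE: "finite_dim scX {x. shift a x \<in> W}"
    by (rule X.finite_dim_vimage[OF op_shift _ finW])
  have "\<exists>m. {x. shift a x \<in> W} \<inter> ?Z m \<subseteq> W"
  proof (rule ccontr)
    assume contra: "\<not> ?thesis"
    have "\<exists>m'>m. \<exists>y. shift a y \<in> W \<and> y \<in> ?Z m \<and> y \<notin> ?Z m'" for m
    proof -
      obtain y where y: "shift a y \<in> W" "y \<in> ?Z m" "y \<notin> W" using contra by blast
      then obtain m' where m': "y \<notin> ?Z m'" by (auto simp: W_def)
      have "m < m'"
      proof (rule ccontr)
        assume "\<not> m < m'"
        then have "?Z m \<subseteq> ?Z m'" by (intro anti) simp
        then show False using y(2) m' by blast
      qed
      then show ?thesis using y m' by blast
    qed
    then obtain h y where hy: "\<And>m. m < h m" "\<And>m. shift a (y m) \<in> W" "\<And>m. y m \<in> ?Z m" "\<And>m. y m \<notin> ?Z (h m)" by metis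
    define s where "s n = (h ^^ n) 0" for n
    have s: "s (Suc n) = h (s n)" for n by (simp add: s_def)
    have "\<not> finite_dim scX {x. shift a x \<in> W}"
    proof (rule X.not_finite_dimI[where u = "\<lambda>n. y (s n)"])
      fix n c assume "(\<Sum>j<n. scX (c j) (y (s j))) = 0"
      then show "\<forall>j<n. c j = 0"
        by (intro X.strict_chain_independent[where Z = "\<lambda>n. ?Z (s n)" and u = "\<lambda>n. y (s n)"])
          (auto simp: s hy X.subspace_0[OF subspace_range_hull] intro: subspace_range_hull dest: subsetD[OF anti[OF less_imp_le[OF hy(1)]]])
    qed (use hy in auto)
    then show False using finE by blast
  qed
  then obtain m where m: "{x. shift a x \<in> W} \<inter> ?Z m \<subseteq> W" by blast
  \<comment> \<open>The orbit stays in the \<open>m\<close>-th range hull, but \<open>e\<close> is not in the next one; that makes the orbit unbounded modulo \<open>W\<close>.\<close>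
  define e where "e = (shift a ^^ m) (x m)"
  define r where "r n = R n e" for n
  have rZ: "r n \<in> ?Z m" for n unfolding r_def e_def by (intro is_resolvent_range_hull[OF R] range_in_range_hull)
  have Tr: "T (r n) = l n *\<^sub>R r n - e" for n using R[of n] by (simp add: X.is_resolvent_def r_def algebra_simps)
  obtain f where f: "f \<in> gen_kernel a (Suc m)" "ev f e \<noteq> 0" using x[of m] by (auto simp: range_hull_def e_def)
  have unb: "\<exists>n. C < infdist (r n) W" for C
  proof (rule ccontr)
    assume "\<not> ?thesis"
    then have le: "infdist (r n) W < C + 1" for n by (force simp: not_less intro: le_less_trans)
    have "norm (ev f e) \<le> \<bar>l n - a\<bar> * (norm f * (C + 1))" for n
    proof -
      obtain w where w: "w \<in> W" "norm (r n - w) < C + 1" using X.infdist_subspace_bound[OF W(1) le[of n]] by blast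
      have "ev f (shift a (r n)) = 0" using shift_range_hull[OF rZ[of n]] f(1) by (simp add: range_hull_def)
      then have "ev f e = of_real (l n - a) * ev f (r n)"
        by (simp add: shift_def Tr ev_right_simps ev_scaleR left_diff_distrib) (simp add: algebra_simps)
      also have "ev f (r n) = ev f (r n - w)" using w(1) f(1) by (simp add: ev_right_simps W_def range_hull_def)
      finally have "norm (ev f e) = \<bar>l n - a\<bar> * norm (ev f (r n - w))" by (simp add: norm_mult flip: of_real_diff)
      moreover have "norm (ev f (r n - w)) \<le> norm f * (C + 1)"
        using ev_norm[of f "r n - w"] mult_left_mono[OF less_imp_le[OF w(2)], of "norm f"] by simp
      ultimately show ?thesis by (simp add: mult_left_mono)
    qed
    moreover have "(\<lambda>n. \<bar>l n - a\<bar> * (norm f * (C + 1))) \<longlonglongrightarrow> \<bar>a - a\<bar> * (norm f * (C + 1))"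
      by (intro tendsto_intros lim)
    ultimately have "norm (ev f e) \<le> \<bar>a - a\<bar> * (norm f * (C + 1))" by (intro LIMSEQ_le_const) auto
    then show False using f(2) by simp
  qed
  show False
  proof (rule X.AIH_or_limit_of_orbit[OF T W TW lim Tr unb])
    fix y assume y: "y \<notin> W" "T y - a *\<^sub>R y \<in> W"
      "\<And>M. X.subspace M \<Longrightarrow> closed M \<Longrightarrow> W \<subseteq> M \<Longrightarrow> (\<And>n. r n \<in> M) \<Longrightarrow> y \<in> M"
    have "y \<in> ?Z m" by (rule y(3)[OF subspace_range_hull closed_range_hull]) (auto simp: W_def rZ)
    then show False using m y(1,2) by (auto simp: shift_def)
  qed (use no in auto)
qed

text \<open>
  The orbits of a functional under the adjoint resolvents are bounded modulo the stable kernel, for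
  otherwise a limit \<open>y\<close> would lie in the next kernel but not in this one. Functionals modulo the kernel
  are just functionals on the range hull, so the resolvents are weakly bounded there, and
  uniform boundedness applies.
\<close>
lemma resolvents_bounded_on_range_hull:
  assumes stable: "gen_kernel a k = gen_kernel a (Suc k)" and no: "\<not> D.has_AIH A"
    and lim: "l \<longlonglongrightarrow> a" and R: "\<And>n. X.is_resolvent T (l n) (R n)"
  obtains C where "C > 0" "\<And>n z. z \<in> range_hull a k \<Longrightarrow> norm (R n z) \<le> C * norm z"
proof -
  let ?G = "gen_kernel a k"
  have opR: "X.bounded_op (R n)" for n using R[of n] by (simp add: X.is_resolvent_def)
  define W where "W = {R n z |n z. z \<in> range_hull a k \<and> norm z \<le> 1}"
  have "\<exists>C. \<forall>w\<in>W. norm (ev f w) \<le> C" for f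
  proof -
    have "\<exists>g. \<forall>x. ev g x = ev f (R n x)" for n using adjoint_exists[OF opR] by metis
    then obtain g where g: "\<And>n x. ev (g n) x = ev f (R n x)" by metis
    have Ag: "A (g n) = l n *\<^sub>R g n - f" for n
    proof (rule ev_eqI)
      fix x
      have "R n (T x) = l n *\<^sub>R R n x - x"
      proof -
        have "R n (l n *\<^sub>R x - T x) = x" using R[of n] by (simp add: X.is_resolvent_def)
        then have "l n *\<^sub>R R n x - R n (T x) = x" by (simp add: X.op_diff[OF opR] X.op_scaleR[OF opR])
        then show ?thesis by (simp add: algebra_simps)
      qed
      then show "ev (A (g n)) x = ev (l n *\<^sub>R g n - f) x"
        by (simp add: ev_A g ev_left_simps ev_right_simps ev_scaleR)
    qed
    have "\<exists>C. \<forall>n. infdist (g n) ?G \<le> C"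
    proof (rule ccontr)
      assume "\<not> ?thesis"
      then have unb: "\<And>C. \<exists>n. C < infdist (g n) ?G" by (auto simp: not_le)
      show False
      proof (rule D.AIH_or_limit_of_orbit[OF A subspace_gen_kernel closed_gen_kernel A_gen_kernel lim Ag unb])
        fix y assume "y \<notin> ?G" "A y - a *\<^sub>R y \<in> ?G"
        then show False using gen_kernel_Suc_iff[of y a k] stable by blast
      qed (use no in auto)
    qed
    then obtain C where C: "\<And>n. infdist (g n) ?G \<le> C" by blast
    have "norm (ev f (R n z)) \<le> C + 1" if z: "z \<in> range_hull a k" "norm z \<le> 1" for n z
    proof -
      have "infdist (g n) ?G < C + 1" using C[of n] by simp
      from D.infdist_subspace_bound[OF subspace_gen_kernel this] obtain h where h: "h \<in> ?G" "norm (g n - h) < C + 1" .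
      have "ev f (R n z) = ev (g n - h) z" using z(1) h(1) by (simp add: ev_left_simps g range_hull_def)
      then have "norm (ev f (R n z)) \<le> norm (g n - h) * norm z" by (simp add: ev_norm)
      also have "\<dots> \<le> (C + 1) * 1" using z(2) h(2) by (intro mult_mono) (auto intro: order_trans[OF norm_ge_zero less_imp_le])
      finally show ?thesis by simp
    qed
    then show ?thesis by (intro exI[of _ "C + 1"]) (auto simp: W_def)
  qed
  then obtain C where C: "\<And>w. w \<in> W \<Longrightarrow> norm w \<le> C" using uniform_boundedness by blast
  have "norm (R n z) \<le> (\<bar>C\<bar> + 1) * norm z" if z: "z \<in> range_hull a k" for n z
  proof (cases "z = 0")
    case True
    then show ?thesis by (simp add: X.op_zero[OF opR])
  next
    case False
    have "R n (inverse (norm z) *\<^sub>R z) \<in> W" unfolding W_def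
      using z False X.subspace_scaleR[OF subspace_range_hull]
      by (intro CollectI exI[of _ n] exI[of _ "inverse (norm z) *\<^sub>R z"]) auto
    from C[OF this] have "inverse (norm z) * norm (R n z) \<le> C" by (simp add: X.op_scaleR[OF opR])
    then have "norm (R n z) \<le> C * norm z" using False by (simp add: field_simps)
    also have "\<dots> \<le> (\<bar>C\<bar> + 1) * norm z" by (intro mult_right_mono) auto
    finally show ?thesis .
  qed
  then show thesis by (intro that[of "\<bar>C\<bar> + 1"]) auto
qed

end

section \<open>Isolated points\<close>

context banach_over
begin

lemma is_resolventI:
  assumes T: "bounded_op T" and ex: "\<And>y. \<exists>w. l *\<^sub>R w - T w = y \<and> norm w \<le> B * norm y"
    and inj: "\<And>x. l *\<^sub>R x = T x \<Longrightarrow> x = 0"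
  shows "\<exists>R. is_resolvent T l R"
proof -
  have "\<forall>y. \<exists>w. l *\<^sub>R w - T w = y \<and> norm w \<le> B * norm y" using ex by blast
  from choice[OF this] obtain R where "\<forall>y. l *\<^sub>R R y - T (R y) = y \<and> norm (R y) \<le> B * norm y" ..
  then have R: "l *\<^sub>R R y - T (R y) = y" "norm (R y) \<le> B * norm y" for y by simp_all
  have uniq: "x = y" if "l *\<^sub>R x - T x = l *\<^sub>R y - T y" for x y
  proof -
    have "l *\<^sub>R (x - y) = T (x - y)" using that by (simp add: op_diff[OF T] algebra_simps)
    then show ?thesis using inj[of "x - y"] by simp
  qed
  have "bounded_linear R"
  proof (rule bounded_linear_intro)
    show "R (x + y) = R x + R y" for x y
    proof (rule uniq)
      have "l *\<^sub>R (R x + R y) - T (R x + R y) = (l *\<^sub>R R x - T (R x)) + (l *\<^sub>R R y - T (R y))"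
        by (simp add: op_add[OF T] scaleR_add_right)
      then show "l *\<^sub>R R (x + y) - T (R (x + y)) = l *\<^sub>R (R x + R y) - T (R x + R y)" by (simp only: R(1))
    qed
    show "R (r *\<^sub>R x) = r *\<^sub>R R x" for r x
    proof (rule uniq)
      have "l *\<^sub>R (r *\<^sub>R R x) - T (r *\<^sub>R R x) = r *\<^sub>R (l *\<^sub>R R x - T (R x))" by (simp add: op_scaleR[OF T] algebra_simps)
      then show "l *\<^sub>R R (r *\<^sub>R x) - T (R (r *\<^sub>R x)) = l *\<^sub>R (r *\<^sub>R R x) - T (r *\<^sub>R R x)" by (simp add: R(1))
    qed
    show "norm (R x) \<le> norm x * B" for x using R(2)[of x] by (simp add: mult.commute)
  qed
  moreover have "R (c *\<^sub>K x) = c *\<^sub>K R x" for c x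
  proof (rule uniq)
    have "l *\<^sub>R (c *\<^sub>K R x) - T (c *\<^sub>K R x) = c *\<^sub>K (l *\<^sub>R R x - T (R x))"
      by (simp add: op_scale[OF T] scale_right_diff_distrib scaleR_sc mult.commute)
    then show "l *\<^sub>R R (c *\<^sub>K x) - T (R (c *\<^sub>K x)) = l *\<^sub>R (c *\<^sub>K R x) - T (c *\<^sub>K R x)" by (simp add: R(1))
  qed
  moreover have "R (l *\<^sub>R x - T x) = x" for x by (rule uniq) (rule R(1))
  ultimately show ?thesis using R(1) by (auto simp: is_resolvent_def bounded_op_def)
qed

text \<open>
  The Neumann series in the form of a contraction: \<open>m w - T w = z\<close> means
  \<open>w = R z - (m - l) R w\<close>. Only the size of \<open>R\<close> on \<open>Z\<close> matters.
\<close>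
lemma solve_nearby:
  assumes T: "bounded_op T" and Z: "subspace Z" "closed Z" and RZ: "\<And>z. z \<in> Z \<Longrightarrow> R z \<in> Z" and R: "is_resolvent T l R"
    and C: "C > 0" "\<And>z. z \<in> Z \<Longrightarrow> norm (R z) \<le> C * norm z" and m: "\<bar>m - l\<bar> * C \<le> 1/2" and z: "z \<in> Z"
  shows "\<exists>w\<in>Z. m *\<^sub>R w - T w = z \<and> norm w \<le> 2 * C * norm z"
proof -
  have opR: "bounded_op R" and R1: "\<And>x. l *\<^sub>R R x - T (R x) = x" using R by (auto simp: is_resolvent_def)
  define h where "h w = R z - (m - l) *\<^sub>R R w" for w
  have small: "norm ((m - l) *\<^sub>R R w) \<le> 1/2 * norm w" if "w \<in> Z" for w
  proof -
    have "norm ((m - l) *\<^sub>R R w) \<le> \<bar>m - l\<bar> * (C * norm w)" using C(2)[OF that] by (simp add: mult_left_mono)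
    also have "\<dots> = (\<bar>m - l\<bar> * C) * norm w" by simp
    also have "\<dots> \<le> 1/2 * norm w" by (intro mult_right_mono m) simp
    finally show ?thesis .
  qed
  have "\<exists>!w\<in>Z. h w = w"
  proof (rule Banach_fix[where c = "1/2"])
    show "complete Z" using Z(2) by (simp add: complete_eq_closed)
    show "Z \<noteq> {}" using z by blast
    show "h ` Z \<subseteq> Z" unfolding h_def using z
      by (auto intro!: subspace_diff[OF Z(1)] subspace_scaleR[OF Z(1)] RZ)
    fix x y assume xy: "x \<in> Z" "y \<in> Z"
    have "h x - h y = - ((m - l) *\<^sub>R R (x - y))" by (simp add: h_def op_diff[OF opR] algebra_simps)
    then show "dist (h x) (h y) \<le> 1/2 * dist x y"
      using small[OF subspace_diff[OF Z(1) xy]] by (simp add: dist_norm)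
  qed auto
  then obtain w where w: "w \<in> Z" "R z - (m - l) *\<^sub>R R w = w" by (auto simp: h_def)
  have "m *\<^sub>R w - T w = (l *\<^sub>R w - T w) + (m - l) *\<^sub>R w" by (simp add: algebra_simps)
  also have "l *\<^sub>R w - T w = l *\<^sub>R (R z - (m - l) *\<^sub>R R w) - T (R z - (m - l) *\<^sub>R R w)" by (simp only: w(2))
  also have "\<dots> = (l *\<^sub>R R z - T (R z)) - (m - l) *\<^sub>R (l *\<^sub>R R w - T (R w))"
    by (simp add: op_diff[OF T] op_add[OF T] op_scaleR[OF T] algebra_simps)
  also have "\<dots> + (m - l) *\<^sub>R w = z" by (simp add: R1)
  finally have "m *\<^sub>R w - T w = z" .
  moreover have "norm w \<le> 2 * C * norm z"
  proof -
    have "norm w \<le> norm (R z) + norm ((m - l) *\<^sub>R R w)" using norm_triangle_ineq4[of "R z" "(m - l) *\<^sub>R R w"] w(2) by simp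
    then show ?thesis using C(2)[OF z] small[OF w(1)] by simp
  qed
  ultimately show ?thesis using w(1) by blast
qed

lemma is_resolvent_large:
  assumes T: "bounded_op T" obtains K where "\<And>l. K < \<bar>l\<bar> \<Longrightarrow> \<exists>R. is_resolvent T l R"
proof -
  obtain K where K: "K > 0" "\<And>v. norm (T v) \<le> K * norm v" using op_bound[OF T] by blast
  show thesis
  proof (rule that[of "2 * K"])
    fix l assume l: "2 * K < \<bar>l\<bar>"
    then have l0: "l \<noteq> 0" using K(1) by auto
    have half: "norm (inverse l *\<^sub>R T v) \<le> 1/2 * norm v" for v
    proof -
      have "norm (T v) \<le> \<bar>l\<bar> / 2 * norm v"
        using l by (intro order_trans[OF K(2)] mult_right_mono) auto
      then show ?thesis using l0 by (simp add: field_simps)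
    qed
    show "\<exists>R. is_resolvent T l R"
    proof (rule is_resolventI[OF T])
      fix y
      have "\<exists>!w. inverse l *\<^sub>R (y + T w) = w"
      proof (rule banach_fix_type[where c = "1/2"])
        show "\<forall>x x'. dist (inverse l *\<^sub>R (y + T x)) (inverse l *\<^sub>R (y + T x')) \<le> 1/2 * dist x x'"
        proof (intro allI)
          fix x x'
          have "inverse l *\<^sub>R (y + T x) - inverse l *\<^sub>R (y + T x') = inverse l *\<^sub>R T (x - x')"
            by (simp add: op_diff[OF T] algebra_simps)
          then show "dist (inverse l *\<^sub>R (y + T x)) (inverse l *\<^sub>R (y + T x')) \<le> 1/2 * dist x x'"
            using half[of "x - x'"] by (simp add: dist_norm)
        qed
      qed auto
      then obtain w where w: "inverse l *\<^sub>R (y + T w) = w" by blast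
      have "l *\<^sub>R w = y + T w" by (subst w[symmetric]) (simp add: l0)
      moreover have "norm w \<le> 2 / \<bar>l\<bar> * norm y"
      proof -
        have "norm w \<le> norm (inverse l *\<^sub>R y) + norm (inverse l *\<^sub>R T w)"
          using norm_triangle_ineq[of "inverse l *\<^sub>R y" "inverse l *\<^sub>R T w"] w by (simp add: scaleR_add_right)
        then have "norm w \<le> 2 * norm (inverse l *\<^sub>R y)" using half[of w] by linarith
        then show ?thesis by (simp add: divide_inverse)
      qed
      ultimately show "\<exists>w. l *\<^sub>R w - T w = y \<and> norm w \<le> 2 / \<bar>l\<bar> * norm y" by (intro exI[of _ w]) simp
    next
      fix x assume "l *\<^sub>R x = T x"
      then have "x = inverse l *\<^sub>R T x" using l0 by (metis left_inverse scaleR_one scaleR_scaleR)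
      then have "norm x \<le> 1/2 * norm x" using half[of x] by simp
      then show "x = 0" by simp
    qed
  qed
qed

end

text \<open>
  The set of limit points is nonempty, closed and bounded. A point of its frontier is a limit of
  points that are not limit points of \<open>S\<close>, and near each of these there are points outside \<open>S\<close>.
\<close>
lemma limit_point_and_resolvent_limit:
  fixes S :: "real set" assumes "infinite S" "bounded S"
  obtains a where "a islimpt S" "a \<in> closure (- S)"
proof -
  define L where "L = {x. x islimpt S}"
  have cL: "closed L" unfolding L_def by (rule closed_limpts)
  have "L \<noteq> {}" using bounded_infinite_imp_islimpt[of S S] assms by (auto simp: L_def)
  moreover have "L \<subseteq> closure S" by (auto simp: L_def closure_def)
  then have "bounded L" using assms(2) bounded_closure bounded_subset by blast
  then have "L \<noteq> UNIV" using not_bounded_UNIV[where 'a = real] by metis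
  ultimately obtain a where a: "a \<in> frontier L" using frontier_eq_empty by blast
  have "a \<in> L" using a cL frontier_subset_closed by blast
  moreover have "a \<in> closure (- S)" unfolding closure_approachable
  proof (intro allI impI)
    fix e :: real assume "e > 0"
    have "a \<in> closure (- L)" using a by (simp add: frontier_closures)
    then obtain c where c: "c \<notin> L" "dist c a < e" using \<open>e > 0\<close> by (auto simp: closure_approachable)
    show "\<exists>y\<in>- S. dist y a < e"
    proof (cases "c \<in> S")
      case True
      obtain d where d: "d > 0" "\<And>x. x \<in> S \<Longrightarrow> x \<noteq> c \<Longrightarrow> d \<le> dist x c"
        using c(1) by (auto simp: L_def islimpt_approachable not_less)
      define r where "r = min d (e - dist c a) / 2"
      have r: "r > 0" "r < d" "r < e - dist c a" using d(1) c(2) by (auto simp: r_def min_def)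
      have "c + r \<notin> S" using d(2)[of "c + r"] r by (auto simp: dist_real_def)
      moreover have "dist (c + r) a < e" using r by (simp add: dist_real_def)
      ultimately show ?thesis by blast
    qed (use c in blast)
  qed
  ultimately show thesis using that by (simp add: L_def)
qed

lemma (in banach_over) op_compose: "bounded_op S \<Longrightarrow> bounded_op T \<Longrightarrow> bounded_op (\<lambda>x. S (T x))"
  by (auto simp: bounded_op_def intro: bounded_linear_compose)

lemma (in banach_over) AIH_imp_almost_invariant:
  assumes "has_AIH T" shows "\<exists>Y. almost_invariant_halfspace (*\<^sub>K) T 1 Y"
proof -
  obtain Y e where Y: "halfspace (*\<^sub>K) Y" and T: "\<And>y. y \<in> Y \<Longrightarrow> \<exists>t. T y - t *\<^sub>K e \<in> Y"
    using assms by (auto simp: has_AIH_def)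
  have "dim (span {e}) \<le> 1" using dim_le_card[of "span {e}" "{e}"] by simp
  moreover have "finite_dim (*\<^sub>K) (span {e})" unfolding finite_dim_def by (intro exI[of _ "{e}"]) simp
  moreover have "T ` Y \<subseteq> {y + e' |y e'. y \<in> Y \<and> e' \<in> span {e}}"
  proof (intro image_subsetI CollectI)
    fix y assume "y \<in> Y"
    then obtain t where "T y - t *\<^sub>K e \<in> Y" using T by blast
    then show "\<exists>y' e'. T y = y' + e' \<and> y' \<in> Y \<and> e' \<in> span {e}"
      by (intro exI[of _ "T y - t *\<^sub>K e"] exI[of _ "t *\<^sub>K e"]) (simp add: span_base span_scale)
  qed
  ultimately show ?thesis unfolding almost_invariant_halfspace_def
    using Y by (intro exI[of _ Y] conjI exI[of _ "span {e}"]) auto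
qed

lemma (in banach_over) op_minus: "bounded_op T \<Longrightarrow> T (- v) = - T v"
  using op_diff[of T 0 v] by (simp add: op_zero)

text \<open>
  If \<open>N\<close> is invertible, the iterates of its inverse at \<open>x\<close> form such a sequence. For \<open>N = T - a\<close> they are,
  from the first iterate on and up to sign, the Taylor coefficients at \<open>a\<close> of the resolvent applied to \<open>x\<close>.
\<close>
definition backward_orbit :: "('v::real_normed_vector \<Rightarrow> 'v) \<Rightarrow> 'v \<Rightarrow> bool" where
  "backward_orbit N x \<longleftrightarrow>
    (\<exists>z B C. 0 \<le> C \<and> z 0 = x \<and> (\<forall>j. N (z (Suc j)) = z j \<and> norm (z j) \<le> B * C^j))"

lemma backward_orbit_image:
  assumes "backward_orbit N x" and J: "\<And>v. N' (J v) = J (N v)" "0 \<le> K" "\<And>v. norm (J v) \<le> K * norm v"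
  shows "backward_orbit N' (J x)"
proof -
  obtain z B C where z: "0 \<le> C" "z 0 = x" "\<And>j. N (z (Suc j)) = z j" "\<And>j. norm (z j) \<le> B * C^j"
    using assms(1) unfolding backward_orbit_def by blast
  have "norm (J (z j)) \<le> (K * B) * C^j" for j
    using order_trans[OF J(3)[of "z j"] mult_left_mono[OF z(4)[of j] J(2)]] by (simp add: mult.assoc)
  then show ?thesis unfolding backward_orbit_def using z(1,2,3)
    by (intro exI[of _ "\<lambda>j. J (z j)"] exI[of _ "K * B"] exI[of _ C]) (simp add: J(1))
qed

context dual_operator
begin

text \<open>
  Since \<open>m - T = (m - a) - (T - a)\<close>, it divides \<open>(m - a)\<^sup>k - (T - a)\<^sup>k\<close> as a polynomial in \<open>T\<close>.
\<close>
lemma power_minus_shift_power: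
  "\<exists>B\<ge>0. \<forall>y. \<exists>p. m *\<^sub>R p - T p = (m - a)^k *\<^sub>R y - (shift a ^^ k) y \<and> norm p \<le> B * norm y"
proof (induction k)
  case 0
  have "\<forall>y. \<exists>p. m *\<^sub>R p - T p = (m - a)^0 *\<^sub>R y - (shift a ^^ 0) y \<and> norm p \<le> 0 * norm y"
    by (intro allI exI[of _ 0]) (simp add: X.op_zero[OF T])
  then show ?case by blast
next
  case (Suc k)
  then obtain B where B: "B \<ge> 0" "\<forall>y. \<exists>p. m *\<^sub>R p - T p = (m - a)^k *\<^sub>R y - (shift a ^^ k) y \<and> norm p \<le> B * norm y" by blast
  obtain K where K: "K > 0" "\<And>v. norm ((shift a ^^ k) v) \<le> K * norm v" using X.op_bound[OF op_shift_pow] by blast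
  have "\<exists>p'. m *\<^sub>R p' - T p' = (m - a)^Suc k *\<^sub>R y - (shift a ^^ Suc k) y \<and> norm p' \<le> (\<bar>m - a\<bar> * B + K) * norm y" for y
  proof -
    obtain p where p: "m *\<^sub>R p - T p = (m - a)^k *\<^sub>R y - (shift a ^^ k) y" "norm p \<le> B * norm y" using B(2) by blast
    define p' where "p' = (m - a) *\<^sub>R p + (shift a ^^ k) y"
    have "m *\<^sub>R p' - T p' = (m - a) *\<^sub>R (m *\<^sub>R p - T p) + (m *\<^sub>R (shift a ^^ k) y - T ((shift a ^^ k) y))"
      by (simp add: p'_def X.op_add[OF T] X.op_diff[OF T] X.op_scaleR[OF T] algebra_simps)
    also have "m *\<^sub>R (shift a ^^ k) y - T ((shift a ^^ k) y) = (m - a) *\<^sub>R (shift a ^^ k) y - (shift a ^^ Suc k) y"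
      by (simp add: shift_def algebra_simps)
    finally have "m *\<^sub>R p' - T p' = (m - a)^Suc k *\<^sub>R y - (shift a ^^ Suc k) y"
      unfolding p(1) by (simp only: scaleR_diff_right scaleR_scaleR power_Suc) simp
    moreover have "norm p' \<le> (\<bar>m - a\<bar> * B + K) * norm y"
    proof -
      have "norm p' \<le> \<bar>m - a\<bar> * norm p + norm ((shift a ^^ k) y)"
        unfolding p'_def using norm_triangle_ineq[of "(m - a) *\<^sub>R p" "(shift a ^^ k) y"] by simp
      also have "\<dots> \<le> \<bar>m - a\<bar> * (B * norm y) + K * norm y"
        by (intro add_mono mult_left_mono p(2) K(2)) simp
      finally show ?thesis by (simp add: algebra_simps)
    qed
    ultimately show ?thesis by blast
  qed
  then show ?case using B(1) K(1) by (intro exI[of _ "\<bar>m - a\<bar> * B + K"]) auto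
qed

text \<open>
  On the range hull of the stable index \<open>k\<close> the operators \<open>m - T\<close> with \<open>m\<close> near \<open>a\<close>, including \<open>a\<close> itself,
  are invertible with a common bound. For \<open>m = a\<close> the inverse generates backward orbits. For \<open>m \<noteq> a\<close>
  the equation \<open>m x - T x = y\<close> is solvable in the whole space, because \<open>m - T\<close> divides
  \<open>(m - a)\<^sup>k - (T - a)\<^sup>k\<close> and the second power maps into the range hull; and an eigenvector for \<open>m\<close> would lie in the
  range hull.
\<close>
theorem no_AIH_imp_isolated:
  assumes no: "\<not> D.has_AIH A" and a: "a \<in> closure {l. \<exists>R. X.is_resolvent T l R}"
  shows "finite_dim scX {x. shift a x = 0}"
    and "\<exists>\<epsilon>>0. \<forall>m. m \<noteq> a \<longrightarrow> \<bar>m - a\<bar> < \<epsilon> \<longrightarrow> (\<exists>R. X.is_resolvent T m R)"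
    and "\<exists>k. \<forall>x. backward_orbit (shift a) ((shift a ^^ k) x)"
proof -
  have noX: "\<not> X.has_AIH T" using no AIH_annihilator by blast
  show "finite_dim scX {x. shift a x = 0}"
    using X.AIH_of_infinite_dim_eigenspace[OF T, of a] noX by (auto simp: shift_def)
  obtain l where l: "\<And>n. \<exists>R. X.is_resolvent T (l n) R" "l \<longlonglongrightarrow> a" using a by (auto simp: closure_sequential)
  then obtain R where R: "\<And>n. X.is_resolvent T (l n) (R n)" by metis
  obtain k where k: "gen_kernel a k = gen_kernel a (Suc k)"
    using AIH_of_strict_chain[OF _ l(2) R] noX by blast
  let ?Z = "range_hull a k"
  obtain C where C: "C > 0" "\<And>n z. z \<in> ?Z \<Longrightarrow> norm (R n z) \<le> C * norm z"
    using resolvents_bounded_on_range_hull[OF k no l(2) R] by metis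
  obtain n where n: "\<bar>l n - a\<bar> * C \<le> 1/4"
  proof -
    have "\<forall>\<^sub>F n in sequentially. dist (l n) a < 1 / (4 * C)" using C(1) by (intro tendstoD[OF l(2)]) simp
    then obtain n where "dist (l n) a < 1 / (4 * C)" by (auto dest: eventually_happens)
    then show thesis using C(1) by (intro that[of n]) (simp add: dist_real_def field_simps)
  qed
  have near: "\<bar>m - l n\<bar> * C \<le> 1/2" if "\<bar>m - a\<bar> * C \<le> 1/4" for m
  proof -
    have "\<bar>m - l n\<bar> * C \<le> (\<bar>m - a\<bar> + \<bar>l n - a\<bar>) * C" using C(1) by (intro mult_right_mono) auto
    then show ?thesis using that n by (simp add: distrib_right)
  qed
  have solve: "\<exists>w\<in>?Z. m *\<^sub>R w - T w = z \<and> norm w \<le> 2 * C * norm z"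
    if "\<bar>m - a\<bar> * C \<le> 1/4" "z \<in> ?Z" for m z
    by (rule X.solve_nearby[OF T subspace_range_hull closed_range_hull is_resolvent_range_hull[OF R] R C near[OF that(1)] that(2)])
  show "\<exists>k. \<forall>x. backward_orbit (shift a) ((shift a ^^ k) x)"
  proof (intro exI[of _ k] allI)
    have "\<exists>v. v \<in> ?Z \<and> shift a v = z \<and> norm v \<le> 2 * C * norm z" if z: "z \<in> ?Z" for z
    proof -
      obtain w where "w \<in> ?Z" "a *\<^sub>R w - T w = z" "norm w \<le> 2 * C * norm z" using solve[OF _ z, of a] by auto
      then show ?thesis
        by (intro exI[of _ "- w"]) (auto simp: shift_def X.op_minus[OF T] X.subspace_neg[OF subspace_range_hull])
    qed
    then obtain g where g: "\<And>z. z \<in> ?Z \<Longrightarrow> g z \<in> ?Z \<and> shift a (g z) = z \<and> norm (g z) \<le> 2 * C * norm z" by metis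
    fix x
    define z where "z j = (g ^^ j) ((shift a ^^ k) x)" for j
    have zS: "z (Suc j) = g (z j)" for j by (simp add: z_def)
    have zZ: "z j \<in> ?Z" for j by (induction j) (use g range_in_range_hull in \<open>auto simp: z_def\<close>)
    have "norm (z j) \<le> norm (z 0) * (2 * C)^j" for j
    proof (induction j)
      case (Suc j)
      have "norm (z (Suc j)) \<le> 2 * C * norm (z j)" using g[OF zZ[of j]] by (simp add: zS)
      also have "\<dots> \<le> 2 * C * (norm (z 0) * (2 * C)^j)" using C(1) Suc by (intro mult_left_mono) auto
      finally show ?case by (simp add: mult_ac)
    qed simp
    moreover have "z 0 = (shift a ^^ k) x" by (simp add: z_def)
    ultimately show "backward_orbit (shift a) ((shift a ^^ k) x)"
      unfolding backward_orbit_def using g[OF zZ] C(1)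
      by (intro exI[of _ z] exI[of _ "norm (z 0)"] exI[of _ "2 * C"]) (auto simp: zS)
  qed
  show "\<exists>\<epsilon>>0. \<forall>m. m \<noteq> a \<longrightarrow> \<bar>m - a\<bar> < \<epsilon> \<longrightarrow> (\<exists>R. X.is_resolvent T m R)"
  proof (intro exI[of _ "1 / (4 * C)"] conjI allI impI)
    show "1 / (4 * C) > 0" using C(1) by simp
    fix m assume m: "m \<noteq> a" "\<bar>m - a\<bar> < 1 / (4 * C)"
    have mC: "\<bar>m - a\<bar> * C \<le> 1/4" using m(2) C(1) by (simp add: field_simps)
    obtain B where B: "B \<ge> 0" "\<forall>y. \<exists>p. m *\<^sub>R p - T p = (m - a)^k *\<^sub>R y - (shift a ^^ k) y \<and> norm p \<le> B * norm y"
      using power_minus_shift_power[of m a k] by blast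
    obtain K where K: "K > 0" "\<And>v. norm ((shift a ^^ k) v) \<le> K * norm v" using X.op_bound[OF op_shift_pow] by blast
    show "\<exists>R. X.is_resolvent T m R"
    proof (rule X.is_resolventI[OF T])
      fix y
      obtain p where p: "m *\<^sub>R p - T p = (m - a)^k *\<^sub>R y - (shift a ^^ k) y" "norm p \<le> B * norm y" using B(2) by blast
      obtain w where w: "m *\<^sub>R w - T w = (shift a ^^ k) y" "norm w \<le> 2 * C * norm ((shift a ^^ k) y)"
        using solve[OF mC range_in_range_hull] by blast
      define x where "x = inverse ((m - a)^k) *\<^sub>R (p + w)"
      have "m *\<^sub>R x - T x = inverse ((m - a)^k) *\<^sub>R ((m *\<^sub>R p - T p) + (m *\<^sub>R w - T w))"
        by (simp add: x_def X.op_add[OF T] X.op_scaleR[OF T] algebra_simps)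
      also have "\<dots> = y" using m(1) by (simp add: p(1) w(1))
      finally have "m *\<^sub>R x - T x = y" .
      moreover have "norm x \<le> inverse (\<bar>m - a\<bar>^k) * (B + 2 * C * K) * norm y"
      proof -
        have "norm (p + w) \<le> B * norm y + 2 * C * (K * norm y)"
          using norm_triangle_ineq[of p w] p(2) w(2) mult_left_mono[OF K(2)[of y], of "2 * C"] C(1) by linarith
        then have "inverse (\<bar>m - a\<bar>^k) * norm (p + w) \<le> inverse (\<bar>m - a\<bar>^k) * (B * norm y + 2 * C * (K * norm y))"
          by (intro mult_left_mono) auto
        also have "inverse (\<bar>m - a\<bar>^k) * norm (p + w) = norm x" by (simp add: x_def power_abs)
        finally show ?thesis by (simp add: algebra_simps)
      qed
      ultimately show "\<exists>x. m *\<^sub>R x - T x = y \<and> norm x \<le> inverse (\<bar>m - a\<bar>^k) * (B + 2 * C * K) * norm y" by blast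
    next
      fix x assume x: "m *\<^sub>R x = T x"
      have sh: "shift a x = (m - a) *\<^sub>R x" using x by (simp add: shift_def algebra_simps)
      have "(shift a ^^ j) x = (m - a)^j *\<^sub>R x" for j
        by (induction j) (simp_all add: sh X.op_scaleR[OF op_shift])
      then have "(m - a)^k *\<^sub>R x \<in> ?Z" using range_in_range_hull[of k a x] by simp
      from X.subspace_scaleR[OF subspace_range_hull this, of "inverse ((m - a)^k)"]
      have xZ: "x \<in> ?Z" using m(1) by simp
      have opR: "X.bounded_op (R n)" and RL: "R n (l n *\<^sub>R x - T x) = x" using R[of n] by (auto simp: X.is_resolvent_def)
      have "x = (l n - m) *\<^sub>R R n x"
        using RL unfolding x[symmetric] by (simp add: X.op_scaleR[OF opR] flip: scaleR_diff_left)
      then have "norm x = \<bar>m - l n\<bar> * norm (R n x)" by (metis norm_scaleR abs_minus_commute)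
      also have "\<dots> \<le> \<bar>m - l n\<bar> * (C * norm x)" by (intro mult_left_mono C(2) xZ) simp
      also have "\<dots> = (\<bar>m - l n\<bar> * C) * norm x" by simp
      also have "\<dots> \<le> 1/2 * norm x" by (intro mult_right_mono near[OF mC]) simp
      finally show "x = 0" by simp
    qed
  qed
qed

definition real_spectrum :: "real set" where "real_spectrum = {l. \<nexists>R. X.is_resolvent T l R}"

lemma real_spectrum_bounded: "bounded real_spectrum"
proof -
  obtain K where "\<And>l. K < \<bar>l\<bar> \<Longrightarrow> \<exists>R. X.is_resolvent T l R" using X.is_resolvent_large[OF T] by blast
  then show ?thesis by (intro boundedI[of _ K]) (force simp: real_spectrum_def not_less)
qed

theorem AIH_of_infinite_real_spectrum:
  assumes "infinite real_spectrum" shows "D.has_AIH A"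
proof (rule ccontr)
  assume no: "\<not> D.has_AIH A"
  obtain a where a: "a islimpt real_spectrum" "a \<in> closure (- real_spectrum)"
    using limit_point_and_resolvent_limit[OF assms real_spectrum_bounded] by blast
  have "- real_spectrum = {l. \<exists>R. X.is_resolvent T l R}" by (auto simp: real_spectrum_def)
  then have "a \<in> closure {l. \<exists>R. X.is_resolvent T l R}" using a(2) by simp
  from no_AIH_imp_isolated(2)[OF no this]
  obtain \<epsilon> where e: "\<epsilon> > 0" "\<And>m. m \<noteq> a \<Longrightarrow> \<bar>m - a\<bar> < \<epsilon> \<Longrightarrow> m \<notin> real_spectrum"
    unfolding real_spectrum_def by blast
  then show False using a(1) by (auto simp: islimpt_approachable dist_real_def)
qed

text \<open>
  One factor \<open>(T - a)\<^sup>k\<close> for each point of the spectrum. The factors commute, so a further factor does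
  not destroy the backward orbits at the other points.
\<close>
lemma product_of_shifts:
  assumes no: "\<not> D.has_AIH A" and fin: "finite real_spectrum"
  obtains Q where "X.bounded_op Q" "finite_dim scX {x. Q x = 0}"
    "\<And>a x. a \<in> real_spectrum \<Longrightarrow> backward_orbit (shift a) (Q x)"
proof -
  have "interior real_spectrum = {}" using fin by (rule empty_interior_finite)
  then have "closure (- real_spectrum) = UNIV" by (simp add: closure_complement)
  moreover have "- real_spectrum = {l. \<exists>R. X.is_resolvent T l R}" by (auto simp: real_spectrum_def)
  ultimately have cl: "a \<in> closure {l. \<exists>R. X.is_resolvent T l R}" for a by auto
  have "\<exists>Q. X.bounded_op Q \<and> finite_dim scX {x. Q x = 0} \<and>
    (\<forall>a\<in>S. \<forall>x. backward_orbit (shift a) (Q x))"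
    if "finite S" for S using that
  proof induction
    case empty
    have "X.bounded_op (\<lambda>x. x)" by (simp add: X.bounded_op_def bounded_linear_ident)
    moreover have "{x. x = 0} = {0}" by auto
    ultimately show ?case using X.finite_dim_zero by (intro exI[of _ "\<lambda>x. x"]) simp
  next
    case (insert b S)
    then obtain Q where Q: "X.bounded_op Q" "finite_dim scX {x. Q x = 0}"
      and ch: "\<And>a x. a \<in> S \<Longrightarrow> backward_orbit (shift a) (Q x)" by blast
    obtain k where k: "\<And>x. backward_orbit (shift b) ((shift b ^^ k) x)"
      using no_AIH_imp_isolated(3)[OF no cl, of b] by blast
    have ker: "finite_dim scX {x. (shift b ^^ i) x = 0}" for i
    proof (induction i)
      case 0
      have "{x. x = 0} = {0 :: 'x}" by auto
      then show ?case using X.finite_dim_zero by simp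
    next
      case (Suc i)
      have "{x. (shift b ^^ Suc i) x = 0} = {x. shift b x \<in> {x. (shift b ^^ i) x = 0}}"
        by (simp add: funpow_Suc_right del: funpow.simps)
      then show ?case using X.finite_dim_vimage[OF op_shift no_AIH_imp_isolated(1)[OF no cl] Suc] by simp
    qed
    show ?case
    proof (intro exI[of _ "\<lambda>x. (shift b ^^ k) (Q x)"] conjI ballI allI)
      show "X.bounded_op (\<lambda>x. (shift b ^^ k) (Q x))" by (rule X.op_compose[OF op_shift_pow Q(1)])
      show "finite_dim scX {x. (shift b ^^ k) (Q x) = 0}"
        using X.finite_dim_vimage[OF Q ker[of k]] by simp
      fix a x assume a: "a \<in> insert b S"
      show "backward_orbit (shift a) ((shift b ^^ k) (Q x))"
      proof (cases "a = b")
        case False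
        obtain K where K: "K > 0" "\<And>v. norm ((shift b ^^ k) v) \<le> K * norm v" using X.op_bound[OF op_shift_pow] by blast
        show ?thesis
        proof (rule backward_orbit_image[where J = "shift b ^^ k" and K = K])
          show "backward_orbit (shift a) (Q x)" using ch[of a x] a False by blast
          show "shift a ((shift b ^^ k) v) = (shift b ^^ k) (shift a v)" for v
            by (simp add: shift_def[of a] shift_pow_T X.op_diff[OF op_shift_pow] X.op_scaleR[OF op_shift_pow])
        qed (use K in auto)
      qed (simp add: k)
    qed
  qed
  from this[OF fin] obtain Q where Q: "X.bounded_op Q" "finite_dim scX {x. Q x = 0}"
    "\<forall>a\<in>real_spectrum. \<forall>x. backward_orbit (shift a) (Q x)"
    by blast
  show thesis by (rule that[OF Q(1,2)]) (use Q(3) in blast)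
qed

end

section \<open>Real and complex Banach spaces\<close>

lemma sublinear_infdist:
  fixes M :: "'a::real_normed_vector set"
  assumes M: "subspace M" shows "sublinear (\<lambda>x. infdist x M)"
proof (rule sublinearI)
  have ne: "M \<noteq> {}" using subspace_0[OF M] by blast
  show "infdist (x + y) M \<le> infdist x M + infdist y M" for x y
  proof (rule field_le_epsilon)
    fix e :: real assume e: "0 < e"
    obtain m where m: "m \<in> M" "dist x m < infdist x M + e/2" using infdist_lessE[OF ne, of x "infdist x M + e/2"] e by auto
    obtain m' where m': "m' \<in> M" "dist y m' < infdist y M + e/2" using infdist_lessE[OF ne, of y "infdist y M + e/2"] e by auto
    have "infdist (x + y) M \<le> dist (x + y) (m + m')" by (intro infdist_le subspace_add[OF M] m m')
    also have "\<dots> \<le> dist x m + dist y m'" by (rule dist_triangle_add)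
    finally show "infdist (x + y) M \<le> infdist x M + infdist y M + e" using m(2) m'(2) by simp
  qed
  have le: "infdist (t *\<^sub>R x) M \<le> t * infdist x M" if t: "t > 0" for t x
  proof (rule field_le_epsilon)
    fix e :: real assume e: "0 < e"
    obtain m where m: "m \<in> M" "dist x m < infdist x M + e/t" using infdist_lessE[OF ne, of x "infdist x M + e/t"] e t by auto
    have "infdist (t *\<^sub>R x) M \<le> dist (t *\<^sub>R x) (t *\<^sub>R m)" by (intro infdist_le subspace_scale[OF M] m)
    also have "\<dots> = t * dist x m" using t by (simp add: dist_norm flip: scaleR_diff_right)
    also have "\<dots> \<le> t * (infdist x M + e/t)" using m(2) t by (intro mult_left_mono) auto
    finally show "infdist (t *\<^sub>R x) M \<le> t * infdist x M + e" using t by (simp add: distrib_left)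
  qed
  show "infdist (t *\<^sub>R x) M = t * infdist x M" if "0 \<le> t" for t x
  proof (cases "t = 0")
    case True
    then show ?thesis using subspace_0[OF M] by simp
  next
    case False
    then have t: "t > 0" using that by simp
    have "infdist x M \<le> inverse t * infdist (t *\<^sub>R x) M" using le[of "inverse t" "t *\<^sub>R x"] t by simp
    then show ?thesis using le[OF t, of x] t by (simp add: field_simps)
  qed
qed

lemma infdist_minus:
  fixes M :: "'a::real_normed_vector set"
  assumes M: "subspace M" shows "infdist (- x) M = infdist x M"
proof -
  have ne: "M \<noteq> {}" using subspace_0[OF M] by blast
  have "infdist (- x) M \<le> infdist x M" for x
  proof (rule field_le_epsilon)
    fix e :: real assume e: "0 < e"
    obtain m where m: "m \<in> M" "dist x m < infdist x M + e" using infdist_lessE[OF ne, of x "infdist x M + e"] e by auto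
    have "infdist (- x) M \<le> dist (- x) (- m)" by (intro infdist_le subspace_neg[OF M] m)
    then show "infdist (- x) M \<le> infdist x M + e" using m(2) by (simp add: dist_minus)
  qed
  from this[of x] this[of "- x"] show ?thesis by simp
qed

lemma infdist_le_norm_subspace:
  fixes M :: "'a::real_normed_vector set"
  assumes M: "subspace M" shows "infdist x M \<le> norm x"
  using infdist_le[OF subspace_0[OF M], of x] by simp

lemma distance_functional_real:
  fixes M :: "'a::real_normed_vector set"
  assumes M: "subspace M"
  obtains f where "linear f" "\<And>x. \<bar>f x\<bar> \<le> infdist x M" "f x0 = infdist x0 M"
proof -
  obtain f where f: "linear f" "\<And>x. f x \<le> infdist x M" "f x0 = infdist x0 M"
    using Hahn_Banach_real[OF sublinear_infdist[OF M], of x0] by metis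
  have "\<bar>f x\<bar> \<le> infdist x M" for x
    using f(2)[of x] f(2)[of "- x"] by (simp add: linear_neg[OF f(1)] infdist_minus[OF M])
  then show thesis using that f by blast
qed

lemma banach_over_scaleR: "banach_over (scaleR :: real \<Rightarrow> 'a::banach \<Rightarrow> 'a)"
proof
  fix M :: "'a set" and x0 :: 'a assume "module.subspace scaleR M"
  then have M: "subspace M" by (simp add: subspace_raw_def)
  obtain f where f: "linear f" "\<And>x. \<bar>f x\<bar> \<le> infdist x M" "f x0 = infdist x0 M"
    using distance_functional_real[OF M, of x0] by blast
  have "\<bar>f x\<bar> \<le> norm x" for x using order_trans[OF f(2) infdist_le_norm_subspace[OF M]] .
  moreover have "f m = 0" if "m \<in> M" for m using f(2)[of m] that by simp
  moreover have "module_hom scaleR (*) f"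
    using f(1) unfolding linear_def module_hom_iff_linear by (simp add: real_scaleR_def[abs_def])
  ultimately show "\<exists>\<gamma>. module_hom scaleR (*) \<gamma> \<and> (\<forall>v. norm (\<gamma> v) \<le> norm v) \<and> (\<forall>m\<in>M. \<gamma> m = 0) \<and> \<gamma> x0 = of_real (infdist x0 M)"
    using f(3) by (intro exI[of _ f]) auto
qed (simp_all add: algebra_simps)

lemma infdist_scaleC_le:
  fixes M :: "'a::complex_normed_vector set"
  assumes M: "module.subspace scaleC M" and c: "cmod c = 1"
  shows "infdist (c *\<^sub>C x) M \<le> infdist x M"
proof -
  interpret module "scaleC :: complex \<Rightarrow> 'a \<Rightarrow> 'a" by (rule module_scaleC)
  have ne: "M \<noteq> {}" using subspace_0[OF M] by blast
  show ?thesis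
  proof (rule field_le_epsilon)
    fix e :: real assume e: "0 < e"
    obtain m where m: "m \<in> M" "dist x m < infdist x M + e" using infdist_lessE[OF ne, of x "infdist x M + e"] e by auto
    have "infdist (c *\<^sub>C x) M \<le> dist (c *\<^sub>C x) (c *\<^sub>C m)" by (intro infdist_le subspace_scale[OF M] m)
    also have "\<dots> = dist x m" using c by (simp add: dist_norm norm_scaleC flip: scale_right_diff_distrib)
    finally show "infdist (c *\<^sub>C x) M \<le> infdist x M + e" using m(2) by simp
  qed
qed

text \<open>
  The real functional \<open>f\<close> is the real part of the complex functional \<open>g\<close>. The distance from \<open>M\<close> does not
  change under rotation, so it dominates not only the real part of \<open>g\<close> but also its modulus.
\<close>
lemma banach_over_scaleC: "banach_over (scaleC :: complex \<Rightarrow> 'a::cbanach \<Rightarrow> 'a)"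
proof (rule banach_over.intro[OF vector_space_scaleC], unfold_locales)
  interpret C: vector_space "scaleC :: complex \<Rightarrow> 'a \<Rightarrow> 'a" by (rule vector_space_scaleC)
  show "norm (c *\<^sub>C x) = norm c * norm x" for c and x :: 'a by (rule norm_scaleC)
  show "r *\<^sub>R x = of_real r *\<^sub>C x" for r and x :: 'a by (rule scaleR_scaleC)
  fix M :: "'a set" and x0 :: 'a assume CM: "module.subspace scaleC M"
  have M: "subspace M"
    using CM by (auto simp: subspace_def C.subspace_def scaleR_scaleC)
  obtain f where f: "linear f" "\<And>x. \<bar>f x\<bar> \<le> infdist x M" "f x0 = infdist x0 M"
    using distance_functional_real[OF M, of x0] by blast
  note lin = linear_add[OF f(1)] linear_diff[OF f(1)] linear_scale[OF f(1)]
  \<comment> \<open>\<open>f (\<i> x)\<close> enters with the sign that makes \<open>g\<close> complex-linear.\<close>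
  define g where "g x = Complex (f x) (- f (\<i> *\<^sub>C x))" for x
  have g_add: "g (x + y) = g x + g y" for x y by (simp add: g_def lin scaleC_add_right complex_eq_iff)
  have g_scale: "g (c *\<^sub>C x) = c * g x" for c x
  proof -
    have 1: "c *\<^sub>C x = Re c *\<^sub>R x + Im c *\<^sub>R (\<i> *\<^sub>C x)"
      by (simp add: scaleR_scaleC scaleC_scaleC scaleC_add_left[symmetric]) (metis complex_eq mult.commute)
    have 2: "\<i> *\<^sub>C c *\<^sub>C x = Re c *\<^sub>R (\<i> *\<^sub>C x) - Im c *\<^sub>R x"
      unfolding 1 by (simp add: scaleC_add_right scaleR_scaleC scaleC_scaleC mult_ac flip: C.scale_minus_left)
    show ?thesis unfolding g_def 2 by (subst 1) (simp add: lin complex_eq_iff)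
  qed
  have g_norm: "cmod (g x) \<le> infdist x M" for x
  proof (cases "g x = 0")
    case False
    define c where "c = cnj (sgn (g x))"
    have c: "cmod c = 1" using False by (simp add: c_def norm_sgn)
    have "c * g x = complex_of_real (cmod (g x))"
      unfolding c_def sgn_eq using False
      by (simp add: complex_norm_square power2_eq_square mult.commute flip: complex_norm_square)
    then have "cmod (g x) = Re (g (c *\<^sub>C x))" by (simp add: g_scale)
    also have "\<dots> = f (c *\<^sub>C x)" by (simp add: g_def)
    also have "\<dots> \<le> infdist (c *\<^sub>C x) M" using f(2)[of "c *\<^sub>C x"] by simp
    also have "\<dots> \<le> infdist x M" by (rule infdist_scaleC_le[OF CM c])
    finally show ?thesis .
  qed (simp add: infdist_nonneg)
  have "g x0 = of_real (infdist x0 M)"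
  proof -
    have re: "Re (g x0) = infdist x0 M" by (simp add: g_def f(3))
    have "(Re (g x0))\<^sup>2 + (Im (g x0))\<^sup>2 \<le> (infdist x0 M)\<^sup>2"
      using power_mono[OF g_norm[of x0], of 2] by (simp add: cmod_power2)
    then have "Im (g x0) = 0" by (simp add: re)
    then show ?thesis using re by (simp add: complex_eq_iff)
  qed
  moreover have "module_hom scaleC (*) g"
  by (intro module_hom.intro C.module_axioms module_mult module_hom_axioms.intro) (simp_all add: g_add g_scale)
  moreover have "cmod (g x) \<le> norm x" for x by (rule order_trans[OF g_norm infdist_le_norm_subspace[OF M]])
  moreover have "g m = 0" if "m \<in> M" for m using g_norm[of m] that by simp
  ultimately show "\<exists>\<gamma>. module_hom scaleC (*) \<gamma> \<and> (\<forall>v. norm (\<gamma> v) \<le> norm v) \<and> (\<forall>m\<in>M. \<gamma> m = 0) \<and> \<gamma> x0 = of_real (infdist x0 M)"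
    by (intro exI[of _ g]) auto
qed

interpretation RS: banach_over "scaleR :: real \<Rightarrow> 'a::banach \<Rightarrow> 'a" by (rule banach_over_scaleR)
interpretation CS: banach_over "scaleC :: complex \<Rightarrow> 'a::cbanach \<Rightarrow> 'a" by (rule banach_over_scaleC)

section \<open>Finite spectrum\<close>

lemma cblinfun_eqI: "(\<And>x. blinfun_of_cblinfun f x = blinfun_of_cblinfun g x) \<Longrightarrow> f = g"
  by (intro blinfun_of_cblinfun_inject[THEN iffD1] blinfun_eqI)

lemma scale_minus_apply: "blinfun_of_cblinfun (l *\<^sub>C id_cblinfun - U) x = l *\<^sub>C x - blinfun_of_cblinfun U x"
  by (simp add: minus_cblinfun.rep_eq blinfun.diff_left scaleC_cblinfun_apply id_cblinfun.rep_eq)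

lemma notin_spectrum_iff:
  "l \<notin> spectrum U \<longleftrightarrow> (\<exists>R. \<forall>x. blinfun_of_cblinfun R (l *\<^sub>C x - blinfun_of_cblinfun U x) = x \<and>
    l *\<^sub>C blinfun_of_cblinfun R x - blinfun_of_cblinfun U (blinfun_of_cblinfun R x) = x)"
proof -
  have "f = id_cblinfun \<longleftrightarrow> (\<forall>x. blinfun_of_cblinfun f x = x)" for f :: "'a \<Rightarrow>\<^sub>C\<^sub>L 'a"
    by (auto simp: id_cblinfun.rep_eq intro: cblinfun_eqI)
  then show ?thesis by (auto simp: spectrum_def cblinfun_compose.rep_eq scale_minus_apply)
qed

text \<open>
  A scalar function of the form \<open>\<gamma> (R(l) z0)\<close> is holomorphic off the spectrum and tends to zero at
  infinity. Near a point \<open>a\<close> of the spectrum the backward orbit \<open>z\<close> bounds it, since iterating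
  \<open>R(l) z\<^sub>j = (l - a) R(l) z\<^sub>j\<^sub>+\<^sub>1 - z\<^sub>j\<^sub>+\<^sub>1\<close> expresses \<open>R(l) z\<^sub>0\<close> by a geometric series and a
  vanishing remainder. So it extends to an entire function, which is zero by Liouville's theorem.
\<close>
theorem zero_if_backward_orbits:
  fixes U :: "'b::cbanach \<Rightarrow>\<^sub>C\<^sub>L 'b"
  defines "u \<equiv> blinfun_of_cblinfun U"
  assumes fin: "finite (spectrum U)"
    and orbit: "\<And>a. a \<in> spectrum U \<Longrightarrow> backward_orbit (\<lambda>x. u x - a *\<^sub>C x) z0"
  shows "z0 = 0"
proof -
  let ?\<sigma> = "spectrum U"
  have "\<forall>l. l \<notin> ?\<sigma> \<longrightarrow> (\<exists>R. bounded_linear R \<and> (\<forall>x. l *\<^sub>C R x - u (R x) = x) \<and> (\<forall>x. R (l *\<^sub>C x - u x) = x))"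
  proof (intro allI impI)
    fix l assume "l \<notin> ?\<sigma>"
    then obtain R where "\<forall>x. blinfun_of_cblinfun R (l *\<^sub>C x - u x) = x \<and>
        l *\<^sub>C blinfun_of_cblinfun R x - u (blinfun_of_cblinfun R x) = x"
      unfolding notin_spectrum_iff u_def by blast
    then show "\<exists>R. bounded_linear R \<and> (\<forall>x. l *\<^sub>C R x - u (R x) = x) \<and> (\<forall>x. R (l *\<^sub>C x - u x) = x)"
      by (intro exI[of _ "blinfun_apply (blinfun_of_cblinfun R)"]) (simp add: blinfun.bounded_linear_right)
  qed
  then obtain r where r: "\<And>l. l \<notin> ?\<sigma> \<Longrightarrow> bounded_linear (r l)"
    "\<And>l x. l \<notin> ?\<sigma> \<Longrightarrow> l *\<^sub>C r l x - u (r l x) = x" "\<And>l x. l \<notin> ?\<sigma> \<Longrightarrow> r l (l *\<^sub>C x - u x) = x" by metis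
  have ops: "u (x + y) = u x + u y" "u (x - y) = u x - u y" "u (c *\<^sub>C x) = c *\<^sub>C u x" for x y c
    by (simp_all add: u_def blinfun.add_right blinfun.diff_right blinfun_of_cblinfun_scaleC)
  have r_scale: "r l (c *\<^sub>C x) = c *\<^sub>C r l x" if "l \<notin> ?\<sigma>" for l c x
  proof -
    have "c *\<^sub>C x = l *\<^sub>C (c *\<^sub>C r l x) - u (c *\<^sub>C r l x)"
      using arg_cong[OF r(2)[OF that, of x], of "scaleC c"]
      by (simp add: ops CS.scale_right_diff_distrib scaleC_scaleC mult.commute)
    then show ?thesis using r(3)[OF that] by metis
  qed
  have r_lin: "r l (x + y) = r l x + r l y" "r l (x - y) = r l x - r l y" "r l (sum g A) = (\<Sum>j\<in>A. r l (g j))"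
    if "l \<notin> ?\<sigma>" for l x y and g :: "nat \<Rightarrow> 'b" and A
    using bounded_linear.linear[OF r(1)[OF that]] by (simp_all add: linear_add linear_diff linear_sum)
  have resolvent_identity: "r m z0 = r l z0 + (l - m) *\<^sub>C r l (r m z0)" if "l \<notin> ?\<sigma>" "m \<notin> ?\<sigma>" for l m
  proof -
    define y where "y = r m z0"
    have "l *\<^sub>C y - u y = z0 + (l - m) *\<^sub>C y"
      using r(2)[OF that(2), of z0] by (simp add: y_def CS.scale_left_diff_distrib algebra_simps)
    from arg_cong[OF this, of "r l"] show ?thesis
      by (simp add: r(3)[OF that(1)] r_lin(1)[OF that(1)] r_scale[OF that(1)] flip: y_def)
  qed
  have "\<not> (UNIV :: complex set) \<subseteq> ?\<sigma>" using fin infinite_UNIV_char_0 finite_subset by blast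
  then obtain l0 where l0: "l0 \<notin> ?\<sigma>" by blast
  obtain \<gamma> where g: "CS.contraction \<gamma>" "\<gamma> (r l0 z0) = of_real (infdist (r l0 z0) {0})"
    using CS.separate[OF CS.subspace_single_0] by blast
  define \<phi> where "\<phi> l = \<gamma> (r l z0)" for l
  have open_resolvent: "open (- ?\<sigma>)" using fin by (simp add: finite_imp_closed open_Compl)
  have hol: "\<phi> holomorphic_on (UNIV - ?\<sigma>)"
  proof -
    have "\<exists>f'. (\<phi> has_field_derivative f') (at l)" if l: "l \<notin> ?\<sigma>" for l
    proof -
      obtain K where K: "K > 0" "\<And>x. norm (r l x) \<le> norm x * K" using bounded_linear.pos_bounded[OF r(1)[OF l]] by blast
      have ev\<sigma>: "\<forall>\<^sub>F m in at l. m \<notin> ?\<sigma>" using eventually_at_in_open'[OF open_resolvent, of l] l by simp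
      have "\<forall>\<^sub>F m in at l. dist m l < 1 / (2 * K)" using K(1) by (intro tendstoD[OF tendsto_ident_at]) simp
      then have bd: "\<forall>\<^sub>F m in at l. norm (r m z0 - r l z0) \<le> dist m l * (K * (2 * norm (r l z0)))"
        using ev\<sigma>
      proof eventually_elim
        case (elim m)
        have mK: "dist m l * K \<le> 1/2" using elim(1) K(1) by (simp add: field_simps)
        have diff: "norm (r m z0 - r l z0) \<le> dist m l * K * norm (r m z0)"
        proof -
          have "r m z0 - r l z0 = (l - m) *\<^sub>C r l (r m z0)" using resolvent_identity[OF l elim(2)] by (simp add: algebra_simps)
          then have "norm (r m z0 - r l z0) = dist m l * norm (r l (r m z0))"
            by (simp add: norm_scaleC dist_norm norm_minus_commute)
          also have "\<dots> \<le> dist m l * (norm (r m z0) * K)" by (intro mult_left_mono K(2)) simp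
          finally show ?thesis by (simp add: mult_ac)
        qed
        also have "\<dots> \<le> 1/2 * norm (r m z0)" by (intro mult_right_mono mK) simp
        finally have "norm (r m z0) \<le> 2 * norm (r l z0)"
          using norm_triangle_sub[of "r m z0" "r l z0"] by simp
        then have "dist m l * K * norm (r m z0) \<le> dist m l * K * (2 * norm (r l z0))"
          using K(1) by (intro mult_left_mono) auto
        then show ?case using diff by (simp add: mult.assoc)
      qed
      have "((\<lambda>m. dist m l * (K * (2 * norm (r l z0)))) \<longlongrightarrow> dist l l * (K * (2 * norm (r l z0)))) (at l)"
        by (intro tendsto_intros)
      then have "((\<lambda>m. r m z0 - r l z0) \<longlongrightarrow> 0) (at l)"
        by (intro Lim_null_comparison[OF bd]) simp
      then have "((\<lambda>m. r m z0) \<longlongrightarrow> r l z0) (at l)" by (rule LIM_zero_cancel)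
      then have lim: "((\<lambda>m. - \<gamma> (r l (r m z0))) \<longlongrightarrow> - \<gamma> (r l (r l z0))) (at l)"
        by (intro tendsto_minus CS.contraction_tendsto[OF g(1)] bounded_linear.tendsto[OF r(1)[OF l]])
      have "\<forall>\<^sub>F m in at l. - \<gamma> (r l (r m z0)) = (\<phi> m - \<phi> l) / (m - l)"
        using ev\<sigma> eventually_neq_at_within[of l l UNIV]
      proof eventually_elim
        case (elim m)
        have "\<phi> m - \<phi> l = (l - m) * \<gamma> (r l (r m z0))"
          unfolding \<phi>_def by (subst resolvent_identity[OF l elim(1)])
            (simp add: CS.contraction_add[OF g(1)] CS.contraction_scale[OF g(1)])
        then show ?case using elim(2) by (simp add: field_simps)
      qed
      from Lim_transform_eventually[OF lim this] show ?thesis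
        unfolding has_field_derivative_iff by blast
    qed
    then show ?thesis using open_resolvent by (simp add: holomorphic_on_open Compl_eq_Diff_UNIV)
  qed
  have bounded_near: "\<phi> \<in> O[at a](\<lambda>_. 1)" if a: "a \<in> ?\<sigma>" for a
  proof -
    obtain z B C where z: "C \<ge> 0" "z 0 = z0" "\<And>j. u (z (Suc j)) - a *\<^sub>C z (Suc j) = z j" "\<And>j. norm (z j) \<le> B * C^j"
      using orbit[OF a] unfolding backward_orbit_def by blast
    have B: "B \<ge> 0" using z(4)[of 0] order_trans[OF norm_ge_zero] by simp
    have "closed (?\<sigma> - {a})" using fin by (intro finite_imp_closed) simp
    then have "open (- (?\<sigma> - {a}))" by (rule open_Compl)
    then have "\<forall>\<^sub>F l in at a. l \<in> - (?\<sigma> - {a})" by (intro eventually_at_in_open') auto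
    moreover have "\<forall>\<^sub>F l in at a. dist l a < 1 / (2 * (C + 1))" using z(1) by (intro tendstoD[OF tendsto_ident_at]) simp
    ultimately have "\<forall>\<^sub>F l in at a. norm (\<phi> l) \<le> (2 * B * C) * norm (1::complex)"
      using eventually_neq_at_within[of a a UNIV]
    proof eventually_elim
      case (elim l)
      then have l: "l \<notin> ?\<sigma>" by blast
      have lC: "norm (l - a) * C \<le> 1/2"
      proof -
        have "norm (l - a) * (C + 1) \<le> 1/2" using elim(2) z(1) by (simp add: dist_norm field_simps)
        moreover have "norm (l - a) * C \<le> norm (l - a) * (C + 1)" by (intro mult_left_mono) auto
        ultimately show ?thesis by linarith
      qed
      have step: "l *\<^sub>C z (Suc j) - u (z (Suc j)) = (l - a) *\<^sub>C z (Suc j) - z j" for j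
        using z(3)[of j] by (simp add: CS.scale_left_diff_distrib algebra_simps)
      have "r l z0 = (l - a)^n *\<^sub>C r l (z n) - (\<Sum>j<n. (l - a)^j *\<^sub>C z (Suc j))" for n
      proof (induction n)
        case 0
        then show ?case by (simp add: z(2))
      next
        case (Suc n)
        have "z (Suc n) = r l ((l - a) *\<^sub>C z (Suc n) - z n)" using r(3)[OF l, of "z (Suc n)"] unfolding step by simp
        then have "r l (z n) = (l - a) *\<^sub>C r l (z (Suc n)) - z (Suc n)"
          by (simp only: r_lin[OF l] r_scale[OF l] eq_diff_eq add.commute)
        then have "(l - a)^n *\<^sub>C r l (z n) = (l - a)^Suc n *\<^sub>C r l (z (Suc n)) - (l - a)^n *\<^sub>C z (Suc n)"
          by (simp only: CS.scale_right_diff_distrib scaleC_scaleC power_Suc2)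
        then show ?case using Suc by simp
      qed
      moreover obtain K where K: "K > 0" "\<And>x. norm (r l x) \<le> norm x * K" using bounded_linear.pos_bounded[OF r(1)[OF l]] by blast
      ultimately have "norm (r l z0) \<le> (B * K) * (1/2)^n + 2 * B * C" for n
      proof -
        have pw: "norm (l - a)^j * C^j \<le> (1/2)^j" for j
          using power_mono[OF lC, of j] z(1) by (simp add: power_mult_distrib)
        have "norm ((l - a)^n *\<^sub>C r l (z n)) \<le> norm (l - a)^n * ((B * C^n) * K)"
          using K(1) z(4)[of n] by (auto simp: norm_scaleC norm_power intro!: mult_left_mono order_trans[OF K(2)] mult_right_mono)
        also have "\<dots> = (B * K) * (norm (l - a)^n * C^n)" by simp
        also have "\<dots> \<le> (B * K) * (1/2)^n" using B K(1) by (intro mult_left_mono pw) auto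
        finally have 1: "norm ((l - a)^n *\<^sub>C r l (z n)) \<le> (B * K) * (1/2)^n" .
        have "norm (\<Sum>j<n. (l - a)^j *\<^sub>C z (Suc j)) \<le> (\<Sum>j<n. (B * C) * (1/2)^j)"
        proof (rule sum_norm_le)
          fix j
          have "norm ((l - a)^j *\<^sub>C z (Suc j)) \<le> norm (l - a)^j * (B * C^Suc j)"
            using z(4)[of "Suc j"] by (simp add: norm_scaleC norm_power mult_left_mono)
          also have "\<dots> = (B * C) * (norm (l - a)^j * C^j)" by simp
          also have "\<dots> \<le> (B * C) * (1/2)^j" using B z(1) by (intro mult_left_mono pw) auto
          finally show "norm ((l - a)^j *\<^sub>C z (Suc j)) \<le> (B * C) * (1/2)^j" .
        qed
        also have "\<dots> = (B * C) * (\<Sum>j<n. (1/2)^j)" by (simp add: sum_distrib_left)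
        also have "\<dots> \<le> (B * C) * 2" using B z(1) by (intro mult_left_mono) (auto simp: sum_gp_strict)
        finally have 2: "norm (\<Sum>j<n. (l - a)^j *\<^sub>C z (Suc j)) \<le> 2 * B * C" by simp
        have "norm (r l z0) \<le> norm ((l - a)^n *\<^sub>C r l (z n)) + norm (\<Sum>j<n. (l - a)^j *\<^sub>C z (Suc j))"
          by (subst \<open>\<And>n. r l z0 = _ n\<close>[of n]) (rule norm_triangle_ineq4)
        then show ?thesis using 1 2 by simp
      qed
      moreover have "(\<lambda>n. (B * K) * (1/2)^n + 2 * B * C) \<longlonglongrightarrow> (B * K) * 0 + 2 * B * C"
        by (intro tendsto_intros LIMSEQ_power_zero) simp
      ultimately have "norm (r l z0) \<le> (B * K) * 0 + 2 * B * C" by (intro LIMSEQ_le_const) auto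
      then show ?case using CS.contraction_norm[OF g(1), of "r l z0"] by (simp add: \<phi>_def)
    qed
    then show ?thesis by (rule bigoI)
  qed
  obtain h where h: "h holomorphic_on UNIV" "\<And>l. l \<notin> ?\<sigma> \<Longrightarrow> h l = \<phi> l"
    using removable_singularities[OF fin _ hol bounded_near] by auto
  obtain K where K: "K > 0" "\<And>x. norm (u x) \<le> norm x * K"
    using bounded_linear.pos_bounded[OF blinfun.bounded_linear_right[of "blinfun_of_cblinfun U"]]
    unfolding u_def by blast
  obtain N where N: "\<And>l. l \<in> ?\<sigma> \<Longrightarrow> norm l \<le> N" using finite_imp_bounded[OF fin] by (auto simp: bounded_iff)
  have "\<forall>\<^sub>F l in at_infinity. norm (h l) \<le> 2 * norm z0 * norm (inverse l)"
    unfolding eventually_at_infinity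
  proof (intro exI[of _ "\<bar>N\<bar> + 2 * K + 1"] allI impI)
    fix l :: complex assume l: "\<bar>N\<bar> + 2 * K + 1 \<le> norm l"
    then have l\<sigma>: "l \<notin> ?\<sigma>" using N[of l] K(1) by auto
    have "norm l * norm (r l z0) = norm (z0 + u (r l z0))"
      using r(2)[OF l\<sigma>, of z0] by (metis norm_scaleC diff_add_cancel)
    also have "\<dots> \<le> norm z0 + norm (r l z0) * K" by (intro order_trans[OF norm_triangle_ineq] add_left_mono K(2))
    also have "\<dots> \<le> norm z0 + norm (r l z0) * (norm l / 2)" using l K(1) by (intro add_left_mono mult_left_mono) auto
    finally have "norm l * norm (r l z0) \<le> 2 * norm z0" by (simp add: mult.commute[of "norm (r l z0)"])
    moreover have "norm l > 0" using l K(1) by auto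
    ultimately have "norm (r l z0) \<le> 2 * norm z0 * norm (inverse l)" by (simp only: norm_inverse) (simp add: field_simps)
    then show "norm (h l) \<le> 2 * norm z0 * norm (inverse l)"
      using CS.contraction_norm[OF g(1), of "r l z0"] by (simp add: h(2)[OF l\<sigma>] \<phi>_def)
  qed
  moreover have "((\<lambda>l::complex. 2 * norm z0 * norm (inverse l)) \<longlongrightarrow> 0) at_infinity"
    by (rule tendsto_mult_right_zero[OF tendsto_norm_zero[OF tendsto_inverse_0]])
  ultimately have "(h \<longlongrightarrow> 0) at_infinity" by (rule Lim_null_comparison)
  then have "h l0 = 0" by (rule Liouville_weak_0[OF h(1)])
  then have "r l0 z0 = 0" using h(2)[OF l0] g(2) by (simp add: \<phi>_def)
  then show "z0 = 0" using r(2)[OF l0, of z0] by (simp add: u_def blinfun.zero_right)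
qed

section \<open>Adjoints of bounded operators\<close>

lemma dual_operator_real:
  fixes S :: "'a::banach \<Rightarrow>\<^sub>L 'a"
  shows "dual_operator scaleR scaleR blinfun_apply (blinfun_apply S) (adjoint_op S)"
proof (rule dual_operator.intro[OF banach_over_scaleR banach_over_scaleR], unfold_locales)
  show "RS.bounded_op (blinfun_apply S)" by (simp add: RS.bounded_op_def blinfun.bounded_linear_right blinfun.scaleR_right)
  have "bounded_linear (\<lambda>f::'a \<Rightarrow>\<^sub>L real. f o\<^sub>L S)"
    by (rule bounded_bilinear.bounded_linear_left[OF bounded_bilinear_blinfun_compose])
  then show "RS.bounded_op (adjoint_op S)"
    using linear_scale[OF bounded_linear.linear] by (auto simp: RS.bounded_op_def adjoint_op_def[abs_def])
  show "norm (blinfun_apply f x) \<le> norm f * norm x" for f :: "'a \<Rightarrow>\<^sub>L real" and x by (rule norm_blinfun)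
  fix \<gamma> :: "'a \<Rightarrow> real" and B :: real
  assume g: "module_hom scaleR (*) \<gamma>" "0 \<le> B" "\<And>x. norm (\<gamma> x) \<le> B * norm x"
  have "bounded_linear \<gamma>"
    by (rule bounded_linear_intro[where K = B])
      (use g(3) in \<open>simp_all add: module_hom.add[OF g(1)] module_hom.scale[OF g(1)] mult.commute\<close>)
  then have "blinfun_apply (Blinfun \<gamma>) = \<gamma>" by (rule bounded_linear_Blinfun_apply)
  then show "\<exists>f. norm f \<le> B \<and> blinfun_apply f = \<gamma>"
    using g by (intro exI[of _ "Blinfun \<gamma>"]) (auto intro: norm_blinfun_bound)
qed (auto simp: blinfun.add_left blinfun.add_right blinfun.scaleR_left blinfun.scaleR_right norm_blinfun
    adjoint_op_def intro: blinfun_eqI)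

lemma dual_operator_complex:
  fixes T :: "'b::cbanach \<Rightarrow>\<^sub>C\<^sub>L 'b"
  shows "dual_operator scaleC scaleC (\<lambda>f. blinfun_apply (blinfun_of_cblinfun f))
    (blinfun_apply (blinfun_of_cblinfun T)) (cadjoint_op T)"
proof (rule dual_operator.intro[OF banach_over_scaleC banach_over_scaleC], unfold_locales)
  show "\<And>f g :: 'b \<Rightarrow>\<^sub>C\<^sub>L complex. (\<And>x. blinfun_of_cblinfun f x = blinfun_of_cblinfun g x) \<Longrightarrow> f = g"
    by (rule cblinfun_eqI)
  show "CS.bounded_op (blinfun_apply (blinfun_of_cblinfun T))"
    by (simp add: CS.bounded_op_def blinfun.bounded_linear_right blinfun_of_cblinfun_scaleC)
  have comp: "blinfun_of_cblinfun (cadjoint_op T f) x = blinfun_of_cblinfun f (blinfun_of_cblinfun T x)" for f x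
    by (simp add: cadjoint_op_def cblinfun_compose.rep_eq)
  show "\<And>f x. blinfun_of_cblinfun (cadjoint_op T f) x = blinfun_of_cblinfun f (blinfun_of_cblinfun T x)" by (rule comp)
  have scl: "cadjoint_op T (c *\<^sub>C f) = c *\<^sub>C cadjoint_op T f" for c f
    by (rule cblinfun_eqI) (simp add: comp scaleC_cblinfun_apply)
  have "bounded_linear (cadjoint_op T)"
  proof (rule bounded_linear_intro)
    show "cadjoint_op T (f + g) = cadjoint_op T f + cadjoint_op T g" for f g
      by (rule cblinfun_eqI) (simp add: comp plus_cblinfun.rep_eq blinfun.add_left)
    show "cadjoint_op T (c *\<^sub>R f) = c *\<^sub>R cadjoint_op T f" for c f by (simp add: scaleR_scaleC scl)
    show "norm (cadjoint_op T f) \<le> norm f * norm T" for f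
      unfolding cadjoint_op_def norm_cblinfun.rep_eq cblinfun_compose.rep_eq by (rule norm_blinfun_compose)
  qed
  then show "CS.bounded_op (cadjoint_op T)" by (simp add: CS.bounded_op_def scl)
  fix \<gamma> :: "'b \<Rightarrow> complex" and B :: real
  assume g: "module_hom scaleC (*) \<gamma>" "0 \<le> B" "\<And>x. norm (\<gamma> x) \<le> B * norm x"
  have "bounded_linear \<gamma>"
    by (rule bounded_linear_intro[where K = B])
      (use g(3) in \<open>simp_all add: module_hom.add[OF g(1)] module_hom.scale[OF g(1)] scaleR_scaleC scaleC_complex_def mult.commute\<close>)
  then have app: "blinfun_apply (Blinfun \<gamma>) = \<gamma>" by (rule bounded_linear_Blinfun_apply)
  have rep: "blinfun_of_cblinfun (cblinfun_of_blinfun (Blinfun \<gamma>)) = Blinfun \<gamma>"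
    by (rule cblinfun_of_blinfun_inverse) (simp add: app module_hom.scale[OF g(1)] scaleC_complex_def)
  show "\<exists>f. norm f \<le> B \<and> blinfun_apply (blinfun_of_cblinfun f) = \<gamma>"
    using g by (intro exI[of _ "cblinfun_of_blinfun (Blinfun \<gamma>)"])
      (auto simp: rep app norm_cblinfun.rep_eq intro: norm_blinfun_bound)
qed (auto simp: plus_cblinfun.rep_eq blinfun.add_left blinfun.add_right scaleC_cblinfun_apply
    blinfun_of_cblinfun_scaleC scaleC_complex_def norm_cblinfun.rep_eq norm_blinfun)

lemma spectrum_real_imp_real_spectrum:
  fixes S :: "'a::banach \<Rightarrow>\<^sub>L 'a"
  assumes "of_real l \<in> spectrum_real S" shows "\<nexists>R. RS.is_resolvent (blinfun_apply S) l R"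
proof
  assume "\<exists>R. RS.is_resolvent (blinfun_apply S) l R"
  then obtain R where R: "bounded_linear R" "\<And>x. l *\<^sub>R R x - S (R x) = x" "\<And>x. R (l *\<^sub>R x - S x) = x"
    by (auto simp: RS.is_resolvent_def RS.bounded_op_def)
  define C where "C = complexify_op (Blinfun R)"
  have R0: "R 0 = 0" using linear_0[OF bounded_linear.linear[OF R(1)]] .
  have Cx: "blinfun_of_cblinfun C w = Oplus (R (re_part w)) (R (im_part w))" for w
    by (simp add: C_def complexify_op.rep_eq complexify_blinfun.rep_eq bounded_linear_Blinfun_apply[OF R(1)])
  have "of_real l \<notin> spectrum (complexify_op S)"
    unfolding notin_spectrum_iff
    by (intro exI[of _ C] allI) (simp add: Cx R complexify_op.rep_eq complexify_blinfun.rep_eq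
      minus_complexification_def scaleC_complexification_def)
  then show False using assms by (simp add: spectrum_real_def)
qed

lemma spectrum_imp_real_spectrum:
  fixes T :: "'b::cbanach \<Rightarrow>\<^sub>C\<^sub>L 'b"
  assumes "of_real l \<in> spectrum T" shows "\<nexists>R. CS.is_resolvent (blinfun_apply (blinfun_of_cblinfun T)) l R"
proof
  assume "\<exists>R. CS.is_resolvent (blinfun_apply (blinfun_of_cblinfun T)) l R"
  then obtain R where R: "bounded_linear R" "\<And>c x. R (c *\<^sub>C x) = c *\<^sub>C R x"
    "\<And>x. l *\<^sub>R R x - blinfun_of_cblinfun T (R x) = x" "\<And>x. R (l *\<^sub>R x - blinfun_of_cblinfun T x) = x"
    by (auto simp: CS.is_resolvent_def CS.bounded_op_def)
  define C where "C = cblinfun_of_blinfun (Blinfun R)"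
  have Cx: "blinfun_of_cblinfun C x = R x" for x
    unfolding C_def by (subst cblinfun_of_blinfun_inverse) (simp_all add: bounded_linear_Blinfun_apply[OF R(1)] R(2))
  have "of_real l \<notin> spectrum T"
    unfolding notin_spectrum_iff by (intro exI[of _ C] allI) (simp add: Cx R flip: scaleR_scaleC)
  then show False using assms by simp
qed

text \<open>
  If there were no halfspace, the vectors \<open>Q x\<close> would vanish as elements of the complexification,
  into which the real backward orbits embed.
\<close>
theorem real_adjoint_halfspace:
  fixes S :: "'a::banach \<Rightarrow>\<^sub>L 'a"
  assumes inf: "\<not> finite_dim scaleR (UNIV :: 'a set)"
    and spec: "spectrum_real S \<subseteq> \<real> \<or> infinite (spectrum_real S \<inter> \<real>)"
  shows "\<exists>Y. almost_invariant_halfspace scaleR (adjoint_op S) 1 Y"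
proof -
  interpret dual_operator scaleR scaleR blinfun_apply "blinfun_apply S" "adjoint_op S" by (rule dual_operator_real)
  have sub: "spectrum_real S \<inter> \<real> \<subseteq> of_real ` real_spectrum"
    using spectrum_real_imp_real_spectrum[of _ S] by (auto simp: real_spectrum_def elim!: Reals_cases)
  have "RS.has_AIH (adjoint_op S)"
  proof (rule ccontr)
    assume no: "\<not> RS.has_AIH (adjoint_op S)"
    then have fin: "finite real_spectrum" using AIH_of_infinite_real_spectrum by blast
    then have fin': "finite (spectrum_real S \<inter> \<real>)" using sub finite_surj by blast
    then have real: "spectrum_real S \<subseteq> \<real>" using spec by blast
    obtain Q where Q: "RS.bounded_op Q" "finite_dim scaleR {x. Q x = 0}"
      "\<And>a x. a \<in> real_spectrum \<Longrightarrow> backward_orbit (shift a) (Q x)"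
      using product_of_shifts[OF no fin] by blast
    have "Q x = 0" for x
    proof -
      have "Oplus (Q x) 0 = 0"
      proof (rule zero_if_backward_orbits)
        show "finite (spectrum (complexify_op S))" using fin' real by (simp add: spectrum_real_def Int_absorb2)
        fix a assume "a \<in> spectrum (complexify_op S)"
        then have "a \<in> of_real ` real_spectrum" using sub real by (auto simp: spectrum_real_def)
        then obtain l where l: "a = of_real l" "l \<in> real_spectrum" by blast
        show "backward_orbit (\<lambda>w. blinfun_of_cblinfun (complexify_op S) w - a *\<^sub>C w) (Oplus (Q x) 0)"
        proof (rule backward_orbit_image[where J = "\<lambda>v. Oplus v 0" and K = 1, OF Q(3)[OF l(2), of x]])
          fix v
          show "blinfun_of_cblinfun (complexify_op S) (Oplus v 0) - a *\<^sub>C Oplus v 0 = Oplus (shift l v) 0"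
            by (simp add: complexify_op.rep_eq complexify_blinfun.rep_eq l(1) minus_complexification_def
              scaleC_complexification_def shift_def blinfun.zero_right)
          show "norm (Oplus v 0) \<le> 1 * norm v" using norm_complexification_le[of "Oplus v 0"] by simp
        qed simp
      qed
      then show ?thesis by (simp add: zero_complexification_def)
    qed
    then show False using Q(2) inf by simp
  qed
  then show ?thesis by (rule RS.AIH_imp_almost_invariant)
qed

theorem complex_adjoint_halfspace:
  fixes T :: "'b::cbanach \<Rightarrow>\<^sub>C\<^sub>L 'b"
  assumes inf: "\<not> finite_dim scaleC (UNIV :: 'b set)"
    and spec: "spectrum T \<subseteq> \<real> \<or> infinite (spectrum T \<inter> \<real>)"
  shows "\<exists>Y. almost_invariant_halfspace scaleC (cadjoint_op T) 1 Y"
proof -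
  interpret dual_operator scaleC scaleC "\<lambda>f. blinfun_apply (blinfun_of_cblinfun f)"
    "blinfun_apply (blinfun_of_cblinfun T)" "cadjoint_op T" by (rule dual_operator_complex)
  have sub: "spectrum T \<inter> \<real> \<subseteq> of_real ` real_spectrum"
    using spectrum_imp_real_spectrum[of _ T] by (auto simp: real_spectrum_def elim!: Reals_cases)
  have "CS.has_AIH (cadjoint_op T)"
  proof (rule ccontr)
    assume no: "\<not> CS.has_AIH (cadjoint_op T)"
    then have fin: "finite real_spectrum" using AIH_of_infinite_real_spectrum by blast
    then have fin': "finite (spectrum T \<inter> \<real>)" using sub finite_surj by blast
    then have real: "spectrum T \<subseteq> \<real>" using spec by blast
    obtain Q where Q: "CS.bounded_op Q" "finite_dim scaleC {x. Q x = 0}"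
      "\<And>a x. a \<in> real_spectrum \<Longrightarrow> backward_orbit (shift a) (Q x)"
      using product_of_shifts[OF no fin] by blast
    have "Q x = 0" for x
    proof (rule zero_if_backward_orbits)
      show "finite (spectrum T)" using fin' real by (simp add: Int_absorb2)
      fix a assume "a \<in> spectrum T"
      then have "a \<in> of_real ` real_spectrum" using sub real by blast
      then obtain l where l: "a = of_real l" "l \<in> real_spectrum" by blast
      show "backward_orbit (\<lambda>w. blinfun_of_cblinfun T w - a *\<^sub>C w) (Q x)"
        using Q(3)[OF l(2), of x] by (simp add: shift_def[abs_def] l(1) scaleR_scaleC)
    qed
    then show False using Q(2) inf by simp
  qed
  then show ?thesis by (rule CS.AIH_imp_almost_invariant)
qed

theorem theorem3p16:
  fixes S :: "'a::banach \<Rightarrow>\<^sub>L 'a" and T :: "'b::cbanach \<Rightarrow>\<^sub>C\<^sub>L 'b"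
  shows "(\<not> finite_dim scaleR (UNIV :: 'a set) \<and>
          (spectrum_real S \<subseteq> \<real> \<or> infinite (spectrum_real S \<inter> \<real>)) \<longrightarrow>
            (\<exists>Y. almost_invariant_halfspace scaleR (adjoint_op S) 1 Y)) \<and>
         (\<not> finite_dim scaleC (UNIV :: 'b set) \<and>
          (spectrum T \<subseteq> \<real> \<or> infinite (spectrum T \<inter> \<real>)) \<longrightarrow>
            (\<exists>Y. almost_invariant_halfspace scaleC (cadjoint_op T) 1 Y))"
  using real_adjoint_halfspace complex_adjoint_halfspace by blast

end
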